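(* Let $H$ be a separable real Hilbert space. (a) For each $\alpha\in(0,2]$ and each positive semi-definite trace class operator $Q\ne0$ on $H$ there is a symmetric $H$-valued strictly $\alpha$-stable Lévy process $Y$ with Lévy exponent $$\rho:H\to\mathbb C,\qquad u\mapsto-\langle Qu|u\rangle^{\alpha/2}.$$ Such a strictly $\alpha$-stable process is square integrable if and only if $\alpha=2$, and it is integrable and mean zero if and only if $\alpha>1$. (b) Let $\alpha\in\mathbb R_+$ and let $Y$ be a symmetric strictly $\alpha$-stable $H$-valued Lévy process which is non-trivial, i.e. $P(Y\neq0)>0$. Then $\alpha\in(0,2]$. Moreover, there is a symmetric continuous function $f:S_H\to\mathbb R_+$ (where $S_H:=\{x\in H:|x|=1\}$) such that the Lévy exponent $\rho$ of $Y$ satisfies $\rho(0)=0$ and $$\rho(u)=-|u|^\alpha f\left(\frac{u}{|u|}\right)\qquad\text{for all }u\in H\setminus\{0\}.$$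
   Context: $\mathbb R_+=[0,\infty)$. For $\alpha\in\mathbb R_+$, a stochastic process $Y$ is strictly $\alpha$-stable if $Y(t^\alpha)$ and $tY(1)$ have the same distribution for every $t\in\mathbb R_+$. The Lévy exponent of an $H$-valued Lévy process $Y$ is the function $\rho:H\to\mathbb C$ given by the Lévy–Khintchine formula, with $\mathrm{E}e^{i\langle u|Y(t)\rangle}=e^{t\rho(u)}$ for $t\ge0$, $u\in H$. $Y$ is symmetric if $Y$ and $-Y$ have the same law; $f$ symmetric means $f(-v)=f(v)$. $Y$ is integrable (square integrable) if $\mathrm{E}|Y(t)|<\infty$ (resp. $\mathrm{E}|Y(t)|^2<\infty$) for all $t\ge0$; mean zero means integrable with $\mathrm{E}Y(t)=0$ for all $t\ge0$. *)

theory Defs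
  imports "HOL-Probability.Probability"
begin

section \<open>Operators on a real Hilbert space\<close>

text \<open>On a real space a nonnegative quadratic form does not force symmetry, so symmetry is part
  of the definition.\<close>

definition pos_semidef :: "('a::real_inner \<Rightarrow> 'a) \<Rightarrow> bool" where
  "pos_semidef Q \<longleftrightarrow>
     bounded_linear Q \<and> (\<forall>x y. Q x \<bullet> y = x \<bullet> Q y) \<and> (\<forall>x. 0 \<le> Q x \<bullet> x)"

definition orthonormal_basis :: "'a::real_inner set \<Rightarrow> bool" where
  "orthonormal_basis B \<longleftrightarrow>
     pairwise orthogonal B \<and> (\<forall>e\<in>B. norm e = 1) \<and> closure (span B) = UNIV"

text \<open>\<open>A\<close> is the absolute value of \<open>Q\<close>, that is, the positive semi-definite square root of
  \<open>Q* Q\<close>.\<close>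

definition is_absolute_value :: "('a::real_inner \<Rightarrow> 'a) \<Rightarrow> ('a \<Rightarrow> 'a) \<Rightarrow> bool" where
  "is_absolute_value A Q \<longleftrightarrow> pos_semidef A \<and> A \<circ> A = adjoint Q \<circ> Q"

definition trace_class :: "('a::real_inner \<Rightarrow> 'a) \<Rightarrow> bool" where
  "trace_class Q \<longleftrightarrow> bounded_linear Q \<and>
     (\<exists>A B. is_absolute_value A Q \<and> orthonormal_basis B \<and> (\<lambda>e. A e \<bullet> e) summable_on B)"


section \<open>Levy processes with values in a separable Hilbert space\<close>

text \<open>Processes are indexed by \<open>real\<close>; only times \<open>t \<ge> 0\<close> are relevant.\<close>

locale levy_process = prob_space M
  for M :: "'w measure" and Y :: "real \<Rightarrow> 'w \<Rightarrow> 'a::{real_inner, banach, polish_space}" +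
  assumes random_variable: "\<And>t. 0 \<le> t \<Longrightarrow> Y t \<in> borel_measurable M"
    and start: "AE \<omega> in M. Y 0 \<omega> = 0"
    and indep_increments:
      "\<And>(n::nat) \<tau>. 0 \<le> \<tau> 0 \<Longrightarrow> (\<And>i. i < n \<Longrightarrow> \<tau> i < \<tau> (Suc i)) \<Longrightarrow>
         indep_vars (\<lambda>_. borel) (\<lambda>i \<omega>. Y (\<tau> (Suc i)) \<omega> - Y (\<tau> i) \<omega>) {..<n}"
    and stationary_increments:
      "\<And>s t. 0 \<le> s \<Longrightarrow> s \<le> t \<Longrightarrow>
         distr M borel (\<lambda>\<omega>. Y t \<omega> - Y s \<omega>) = distr M borel (Y (t - s))"
    and stochastically_continuous:
      "\<And>t \<epsilon>. 0 \<le> t \<Longrightarrow> 0 < \<epsilon> \<Longrightarrow>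
         ((\<lambda>s. prob {\<omega> \<in> space M. \<epsilon> < norm (Y s \<omega> - Y t \<omega>)}) \<longlongrightarrow> 0) (at t within {0..})"

definition process_law :: "'w measure \<Rightarrow> (real \<Rightarrow> 'w \<Rightarrow> 'a::topological_space) \<Rightarrow> (real \<Rightarrow> 'a) measure"
  where "process_law M Y = distr M (Pi\<^sub>M {0..} (\<lambda>_. borel)) (\<lambda>\<omega>. \<lambda>t\<in>{0..}. Y t \<omega>)"

definition symmetric_process :: "'w measure \<Rightarrow> (real \<Rightarrow> 'w \<Rightarrow> 'a::real_normed_vector) \<Rightarrow> bool"
  where "symmetric_process M Y \<longleftrightarrow> process_law M Y = process_law M (\<lambda>t \<omega>. - Y t \<omega>)"

text \<open>The library sets \<open>0 powr 0 = 0\<close>, so for \<open>\<alpha> = 0\<close> the exponent \<open>t powr \<alpha>\<close> differs from the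
  convention \<open>0\<^sup>0 = 1\<close> at \<open>t = 0\<close>. This is harmless: for \<open>\<alpha> = 0\<close> the instance \<open>t = 2\<close> already
  gives \<open>Y 1 = 0\<close> almost surely.\<close>

definition strictly_stable :: "real \<Rightarrow> 'w measure \<Rightarrow> (real \<Rightarrow> 'w \<Rightarrow> 'a::real_normed_vector) \<Rightarrow> bool"
  where "strictly_stable \<alpha> M Y \<longleftrightarrow>
    (\<forall>t\<ge>0. distr M borel (Y (t powr \<alpha>)) = distr M borel (\<lambda>\<omega>. t *\<^sub>R Y 1 \<omega>))"

text \<open>As the equation is required for all \<open>t \<ge> 0\<close>, it determines \<open>\<rho>\<close>; see \<open>levy_exponent_unique\<close>
  below.\<close>

definition levy_exponent ::
    "'w measure \<Rightarrow> (real \<Rightarrow> 'w \<Rightarrow> 'a::real_inner) \<Rightarrow> ('a \<Rightarrow> complex) \<Rightarrow> bool"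
  where "levy_exponent M Y \<rho> \<longleftrightarrow>
    (\<forall>t\<ge>0. \<forall>u. (\<integral>\<omega>. iexp (u \<bullet> Y t \<omega>) \<partial>M) = exp (complex_of_real t * \<rho> u))"

lemma levy_exponent_unique:
  assumes "levy_exponent M Y \<rho>" "levy_exponent M Y \<rho>'"
  shows "\<rho> = \<rho>'"
proof
  fix u
  define d where "d = \<rho> u - \<rho>' u"
  have e: "exp (complex_of_real t * d) = 1" if "t \<ge> 0" for t
  proof -
    have "exp (complex_of_real t * \<rho> u) = exp (complex_of_real t * \<rho>' u)"
      using assms that unfolding levy_exponent_def by metis
    then show ?thesis by (simp add: d_def right_diff_distrib exp_diff)
  qed
  show "\<rho> u = \<rho>' u"
  proof (rule ccontr)
    assume "\<rho> u \<noteq> \<rho>' u"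
    then have d: "norm d > 0" by (simp add: d_def)
    define t where "t = 1 / norm d"
    have n: "norm (complex_of_real t * d) = 1" using d by (simp add: t_def norm_divide)
    have "complex_of_real t * d = 0"
    proof (rule exp_complex_eqI)
      show "\<bar>Im (complex_of_real t * d) - Im 0\<bar> < 2 * pi"
        using abs_Im_le_cmod[of "complex_of_real t * d"] n pi_gt3 by simp
      show "exp (complex_of_real t * d) = exp 0"
        using e[of t] d by (simp add: t_def)
    qed
    with n show False by simp
  qed
qed

definition square_integrable_process ::
    "'w measure \<Rightarrow> (real \<Rightarrow> 'w \<Rightarrow> 'a::{banach, second_countable_topology}) \<Rightarrow> bool"
  where "square_integrable_process M Y \<longleftrightarrow> (\<forall>t\<ge>0. integrable M (\<lambda>\<omega>. (norm (Y t \<omega>))\<^sup>2))"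

definition integrable_process ::
    "'w measure \<Rightarrow> (real \<Rightarrow> 'w \<Rightarrow> 'a::{banach, second_countable_topology}) \<Rightarrow> bool"
  where "integrable_process M Y \<longleftrightarrow> (\<forall>t\<ge>0. integrable M (Y t))"

definition mean_zero_process ::
    "'w measure \<Rightarrow> (real \<Rightarrow> 'w \<Rightarrow> 'a::{banach, second_countable_topology}) \<Rightarrow> bool"
  where "mean_zero_process M Y \<longleftrightarrow> integrable_process M Y \<and> (\<forall>t\<ge>0. (\<integral>\<omega>. Y t \<omega> \<partial>M) = 0)"

text \<open>Sample paths are not assumed to be regular, hence the event that some \<open>Y t\<close> is nonzero need
  not be measurable, and it may have probability one even if \<open>Y\<close> is a modification of the zero
  process. Non-triviality therefore refers to the single times; for right-continuous paths this
  amounts to the path \<open>Y\<close> being nonzero with positive probability.\<close>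

definition nontrivial_process ::
    "'w measure \<Rightarrow> (real \<Rightarrow> 'w \<Rightarrow> 'a::real_normed_vector) \<Rightarrow> bool"
  where "nontrivial_process M Y \<longleftrightarrow> (\<exists>t\<ge>0. measure M {\<omega> \<in> space M. Y t \<omega> \<noteq> 0} > 0)"

end

theory Submission
  imports Defs "HOL-Real_Asymp.Real_Asymp"
begin

text \<open>Part (a). Factor the covariance operator as \<open>Q = T T*\<close> with a Hilbert--Schmidt operator \<open>T\<close>
  and sum a Gaussian series to get \<open>G\<close> with \<open>E exp (i \<langle>u | G\<rangle>) = exp (- \<langle>Q u | u\<rangle> / 2)\<close>. With an
  independent positive \<open>\<alpha>/2\<close>-stable variable \<open>S\<close>, a limit of normalized sums of Sibuya variables, the
  law of \<open>sqrt (2 S) G\<close> has the characteristic functional \<open>exp (- \<langle>Q u | u\<rangle>\<^sup>\<alpha>\<^sup>/\<^sup>2)\<close>. Its dilations form a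
  convolution semigroup, and Kolmogorov's extension theorem gives the process. A law on a separable
  Hilbert space is determined by its characteristic functional, so every process with this exponent
  inherits the moments of \<open>sqrt (2 S) G\<close>; conversely, moments of \<open>\<langle>u | Y 1\<rangle>\<close> bound
  \<open>1 - exp (- c s\<^sup>\<alpha>)\<close> for small \<open>s\<close>.

  Part (b). The characteristic functional of a symmetric Levy process is real and multiplicative in
  time, hence equal to \<open>exp (- t \<psi> u)\<close> with \<open>\<psi> u \<ge> 0\<close> continuous, and stability makes \<open>\<psi>\<close> homogeneous
  of degree \<open>\<alpha>\<close>. Since \<open>1 - cos (2 x) \<le> 4 (1 - cos x)\<close>, the degree is at most 2 unless \<open>\<psi> = 0\<close>.\<close>

section \<open>Uniqueness of characteristic functionals\<close>

text \<open>Several obstacles shape the proof. Levy's uniqueness theorem is one-dimensional, so on H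
  the values of the functionals are constrained one at a time: each constraint becomes a factor of a
  bounded nonnegative weight, and the induction carries the transforms of the weight against all
  remaining functionals. The trace class hypothesis speaks about |Q| rather than Q; only the
  comparison Q \<le> |Q| of quadratic forms is derived from it. A real characteristic functional
  could still vanish or be negative, and then it has no logarithm: stochastic continuity makes it
  positive for small times, and multiplicativity in time spreads this by doubling. The factor sqrt
  (2 S) is chosen because a Gaussian scaled by it has, given S, the transform exp (- S q) with q the
  quadratic form, and averaging over S turns this into the Laplace transform of S at q. Sibuya
  variables enter because their Laplace transform 1 - (1 - exp (- l))^\<beta> behaves like 1 -
  l^\<beta> near 0, so that sums of n copies scaled by n^(-1/\<beta>) tend to exp (-
  l^\<beta>).\<close>

abbreviation charf :: "'a::real_inner measure \<Rightarrow> 'a \<Rightarrow> complex" where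
  "charf M u \<equiv> (\<integral>x. iexp (u \<bullet> x) \<partial>M)"

abbreviation pathchar :: "('i \<Rightarrow> 'a::real_inner) measure \<Rightarrow> 'i set \<Rightarrow> ('i \<Rightarrow> 'a) \<Rightarrow> complex" where
  "pathchar M J u \<equiv> (\<integral>x. iexp (\<Sum>j\<in>J. u j \<bullet> x j) \<partial>M)"

abbreviation wchar :: "'w measure \<Rightarrow> ('w \<Rightarrow> real) \<Rightarrow> ('w \<Rightarrow> real) \<Rightarrow> complex" where
  "wchar M W g \<equiv> (\<integral>x. complex_of_real (W x) * iexp (g x) \<partial>M)"

text \<open>By separability a closed ball is a countable intersection of half-spaces, with normals
  in a countable dense set, and an open set is a countable union of closed balls. Preimages of
  half-spaces are measurable by assumption.\<close>

lemma weakly_measurable_imp_borel_measurable: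
  fixes f :: "'w \<Rightarrow> 'a::{real_inner, second_countable_topology}"
  assumes [measurable]: "\<And>u. (\<lambda>w. u \<bullet> f w) \<in> borel_measurable M"
  shows "f \<in> borel_measurable M"
proof -
  obtain D :: "'a set" where D: "countable D" "\<And>X. open X \<Longrightarrow> X \<noteq> {} \<Longrightarrow> \<exists>d\<in>D. d \<in> X"
    using countable_dense_setE by blast
  have clD: "closure D = UNIV"
    using D(2)[of "- closure D"] closure_subset[of D] by auto
  have norm_le: "norm y \<le> r \<longleftrightarrow> (\<forall>d\<in>D. d \<bullet> y \<le> r * norm d)" if "r \<ge> 0" for y :: 'a and r
  proof
    assume "norm y \<le> r"
    then have "d \<bullet> y \<le> r * norm d" for d
      using norm_cauchy_schwarz[of d y] mult_left_mono[of "norm y" r "norm d"]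
      by (simp add: mult.commute)
    then show "\<forall>d\<in>D. d \<bullet> y \<le> r * norm d" by blast
  next
    assume "\<forall>d\<in>D. d \<bullet> y \<le> r * norm d"
    then have "D \<subseteq> {d. d \<bullet> y \<le> r * norm d}" by blast
    moreover have "closed {d. d \<bullet> y \<le> r * norm d}"
      by (intro closed_Collect_le continuous_intros)
    \<comment> \<open>The admissible normals form a closed set containing the dense set, so
      \<open>y\<close> itself is one; this gives |y|^2 \<le> r |y|.\<close>
    ultimately have "y \<in> {d. d \<bullet> y \<le> r * norm d}"
      using clD by (metis UNIV_I closure_minimal subsetD)
    then have "norm y * norm y \<le> r * norm y"
      by (simp add: power2_norm_eq_inner[symmetric] power2_eq_square)
    then show "norm y \<le> r"
      using that by (cases "y = 0") auto
  qed
  have cball_meas: "f -` cball c r \<inter> space M \<in> sets M" if "r \<ge> 0" for c r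
  proof -
    have "f -` cball c r \<inter> space M = {w \<in> space M. \<forall>d\<in>D. d \<bullet> f w - d \<bullet> c \<le> r * norm d}"
      using norm_le[OF that, of "f _ - c"]
      by (auto simp: dist_norm norm_minus_commute inner_diff_right)
    also have "\<dots> \<in> sets M"
      using D(1) by measurable
    finally show ?thesis .
  qed
  show ?thesis
  proof (rule borel_measurableI)
    fix U :: "'a set" assume "open U"
    define I where "I = {(d, r). d \<in> D \<and> r \<in> \<rat> \<and> r > 0 \<and> cball d r \<subseteq> U}"
    have "countable I"
      by (rule countable_subset[of _ "D \<times> \<rat>"]) (auto simp: I_def D countable_rat)
    have "U = (\<Union>(d, r)\<in>I. cball d r)"
    proof (intro equalityI subsetI)
      fix x assume "x \<in> U"
      then obtain e where e: "e > 0" "ball x e \<subseteq> U"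
        using \<open>open U\<close> open_contains_ball by blast
      obtain r where r: "r \<in> \<rat>" "0 < r" "r < e / 2"
        using Rats_dense_in_real[of 0 "e/2"] e by auto
      obtain d where d: "d \<in> D" "d \<in> ball x r"
        using D(2)[of "ball x r"] r by auto
      have "cball d r \<subseteq> U"
      proof
        fix y assume "y \<in> cball d r"
        then have "dist x y < e"
          using d r dist_triangle[of x y d] by (auto simp: dist_commute)
        then show "y \<in> U" using e by auto
      qed
      then show "x \<in> (\<Union>(d, r)\<in>I. cball d r)"
        using d r by (intro UN_I[of "(d, r)"]) (auto simp: I_def dist_commute)
    qed (auto simp: I_def)
    then have "f -` U \<inter> space M = (\<Union>(d, r)\<in>I. f -` cball d r \<inter> space M)"
      by auto
    also have "\<dots> \<in> sets M"
      using \<open>countable I\<close> by (intro sets.countable_UN') (auto simp: I_def intro!: cball_meas)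
    finally show "f -` U \<inter> space M \<in> sets M" .
  qed
qed

text \<open>Normalized by its total mass, \<open>V\<close> is a probability density, and the claim
  is Levy's theorem for the push-forwards under \<open>f\<close>. The masses agree by the case s =
  0; if they vanish, so do both integrals.\<close>

lemma weighted_char_unique:
  fixes f V :: "'w \<Rightarrow> real"
  assumes "prob_space M" "prob_space N" and sets: "sets M = sets N"
    and [measurable]: "f \<in> borel_measurable M" "V \<in> borel_measurable M"
    and V: "\<And>x. 0 \<le> V x" "\<And>x. V x \<le> B"
    and eq: "\<And>s. wchar M V (\<lambda>x. s * f x) = wchar N V (\<lambda>x. s * f x)"
    and [measurable]: "A \<in> sets borel"
  shows "(\<integral>x. V x * indicator A (f x) \<partial>M) = (\<integral>x. V x * indicator A (f x) \<partial>N)"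
proof -
  have [measurable]: "f \<in> borel_measurable N" "V \<in> borel_measurable N"
    using assms(4,5) by (simp_all add: measurable_cong_sets[OF sets refl])
  interpret M: prob_space M by fact
  interpret N: prob_space N by fact
  define c where "c = (\<integral>x. V x \<partial>M)"
  have iM: "integrable M V" and iN: "integrable N V"
    using V by (auto intro!: M.integrable_const_bound[of _ B] N.integrable_const_bound[of _ B])
  have cN: "c = (\<integral>x. V x \<partial>N)"
    using eq[of 0] by (simp add: c_def)
  show ?thesis
  proof (cases "c = 0")
    case True
    have "AE x in M. V x = 0"
      using integral_nonneg_eq_0_iff_AE[OF iM] V True by (simp add: c_def)
    then have "(\<integral>x. V x * indicator A (f x) \<partial>M) = 0"
      by (intro integral_eq_zero_AE) auto
    moreover have "AE x in N. V x = 0"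
      using integral_nonneg_eq_0_iff_AE[OF iN] V True by (simp add: cN)
    then have "(\<integral>x. V x * indicator A (f x) \<partial>N) = 0"
      by (intro integral_eq_zero_AE) auto
    ultimately show ?thesis by simp
  next
    case False
    then have "c > 0" using V by (simp add: c_def order_less_le)
    define D where "D K = distr (density K (\<lambda>x. ennreal (V x / c))) borel f" for K
    have D: "real_distribution (D K)"
      "char (D K) s = wchar K V (\<lambda>x. s * f x) / c"
      "measure (D K) A = (\<integral>x. V x * indicator A (f x) \<partial>K) / c"
      if "K = M \<or> K = N" for K s
    proof -
      have [measurable]: "f \<in> borel_measurable K" "V \<in> borel_measurable K" using that by auto
      interpret K: prob_space K using that \<open>prob_space M\<close> \<open>prob_space N\<close> by auto
      have iK: "integrable K V" and cK: "c = (\<integral>x. V x \<partial>K)"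
        using that iM iN c_def cN by auto
      have "emeasure (density K (\<lambda>x. ennreal (V x / c))) (space K) = (\<integral>\<^sup>+x. ennreal (V x / c) \<partial>K)"
        by (subst emeasure_density) (auto intro!: nn_integral_cong)
      also have "\<dots> = ennreal (\<integral>x. V x / c \<partial>K)"
        using V \<open>c > 0\<close> iK by (intro nn_integral_eq_integral) auto
      also have "\<dots> = 1"
        using cK \<open>c > 0\<close> by simp
      finally interpret d: prob_space "density K (\<lambda>x. ennreal (V x / c))"
        by (intro prob_spaceI) simp
      show *: "real_distribution (D K)"
        unfolding D_def by (rule d.real_distribution_distr) simp
      interpret D: real_distribution "D K" by fact
      have "char (D K) s = (\<integral>x. (V x / c) *\<^sub>R iexp (s * f x) \<partial>K)"
        unfolding char_def D_def using V \<open>c > 0\<close>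
        by (subst integral_distr) (auto simp: integral_density)
      also have "\<dots> = (\<integral>x. complex_of_real (V x) * iexp (s * f x) / c \<partial>K)"
        by (intro Bochner_Integration.integral_cong) (auto simp: scaleR_conv_of_real)
      finally show "char (D K) s = wchar K V (\<lambda>x. s * f x) / c"
        by simp
      have "measure (D K) A = (\<integral>x. indicator A x \<partial>D K)"
        by (simp add: D_def)
      also have "\<dots> = (\<integral>x. (V x / c) *\<^sub>R indicator A (f x) \<partial>K)"
        unfolding D_def using V \<open>c > 0\<close>
        by (subst integral_distr) (auto simp: integral_density)
      finally show "measure (D K) A = (\<integral>x. V x * indicator A (f x) \<partial>K) / c"
        by simp
    qed
    have "D M = D N"
      by (rule Levy_uniqueness) (simp_all only: D(1,2) eq fun_eq_iff simp_thms)
    then show ?thesis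
      using D(3)[of M] D(3)[of N] \<open>c > 0\<close> by simp
  qed
qed


text \<open>For nonnegative \<open>W\<close> the weights W (1 + cos l) and W (1 + sin l) are
  nonnegative, hence admissible in \<open>weighted_char_unique\<close>. Their transforms reduce to
  those of \<open>W\<close>, and conversely the two weights together recover the transform of
  \<open>W\<close> at \<open>l\<close>.\<close>

lemma (in prob_space) weighted_trig_expectation:
  fixes W g l :: "'a \<Rightarrow> real"
  assumes [measurable]: "W \<in> borel_measurable M" "g \<in> borel_measurable M" "l \<in> borel_measurable M"
    and W: "\<And>x. \<bar>W x\<bar> \<le> 1"
  shows "wchar M (\<lambda>x. W x * (1 + cos (l x))) g = wchar M W g +
      (wchar M W (\<lambda>x. g x + l x) + wchar M W (\<lambda>x. g x - l x)) / 2" (is ?cos)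
    and "wchar M (\<lambda>x. W x * (1 + sin (l x))) g = wchar M W g +
      (wchar M W (\<lambda>x. g x + l x) -
       wchar M W (\<lambda>x. g x - l x)) / (2 * \<i>)" (is ?sin)
    and "wchar M W l =
       complex_of_real ((\<integral>x. W x * (1 + cos (l x)) \<partial>M) - (\<integral>x. W x \<partial>M)) +
       \<i> * complex_of_real ((\<integral>x. W x * (1 + sin (l x)) \<partial>M) - (\<integral>x. W x \<partial>M))" (is ?iexp)
proof -
  have [simp]: "integrable M (\<lambda>x. complex_of_real (W x) * iexp (h x))"
    if [measurable]: "h \<in> borel_measurable M" for h :: "'a \<Rightarrow> real"
    using W by (intro integrable_const_bound[of _ 1]) (auto simp: norm_mult)
  have "\<bar>W x * (1 + z)\<bar> \<le> 2" if "\<bar>z\<bar> \<le> 1" for x z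
    using that mult_mono[OF W[of x], of "\<bar>1 + z\<bar>" 2] by (auto simp: abs_mult)
  then have [simp]: "integrable M (\<lambda>x. W x * (1 + cos (l x)))" "integrable M (\<lambda>x. W x * (1 + sin (l x)))"
    by (auto intro!: integrable_const_bound[of _ 2])
  have [simp]: "integrable M W"
    using W by (intro integrable_const_bound[of _ 1]) auto
  have iexp: "iexp (a + b) = iexp a * (cos b + \<i> * sin b)"
    "iexp (a - b) = iexp a * (cos b - \<i> * sin b)" for a b :: real
    unfolding cis_conv_exp[symmetric]
    by (simp_all add: complex_eq_iff cos_add sin_add cos_diff sin_diff)
  have "wchar M (\<lambda>x. W x * (1 + cos (l x))) g =
     (\<integral>x. complex_of_real (W x) * iexp (g x) + (complex_of_real (W x) * iexp (g x + l x) +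
        complex_of_real (W x) * iexp (g x - l x)) / 2 \<partial>M)"
    unfolding iexp by (intro Bochner_Integration.integral_cong) (auto simp: field_simps)
  then show ?cos
    by (simp del: of_real_add of_real_diff)
  have "wchar M (\<lambda>x. W x * (1 + sin (l x))) g =
     (\<integral>x. complex_of_real (W x) * iexp (g x) + (complex_of_real (W x) * iexp (g x + l x) -
        complex_of_real (W x) * iexp (g x - l x)) / (2 * \<i>) \<partial>M)"
    unfolding iexp by (intro Bochner_Integration.integral_cong) (auto simp: field_simps)
  then show ?sin
    by (simp del: of_real_add of_real_diff)
  have "wchar M W l = (\<integral>x. complex_of_real (W x * (1 + cos (l x)) - W x) +
       \<i> * complex_of_real (W x * (1 + sin (l x)) - W x) \<partial>M)"
    by (intro Bochner_Integration.integral_cong)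
       (auto simp: algebra_simps cis_conv_exp[symmetric] cis.ctr complex_eq_iff)
  also have "\<dots> = (\<integral>x. complex_of_real (W x * (1 + cos (l x)) - W x) \<partial>M) +
       \<i> * (\<integral>x. complex_of_real (W x * (1 + sin (l x)) - W x) \<partial>M)"
    by (subst Bochner_Integration.integral_add)
       (auto intro!: integrable_of_real Bochner_Integration.integrable_diff simp del: of_real_diff of_real_mult)
  also have "\<dots> = complex_of_real ((\<integral>x. W x * (1 + cos (l x)) \<partial>M) - (\<integral>x. W x \<partial>M)) +
       \<i> * complex_of_real ((\<integral>x. W x * (1 + sin (l x)) \<partial>M) - (\<integral>x. W x \<partial>M))"
    by (simp only: integral_complex_of_real) simp
  finally show ?iexp .
qed

text \<open>\<open>L\<close> is a linear space of functionals that generates the sigma-algebra.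
  Equality on the finite intersections of sets {f \<in> A} suffices, since they form a generator
  closed under intersection.\<close>

lemma char_functional_unique:
  fixes L :: "('w \<Rightarrow> real) set"
  assumes pM: "prob_space M" and pN: "prob_space N" and sets: "sets M = sets N"
    and meas: "\<And>f. f \<in> L \<Longrightarrow> f \<in> borel_measurable M"
    and add: "\<And>f g. f \<in> L \<Longrightarrow> g \<in> L \<Longrightarrow> (\<lambda>x. f x + g x) \<in> L"
    and scale: "\<And>c f. f \<in> L \<Longrightarrow> (\<lambda>x. c * f x) \<in> L"
    and ne: "L \<noteq> {}"
    and eq: "\<And>f. f \<in> L \<Longrightarrow> (\<integral>x. iexp (f x) \<partial>M) = (\<integral>x. iexp (f x) \<partial>N)"
    and gen: "sets M \<subseteq> sigma_sets (space M) {f -` A \<inter> space M |f A. f \<in> L \<and> A \<in> sets borel}"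
  shows "M = N"
proof -
  interpret M: prob_space M by fact
  interpret N: prob_space N by fact
  have space: "space M = space N" using sets by (rule sets_eq_imp_space_eq)
  have measN: "f \<in> borel_measurable N" if "f \<in> borel_measurable M" for f :: "'w \<Rightarrow> real"
    using that by (simp add: measurable_cong_sets[OF sets refl])
  define W :: "(('w \<Rightarrow> real) \<times> real set) list \<Rightarrow> 'w \<Rightarrow> real"
    where "W ps x = prod_list (map (\<lambda>(f, A). indicator A (f x)) ps)" for ps x
  have W01: "0 \<le> W ps x" "W ps x \<le> 1" for ps x
    by (induction ps) (auto simp: W_def indicator_def)
  have Wmeas: "W ps \<in> borel_measurable M" if "set ps \<subseteq> L \<times> sets borel" for ps
    using that
  proof (induction ps)
    case (Cons p ps)
    then obtain f A where p: "p = (f, A)" "f \<in> L" "A \<in> sets borel" by (cases p) auto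
    note [measurable] = meas[OF p(2)] p(3)
    from Cons have [measurable]: "W ps \<in> borel_measurable M" by auto
    have "W (p # ps) = (\<lambda>x. indicator A (f x) * W ps x)" by (auto simp: W_def p)
    also have "\<dots> \<in> borel_measurable M" by measurable
    finally show ?case .
  qed (simp add: W_def[abs_def])
  \<comment> \<open>The statement for all \<open>l\<close> at once makes the induction work: a new
    constraint on \<open>f\<close> is added by \<open>weighted_char_unique\<close> with the weights
    W (1 + cos l) and W (1 + sin l), whose transforms along s f only involve s f, s f + l and s f -
    l, all of them in \<open>L\<close>.\<close>
  have main: "\<forall>l\<in>L. wchar M (W ps) l = wchar N (W ps) l"
    if "set ps \<subseteq> L \<times> sets borel" for ps
    using that
  proof (induction ps)
    case Nil
    then show ?case using eq by (simp add: W_def)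
  next
    case (Cons p ps)
    then obtain f A where p: "p = (f, A)" and f: "f \<in> L" and A[measurable]: "A \<in> sets borel"
      by (cases p) auto
    have IH: "wchar M (W ps) l = wchar N (W ps) l" if "l \<in> L" for l
      using Cons that by auto
    from Cons have WM[measurable]: "W ps \<in> borel_measurable M" by (auto intro: Wmeas)
    note WN[measurable] = measN[OF WM]
    note fM[measurable] = meas[OF f]
    note fN[measurable] = measN[OF fM]
    show ?case
    proof
      fix l assume l: "l \<in> L"
      note lM[measurable] = meas[OF l]
      note lN[measurable] = measN[OF lM]
      have sfp: "(\<lambda>x. s * f x + l x) \<in> L" for s
        by (intro add scale f l)
      have sfm: "(\<lambda>x. s * f x - l x) \<in> L" for s
        using add[OF scale[OF f, of s] scale[OF l, of "-1"]] by simp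
      have W1: "\<bar>W ps x\<bar> \<le> 1" for x using W01[of ps x] by simp
      have bd: "W ps x * (1 + cos y) \<le> 2" "W ps x * (1 + sin y) \<le> 2"
        "0 \<le> W ps x * (1 + cos y)" "0 \<le> W ps x * (1 + sin y)" for x y
        using mult_mono[OF W01(2)[of ps x], of "1 + cos y" 2] W01(1)[of ps x]
          mult_mono[OF W01(2)[of ps x], of "1 + sin y" 2]
          mult_nonneg_nonneg[OF W01(1)[of ps x], of "1 + cos y"]
          mult_nonneg_nonneg[OF W01(1)[of ps x], of "1 + sin y"]
          cos_ge_minus_one[of y] sin_ge_minus_one[of y] cos_le_one[of y] sin_le_one[of y]
        by linarith+
      note trigM = M.weighted_trig_expectation(1,2)[OF WM _ lM W1]
      note trigN = N.weighted_trig_expectation(1,2)[OF WN _ lN W1]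
      have c: "(\<integral>x. W ps x * (1 + cos (l x)) * indicator A (f x) \<partial>M) =
            (\<integral>x. W ps x * (1 + cos (l x)) * indicator A (f x) \<partial>N)"
      proof (rule weighted_char_unique[OF pM pN sets, where B = 2])
        fix s :: real
        show "wchar M (\<lambda>x. W ps x * (1 + cos (l x))) (\<lambda>x. s * f x) =
              wchar N (\<lambda>x. W ps x * (1 + cos (l x))) (\<lambda>x. s * f x)"
          by (simp only: trigM[of "\<lambda>x. s * f x"] trigN[of "\<lambda>x. s * f x"] borel_measurable_times
            borel_measurable_const fM fN IH[OF sfp] IH[OF sfm] IH[OF scale[OF f]])
      qed (use bd in auto)
      have s: "(\<integral>x. W ps x * (1 + sin (l x)) * indicator A (f x) \<partial>M) =
            (\<integral>x. W ps x * (1 + sin (l x)) * indicator A (f x) \<partial>N)"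
      proof (rule weighted_char_unique[OF pM pN sets, where B = 2])
        fix s :: real
        show "wchar M (\<lambda>x. W ps x * (1 + sin (l x))) (\<lambda>x. s * f x) =
              wchar N (\<lambda>x. W ps x * (1 + sin (l x))) (\<lambda>x. s * f x)"
          by (simp only: trigM[of "\<lambda>x. s * f x"] trigN[of "\<lambda>x. s * f x"] borel_measurable_times
            borel_measurable_const fM fN IH[OF sfp] IH[OF sfm] IH[OF scale[OF f]])
      qed (use bd in auto)
      have w: "(\<integral>x. W ps x * indicator A (f x) \<partial>M) = (\<integral>x. W ps x * indicator A (f x) \<partial>N)"
        by (rule weighted_char_unique[OF pM pN sets, where B = 1])
           (use W01 IH[OF scale[OF f]] in auto)
      have Wp: "W (p # ps) = (\<lambda>x. W ps x * indicator A (f x))"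
        by (auto simp: W_def p)
      have rearr: "W (p # ps) x * y = W ps x * y * indicator A (f x)" for x y
        by (simp add: Wp)
      have w': "(\<integral>x. W (p # ps) x \<partial>M) = (\<integral>x. W (p # ps) x \<partial>N)"
        using w by (simp only: Wp)
      have Wp1: "\<bar>W (p # ps) x\<bar> \<le> 1" for x using W01[of "p # ps" x] by simp
      have WpM: "W (p # ps) \<in> borel_measurable M" by (intro Wmeas Cons)
      show "wchar M (W (p # ps)) l = wchar N (W (p # ps)) l"
        unfolding M.weighted_trig_expectation(3)[OF WpM lM lM Wp1]
          N.weighted_trig_expectation(3)[OF measN[OF WpM] lN lN Wp1]
        by (simp only: rearr c s w')
    qed
  qed
  obtain l0 where l0: "l0 \<in> L" using ne by auto
  have zero: "(\<lambda>x. 0) \<in> L" using scale[OF l0, of 0] by simp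
  define S where "S ps = {x \<in> space M. \<forall>(f, A)\<in>set ps. f x \<in> A}" for ps :: "(('w \<Rightarrow> real) \<times> real set) list"
  have W_S: "W ps x = indicator (S ps) x" if "x \<in> space M" for x ps
    using that by (induction ps) (auto simp: W_def S_def indicator_def)
  define E where "E = S ` {ps. set ps \<subseteq> L \<times> sets borel}"
  have Sset: "S ps \<in> sets M" if "set ps \<subseteq> L \<times> sets borel" for ps
  proof -
    have "S ps = {x \<in> space M. W ps x = 1}"
      using W_S[of _ ps] by (auto simp: S_def indicator_def split: if_splits)
    then show ?thesis using Wmeas[OF that] by simp
  qed
  show ?thesis
  proof (rule measure_eqI_generator_eq[where E = E and A = "\<lambda>_. space M" and \<Omega> = "space M"])
    show "Int_stable E"
    proof (rule Int_stableI)
      fix X Y assume "X \<in> E" "Y \<in> E"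
      then obtain ps qs where "X = S ps" "Y = S qs"
        "set ps \<subseteq> L \<times> sets borel" "set qs \<subseteq> L \<times> sets borel"
        by (auto simp: E_def)
      then show "X \<inter> Y \<in> E"
        unfolding E_def by (intro image_eqI[of _ _ "ps @ qs"]) (auto simp: S_def)
    qed
    show "E \<subseteq> Pow (space M)" by (auto simp: E_def S_def)
    show "emeasure M X = emeasure N X" if "X \<in> E" for X
    proof -
      obtain ps where ps: "set ps \<subseteq> L \<times> sets borel" "X = S ps" using \<open>X \<in> E\<close> unfolding E_def by blast
      have "complex_of_real (\<integral>x. W ps x \<partial>M) = complex_of_real (\<integral>x. W ps x \<partial>N)"
        using main[OF ps(1), rule_format, OF zero] by simp
      moreover have "(\<integral>x. W ps x \<partial>M) = measure M X"
        using W_S Sset[OF ps(1)] ps(2)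
        by (subst Bochner_Integration.integral_cong[OF refl W_S]) auto
      moreover have "(\<integral>x. W ps x \<partial>N) = measure N X"
        using W_S Sset[OF ps(1)] ps(2) sets space
        by (subst Bochner_Integration.integral_cong[OF refl W_S]) auto
      ultimately show ?thesis
        by (simp add: M.emeasure_eq_measure N.emeasure_eq_measure)
    qed
    have E_sets: "E \<subseteq> sets M" using Sset by (auto simp: E_def)
    have gE: "{f -` A \<inter> space M |f A. f \<in> L \<and> A \<in> sets borel} \<subseteq> E"
    proof
      fix X assume "X \<in> {f -` A \<inter> space M |f A. f \<in> L \<and> A \<in> sets borel}"
      then obtain f A where "X = f -` A \<inter> space M" "f \<in> L" "A \<in> sets borel" by auto
      then show "X \<in> E"
        unfolding E_def by (intro image_eqI[of _ _ "[(f, A)]"]) (auto simp: S_def)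
    qed
    show *: "sets M = sigma_sets (space M) E"
      using gen sigma_sets_mono'[OF gE] sets.sigma_sets_subset[OF E_sets] by blast
    show "sets N = sigma_sets (space M) E" using * sets by simp
    show "range (\<lambda>_. space M) \<subseteq> E"
      by (auto simp: E_def S_def intro!: image_eqI[of _ _ "[]"])
  qed auto
qed

text \<open>The functionals x \<mapsto> u \<bullet> x generate the Borel sets, because the identity
  is weakly measurable, hence measurable, for the sigma-algebra that they generate.\<close>

lemma prob_measure_eqI_char:
  fixes M N :: "'a::{real_inner, second_countable_topology} measure"
  assumes "prob_space M" "prob_space N" and sets: "sets M = sets borel" "sets N = sets borel"
    and eq: "\<And>u. charf M u = charf N u"
  shows "M = N"
proof (rule char_functional_unique[where L = "range (\<lambda>u x. u \<bullet> x)"])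
  have space: "space M = UNIV"
    using sets_eq_imp_space_eq[OF sets(1)] by simp
  define G where "G = {f -` A \<inter> space M |f A. f \<in> range (\<lambda>u (x::'a). u \<bullet> x) \<and> A \<in> sets (borel :: real measure)}"
  define S where "S = sigma UNIV G"
  have S: "sets S = sigma_sets UNIV G" "space S = UNIV"
    by (simp_all add: S_def)
  have "(\<lambda>x. x) \<in> borel_measurable S"
  proof (rule weakly_measurable_imp_borel_measurable, rule measurableI)
    fix u :: 'a and A :: "real set" assume "A \<in> sets borel"
    then have "(\<lambda>x. u \<bullet> x) -` A \<inter> space M \<in> G"
      unfolding G_def by blast
    then show "(\<lambda>x. u \<bullet> x) -` A \<inter> space S \<in> sets S"
      by (simp add: S space sigma_sets.Basic)
  qed auto
  then have "A \<in> sigma_sets UNIV G" if "A \<in> sets borel" for A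
    using measurable_sets[OF _ that, of "\<lambda>x. x" S] S by simp
  then show "sets M \<subseteq> sigma_sets (space M) {f -` A \<inter> space M |f A. f \<in> range (\<lambda>u x. u \<bullet> x) \<and> A \<in> sets borel}"
    unfolding G_def space sets(1) by (rule subsetI)
next
  fix f g :: "'a \<Rightarrow> real" and c :: real assume f: "f \<in> range (\<lambda>u x. u \<bullet> x)"
  from f obtain u where u: "f = (\<lambda>x. u \<bullet> x)" by (elim rangeE)
  show "(\<integral>x. iexp (f x) \<partial>M) = (\<integral>x. iexp (f x) \<partial>N)"
    unfolding u by (rule eq)
  show "f \<in> borel_measurable M"
    unfolding u measurable_cong_sets[OF sets(1) refl] by simp
  have "(\<lambda>x. c * f x) = (\<lambda>x. (c *\<^sub>R u) \<bullet> x)"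
    by (simp add: u)
  then show "(\<lambda>x. c * f x) \<in> range (\<lambda>u x. u \<bullet> x)"
    by (rule range_eqI)
  assume "g \<in> range (\<lambda>u x. u \<bullet> x)"
  then obtain v where "g = (\<lambda>x. v \<bullet> x)" by (elim rangeE)
  then have "(\<lambda>x. f x + g x) = (\<lambda>x. (u + v) \<bullet> x)"
    by (simp add: u inner_add_left)
  then show "(\<lambda>x. f x + g x) \<in> range (\<lambda>u x. u \<bullet> x)"
    by (rule range_eqI)
qed (use assms in auto)

text \<open>Here \<open>L\<close> consists of finite combinations of coordinate functionals; the
  index set may be uncountable, as it is for path laws.\<close>

lemma PiM_measure_eqI_char:
  fixes M N :: "('i \<Rightarrow> 'a::{real_inner, second_countable_topology}) measure"
  assumes "prob_space M" "prob_space N"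
    and sets: "sets M = sets (Pi\<^sub>M I (\<lambda>_. borel))" "sets N = sets (Pi\<^sub>M I (\<lambda>_. borel))"
    and eq: "\<And>J u. finite J \<Longrightarrow> J \<subseteq> I \<Longrightarrow>
      pathchar M J u = pathchar N J u"
  shows "M = N"
proof -
  define L :: "(('i \<Rightarrow> 'a) \<Rightarrow> real) set"
    where "L = {\<lambda>x. \<Sum>j\<in>J. u j \<bullet> x j |J u. finite J \<and> J \<subseteq> I}"
  show ?thesis
  proof (rule char_functional_unique[where L = L])
    have space: "space M = Pi\<^sub>E I (\<lambda>_. UNIV)"
      using sets_eq_imp_space_eq[OF sets(1)] by (simp add: space_PiM)
    define G where "G = {f -` A \<inter> space M |f A. f \<in> L \<and> A \<in> sets (borel :: real measure)}"
    define S where "S = sigma (space M) G"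
    have "G \<subseteq> Pow (space M)" by (auto simp: G_def)
    then have S: "sets S = sigma_sets (space M) G" "space S = space M"
      by (simp_all add: S_def)
    have "(\<lambda>x. x i) \<in> borel_measurable S" if i: "i \<in> I" for i
    proof (rule weakly_measurable_imp_borel_measurable, rule measurableI)
      fix u :: 'a and A :: "real set" assume A: "A \<in> sets borel"
      have "(\<lambda>x. u \<bullet> x i) \<in> L"
        unfolding L_def using i by (intro CollectI exI[of _ "{i}"] exI[of _ "\<lambda>_. u"]) auto
      with A have "(\<lambda>x. u \<bullet> x i) -` A \<inter> space M \<in> G"
        unfolding G_def by blast
      then show "(\<lambda>x. u \<bullet> x i) -` A \<inter> space S \<in> sets S"
        by (simp add: S sigma_sets.Basic)
    qed auto
    then have "(\<lambda>x i. x i) \<in> S \<rightarrow>\<^sub>M Pi\<^sub>M I (\<lambda>_. borel)"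
      by (intro measurable_PiM_single') (auto simp: S space)
    then have "A \<in> sigma_sets (space M) G" if "A \<in> sets (Pi\<^sub>M I (\<lambda>_. borel))" for A
      using measurable_sets[OF _ that, of "\<lambda>x. x" S] S sets.sets_into_space[OF that]
      by (simp add: space space_PiM Int_absorb2)
    then show "sets M \<subseteq> sigma_sets (space M) {f -` A \<inter> space M |f A. f \<in> L \<and> A \<in> sets borel}"
      unfolding G_def sets(1) by (rule subsetI)
  next
    fix f g and c :: real assume f: "f \<in> L"
    then obtain J u where J: "finite J" "J \<subseteq> I" "f = (\<lambda>x. \<Sum>j\<in>J. u j \<bullet> x j)"
      by (auto simp: L_def)
    show "(\<integral>x. iexp (f x) \<partial>M) = (\<integral>x. iexp (f x) \<partial>N)"
      using J eq by simp
    have "f \<in> borel_measurable (Pi\<^sub>M I (\<lambda>_. borel))"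
      unfolding J(3) using J(2)
      by (intro borel_measurable_sum borel_measurable_inner measurable_const measurable_component_singleton) auto
    then show "f \<in> borel_measurable M"
      by (simp add: measurable_cong_sets[OF sets(1) refl])
    show "(\<lambda>x. c * f x) \<in> L"
      unfolding L_def J(3) using J(1,2)
      by (intro CollectI exI[of _ J] exI[of _ "\<lambda>j. c *\<^sub>R u j"]) (simp add: sum_distrib_left)
    assume "g \<in> L"
    then obtain K v where K: "finite K" "K \<subseteq> I" "g = (\<lambda>x. \<Sum>j\<in>K. v j \<bullet> x j)"
      by (auto simp: L_def)
    \<comment> \<open>Both functionals are written over the common index set by padding with zero
      coefficients.\<close>
    have "(\<Sum>j\<in>J. u j \<bullet> x j) = (\<Sum>j\<in>J \<union> K. (if j \<in> J then u j else 0) \<bullet> x j)"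
      "(\<Sum>j\<in>K. v j \<bullet> x j) = (\<Sum>j\<in>J \<union> K. (if j \<in> K then v j else 0) \<bullet> x j)" for x
      using J(1) K(1) by (auto intro!: sum.mono_neutral_cong_left)
    then have "(\<lambda>x. f x + g x) =
       (\<lambda>x. \<Sum>j\<in>J \<union> K. ((if j \<in> J then u j else 0) + (if j \<in> K then v j else 0)) \<bullet> x j)"
      by (simp only: J(3) K(3) sum.distrib[symmetric] inner_add_left)
    then show "(\<lambda>x. f x + g x) \<in> L"
      unfolding L_def using J(1,2) K(1,2)
      by (intro CollectI exI[of _ "J \<union> K"] exI) auto
  qed (use assms in \<open>auto simp: L_def\<close>)
qed

section \<open>Levy processes from convolution semigroups\<close>

text \<open>\<open>fdd_exponent \<rho> s ts u\<close> is the logarithm of \<open>E exp (i \<Sum>t\<in>ts. \<langle>u t | Y t\<rangle>)\<close> for a Levy process with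
  exponent \<open>\<rho>\<close> that starts in 0 at time \<open>s\<close>.\<close>

fun fdd_exponent :: "('a::real_inner \<Rightarrow> complex) \<Rightarrow> real \<Rightarrow> real list \<Rightarrow> (real \<Rightarrow> 'a) \<Rightarrow> complex" where
  "fdd_exponent \<rho> s [] u = 0"
| "fdd_exponent \<rho> s (t # ts) u =
     complex_of_real (t - s) * \<rho> (\<Sum>j\<leftarrow>t # ts. u j) + fdd_exponent \<rho> t ts u"

lemma sum_list_map_insort: "(\<Sum>j\<leftarrow>insort k ts. u j) = u k + (\<Sum>j\<leftarrow>ts. u j :: 'a::comm_monoid_add)"
  by (induction ts) (auto simp: add_ac)

text \<open>A time with coefficient 0 splits an interval in two on which the argument of
  \<open>\<rho>\<close> is the same; after the last time that argument is 0, where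
  \<open>\<rho>\<close> vanishes.\<close>

lemma fdd_exponent_insort:
  assumes "\<rho> 0 = 0" "u k = 0"
  shows "fdd_exponent \<rho> s (insort k ts) u = fdd_exponent \<rho> s ts u"
  using assms
  by (induction ts arbitrary: s) (auto simp: sum_list_map_insort algebra_simps)

text \<open>This is the consistency of the finite-dimensional distributions on the level of
  exponents.\<close>

lemma fdd_exponent_superset:
  assumes "\<rho> 0 = 0" and "finite H" "J \<subseteq> H" and u: "\<And>j. j \<in> H - J \<Longrightarrow> u j = 0"
  shows "fdd_exponent \<rho> s (sorted_list_of_set H) u = fdd_exponent \<rho> s (sorted_list_of_set J) u"
proof -
  have "finite J" using assms finite_subset by auto
  have "fdd_exponent \<rho> s (sorted_list_of_set (J \<union> K)) u = fdd_exponent \<rho> s (sorted_list_of_set J) u"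
    if "finite K" "K \<subseteq> H - J" for K
    using that
  proof (induction K rule: finite_induct)
    case (insert k K)
    then have "sorted_list_of_set (J \<union> insert k K) = insort k (sorted_list_of_set (J \<union> K))"
      using \<open>finite J\<close> by simp
    moreover have "u k = 0" using u insert.prems by auto
    ultimately show ?case
      using fdd_exponent_insort[of \<rho> u k, OF assms(1)] insert by simp
  qed simp
  from this[of "H - J"] show ?thesis
    using assms(2,3) by (simp add: Un_absorb1)
qed

lemma fdd_exponent_uminus:
  assumes "\<And>u. \<rho> (- u) = \<rho> u"
  shows "fdd_exponent \<rho> s ts (\<lambda>j. - u j) = fdd_exponent \<rho> s ts u"
proof (induction ts arbitrary: s)
  case (Cons t ts)
  have "- u t + (\<Sum>j\<leftarrow>ts. - u j) = - (u t + (\<Sum>j\<leftarrow>ts. u j))"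
    by (simp add: uminus_sum_list_map o_def)
  then show ?case using Cons assms by (simp only: fdd_exponent.simps list.map sum_list.Cons)
qed simp

text \<open>The semigroup law is encoded by the linearity in \<open>t\<close> of the exponent in
  \<open>char_mu\<close>. The limit \<open>tendsto_mu\<close> becomes stochastic continuity of the
  process.\<close>

locale convolution_semigroup =
  fixes \<mu> :: "real \<Rightarrow> 'a::{real_inner, banach, polish_space} measure" and \<rho> :: "'a \<Rightarrow> complex"
  assumes prob_mu: "\<And>t. 0 \<le> t \<Longrightarrow> prob_space (\<mu> t)"
    and sets_mu: "\<And>t. 0 \<le> t \<Longrightarrow> sets (\<mu> t) = sets borel"
    and char_mu: "\<And>t u. 0 \<le> t \<Longrightarrow> charf (\<mu> t) u = exp (complex_of_real t * \<rho> u)"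
    and rho_0: "\<rho> 0 = 0"
    and tendsto_mu: "\<And>\<epsilon>. 0 < \<epsilon> \<Longrightarrow> ((\<lambda>t. measure (\<mu> t) {x. \<epsilon> < norm x}) \<longlongrightarrow> 0) (at_right 0)"
begin

definition is_fdd :: "real set \<Rightarrow> (real \<Rightarrow> 'a) measure \<Rightarrow> bool" where
  "is_fdd J P \<longleftrightarrow> prob_space P \<and> sets P = sets (Pi\<^sub>M J (\<lambda>_. borel)) \<and>
     (\<forall>u. pathchar P J u = exp (fdd_exponent \<rho> 0 (sorted_list_of_set J) u))"

text \<open>Independent of the path after \<open>t\<close>, taken relative to its position at
  \<open>t\<close>, the first increment is drawn from \<open>\<mu> (t - s)\<close> and added to all
  coordinates. The start time has to vary in the induction.\<close>

lemma ex_fdd_list: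
  assumes "sorted (s # ts)" "distinct ts"
  shows "\<exists>P. prob_space P \<and> sets P = sets (Pi\<^sub>M (set ts) (\<lambda>_. borel :: 'a measure)) \<and>
     (\<forall>u. pathchar P (set ts) u = exp (fdd_exponent \<rho> s ts u))"
  using assms
proof (induction ts arbitrary: s)
  case Nil
  have "prob_space (return (Pi\<^sub>M {} (\<lambda>_. borel :: 'a measure)) (\<lambda>_::real. undefined))"
    by (rule prob_space_return) (simp add: space_PiM)
  then interpret r: prob_space "return (Pi\<^sub>M {} (\<lambda>_. borel :: 'a measure)) (\<lambda>_::real. undefined)" .
  show ?case
    by (rule exI[of _ "return (Pi\<^sub>M {} (\<lambda>_. borel)) (\<lambda>_. undefined)"])
       (use r.prob_space_axioms r.prob_space in simp)
next
  case (Cons t ts)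
  then obtain P where P: "prob_space P" and setsP: "sets P = sets (Pi\<^sub>M (set ts) (\<lambda>_. borel))"
    and charP: "\<And>u. pathchar P (set ts) u = exp (fdd_exponent \<rho> t ts u)"
    by fastforce
  have "s \<le> t" "t \<notin> set ts" using Cons.prems by auto
  define N where "N = \<mu> (t - s)"
  interpret P: prob_space P by fact
  interpret N: prob_space N using prob_mu \<open>s \<le> t\<close> by (simp add: N_def)
  have setsN: "sets N = sets borel" using sets_mu \<open>s \<le> t\<close> by (simp add: N_def)
  interpret NP: pair_prob_space N P ..
  have sets_NP: "sets (N \<Otimes>\<^sub>M P) = sets (borel \<Otimes>\<^sub>M Pi\<^sub>M (set ts) (\<lambda>_. borel))"
    by (intro sets_pair_measure_cong setsN setsP)
  define g where "g = (\<lambda>(y, x). \<lambda>j\<in>set (t # ts). y + (if j = t then 0 else x j) :: 'a)"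
  have "g \<in> borel \<Otimes>\<^sub>M Pi\<^sub>M (set ts) (\<lambda>_. borel) \<rightarrow>\<^sub>M Pi\<^sub>M (set (t # ts)) (\<lambda>_. borel)"
    unfolding g_def split_beta'
  proof (rule measurable_restrict)
    fix j assume j: "j \<in> set (t # ts)"
    show "(\<lambda>x. fst x + (if j = t then 0 else snd x j)) \<in>
        borel_measurable ((borel :: 'a measure) \<Otimes>\<^sub>M Pi\<^sub>M (set ts) (\<lambda>_. borel))"
    proof (cases "j = t")
      case False
      have "(\<lambda>x. snd x j) \<in> borel_measurable ((borel :: 'a measure) \<Otimes>\<^sub>M Pi\<^sub>M (set ts) (\<lambda>_. borel))"
        using j False by (intro measurable_compose[OF measurable_snd measurable_component_singleton]) auto
      from borel_measurable_add[OF measurable_fst this] show ?thesis using False by simp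
    qed simp
  qed
  then have g[measurable]: "g \<in> N \<Otimes>\<^sub>M P \<rightarrow>\<^sub>M Pi\<^sub>M (set (t # ts)) (\<lambda>_. borel)"
    by (simp add: measurable_cong_sets[OF sets_NP refl])
  define R where "R = distr (N \<Otimes>\<^sub>M P) (Pi\<^sub>M (set (t # ts)) (\<lambda>_. borel)) g"
  have "pathchar R (set (t # ts)) u = exp (fdd_exponent \<rho> s (t # ts) u)" for u
  proof -
    \<comment> \<open>The first increment occurs in every coordinate, so it is tested against the
      sum of all coefficients.\<close>
    define v where "v = (\<Sum>j\<leftarrow>t # ts. u j)"
    have v: "v = u t + (\<Sum>j\<in>set ts. u j)"
      using Cons.prems by (simp add: v_def sum_list_distinct_conv_sum_set)
    have meas1: "(\<lambda>x. iexp (\<Sum>j\<in>set (t # ts). u j \<bullet> x j)) \<in> borel_measurable (Pi\<^sub>M (set (t # ts)) (\<lambda>_. borel))"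
      by measurable
    have "(\<lambda>x. iexp (\<Sum>j\<in>set ts. u j \<bullet> x j)) \<in> borel_measurable (Pi\<^sub>M (set ts) (\<lambda>_. borel))"
      by measurable
    then have meas2[measurable]: "(\<lambda>x. iexp (\<Sum>j\<in>set ts. u j \<bullet> x j)) \<in> borel_measurable P"
      by (simp only: measurable_cong_sets[OF setsP refl])
    have meas3[measurable]: "(\<lambda>y. iexp (v \<bullet> y)) \<in> borel_measurable N"
      unfolding measurable_cong_sets[OF setsN refl] by measurable
    have g_sum: "(\<Sum>j\<in>set (t # ts). u j \<bullet> g (y, x) j) = v \<bullet> y + (\<Sum>j\<in>set ts. u j \<bullet> x j)" for y x
    proof -
      have "(\<Sum>j\<in>set ts. u j \<bullet> g (y, x) j) = (\<Sum>j\<in>set ts. u j \<bullet> y + u j \<bullet> x j)"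
        using \<open>t \<notin> set ts\<close> by (intro sum.cong) (auto simp: g_def inner_add_right)
      then show ?thesis
        using \<open>t \<notin> set ts\<close> by (simp add: v g_def sum.distrib inner_add_left inner_sum_left)
    qed
    have g_exp: "iexp (\<Sum>j\<in>set (t # ts). u j \<bullet> g z j) =
        iexp (v \<bullet> fst z) * iexp (\<Sum>j\<in>set ts. u j \<bullet> snd z j)" for z
      by (cases z) (simp only: g_sum fst_conv snd_conv of_real_add distrib_left exp_add)
    have "pathchar R (set (t # ts)) u =
        (\<integral>z. iexp (\<Sum>j\<in>set (t # ts). u j \<bullet> g z j) \<partial>(N \<Otimes>\<^sub>M P))"
      unfolding R_def by (rule integral_distr[OF g meas1])
    also have "\<dots> = (\<integral>z. iexp (v \<bullet> fst z) * iexp (\<Sum>j\<in>set ts. u j \<bullet> snd z j) \<partial>(N \<Otimes>\<^sub>M P))"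
      by (simp only: g_exp)
    also have "\<dots> = (\<integral>y. (\<integral>x. iexp (v \<bullet> y) * iexp (\<Sum>j\<in>set ts. u j \<bullet> x j) \<partial>P) \<partial>N)"
    proof -
      have "integrable (N \<Otimes>\<^sub>M P) (\<lambda>z. iexp (v \<bullet> fst z) * iexp (\<Sum>j\<in>set ts. u j \<bullet> snd z j))"
        using borel_measurable_times[OF measurable_compose[OF measurable_fst meas3]
            measurable_compose[OF measurable_snd meas2]]
        by (intro NP.P.integrable_const_bound[of _ 1]) (simp_all only: norm_mult norm_exp_i_times, simp)
      from NP.integral_fst'[OF this] show ?thesis by simp
    qed
    also have "\<dots> = (\<integral>y. iexp (v \<bullet> y) \<partial>N) * pathchar P (set ts) u"
      by simp
    also have "\<dots> = exp (complex_of_real (t - s) * \<rho> v) * exp (fdd_exponent \<rho> t ts u)"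
      using char_mu[of "t - s" v] charP \<open>s \<le> t\<close> by (simp add: N_def)
    finally show ?thesis by (simp add: exp_add v_def)
  qed
  moreover have "prob_space R"
    unfolding R_def using g by (rule NP.prob_space_distr)
  moreover have "sets R = sets (Pi\<^sub>M (set (t # ts)) (\<lambda>_. borel))"
    by (simp add: R_def)
  ultimately show ?case by blast
qed

definition fdd :: "real set \<Rightarrow> (real \<Rightarrow> 'a) measure" where
  "fdd J = (SOME P. is_fdd J P)"

lemma is_fdd:
  assumes "finite J" "J \<subseteq> {0..}"
  shows "is_fdd J (fdd J)"
proof -
  have "sorted (0 # sorted_list_of_set J)" using assms by auto
  then have "\<exists>P. is_fdd J P"
    using ex_fdd_list[of 0 "sorted_list_of_set J"] assms(1) by (auto simp: is_fdd_def)
  then show ?thesis unfolding fdd_def by (rule someI_ex)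
qed

lemma sum_restrict_support:
  fixes u :: "real \<Rightarrow> 'a"
  assumes "finite H" "K \<subseteq> H"
  shows "(\<Sum>j\<in>K. u j \<bullet> x j) = (\<Sum>j\<in>H. (if j \<in> K then u j else 0) \<bullet> x j)"
  using assms by (intro sum.mono_neutral_cong_left) auto

text \<open>Coefficients outside \<open>K\<close> are set to 0, and the corresponding times then
  drop out of the exponent; thus all marginals of \<open>fdd H\<close> are known.\<close>

lemma char_fdd:
  assumes "finite H" "H \<subseteq> {0..}" "K \<subseteq> H"
  shows "pathchar (fdd H) K u = exp (fdd_exponent \<rho> 0 (sorted_list_of_set K) u)"
proof -
  have fK: "finite K" using assms finite_subset by blast
  have "pathchar (fdd H) K u =
     exp (fdd_exponent \<rho> 0 (sorted_list_of_set H) (\<lambda>j. if j \<in> K then u j else 0))"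
    unfolding sum_restrict_support[OF assms(1,3)]
    by (rule is_fdd[OF assms(1,2), unfolded is_fdd_def, THEN conjunct2, THEN conjunct2, rule_format])
  also have "fdd_exponent \<rho> 0 (sorted_list_of_set H) (\<lambda>j. if j \<in> K then u j else 0) =
     fdd_exponent \<rho> 0 (sorted_list_of_set K) (\<lambda>j. if j \<in> K then u j else 0)"
    using assms by (intro fdd_exponent_superset rho_0) auto
  also have "\<dots> = fdd_exponent \<rho> 0 (sorted_list_of_set K) u"
  proof -
    have "fdd_exponent \<rho> s ts (\<lambda>j. if j \<in> K then u j else 0) = fdd_exponent \<rho> s ts u"
      if "set ts \<subseteq> K" for s ts
      using that by (induction ts arbitrary: s) (auto intro!: arg_cong[where f = \<rho>] arg_cong[where f = sum_list] simp: subset_iff)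
    then show ?thesis using fK by simp
  qed
  finally show ?thesis .
qed

text \<open>Consistency is checked by comparing characteristic functionals of marginals; as the
  state space is Polish, the projective limit \<open>lim\<close> then exists.\<close>

sublocale polish_projective "{0..}" fdd
proof (intro polish_projective.intro projective_family.intro)
  fix J H :: "real set"
  assume JH: "J \<subseteq> H" "finite H" "H \<subseteq> {0..}"
  have J: "finite J" "J \<subseteq> {0..}" using JH finite_subset by auto
  note fJ = is_fdd[OF J] and fH = is_fdd[OF JH(2,3)]
  interpret J: prob_space "fdd J" using fJ by (simp add: is_fdd_def)
  interpret H: prob_space "fdd H" using fH by (simp add: is_fdd_def)
  have setsH: "sets (fdd H) = sets (Pi\<^sub>M H (\<lambda>_. borel))" using fH by (simp add: is_fdd_def)
  have [measurable]: "(\<lambda>f. restrict f J) \<in> fdd H \<rightarrow>\<^sub>M Pi\<^sub>M J (\<lambda>_. borel)"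
    unfolding measurable_cong_sets[OF setsH refl] by (rule measurable_restrict_subset) fact
  have "pathchar (fdd J) K u =
      pathchar (distr (fdd H) (Pi\<^sub>M J (\<lambda>_. borel)) (\<lambda>f. restrict f J)) K u"
    if K: "finite K" "K \<subseteq> J" for K u
  proof -
    have [measurable]: "(\<lambda>x. iexp (\<Sum>j\<in>K. u j \<bullet> x j)) \<in> borel_measurable (Pi\<^sub>M J (\<lambda>_. borel))"
      by measurable (use K in auto)
    have "pathchar (distr (fdd H) (Pi\<^sub>M J (\<lambda>_. borel)) (\<lambda>f. restrict f J)) K u =
        (\<integral>x. iexp (\<Sum>j\<in>K. u j \<bullet> restrict x J j) \<partial>fdd H)"
      by (rule integral_distr) measurable
    also have "\<dots> = pathchar (fdd H) K u"
      using K(2) by (intro Bochner_Integration.integral_cong refl arg_cong[where f = iexp] sum.cong) auto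
    also have "\<dots> = pathchar (fdd J) K u"
      using char_fdd[OF JH(2,3), of K] char_fdd[OF J, of K] K JH(1) by auto
    finally show ?thesis by simp
  qed
  then show "fdd J = distr (fdd H) (Pi\<^sub>M J (\<lambda>_. borel)) (\<lambda>f. restrict f J)"
    using J.prob_space_axioms fJ
    by (intro PiM_measure_eqI_char[where I = J] H.prob_space_distr) (auto simp: is_fdd_def)
next
  fix J :: "real set" assume "finite J" "J \<subseteq> {0..}"
  then show "prob_space (fdd J)" using is_fdd by (simp add: is_fdd_def)
qed

end

section \<open>The coordinate process under the projective limit\<close>

context convolution_semigroup
begin

lemma finite_char:
  assumes "finite J" "J \<subseteq> {0..}"
  shows "pathchar lim J u = exp (fdd_exponent \<rho> 0 (sorted_list_of_set J) u)"
proof -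
  have meas: "(\<lambda>x. iexp (\<Sum>j\<in>J. u j \<bullet> x j)) \<in> borel_measurable (Pi\<^sub>M J (\<lambda>_. borel))"
    by measurable
  have restr: "(\<lambda>f. restrict f J) \<in> lim \<rightarrow>\<^sub>M Pi\<^sub>M J (\<lambda>_. borel)"
    unfolding measurable_cong_sets[OF sets_lim refl] by (rule measurable_restrict_subset) fact
  have "distr lim (Pi\<^sub>M J (\<lambda>_. borel)) (\<lambda>f. restrict f J) = fdd J"
  proof (rule measure_eqI)
    show "sets (distr lim (Pi\<^sub>M J (\<lambda>_. borel)) (\<lambda>f. restrict f J)) = sets (fdd J)"
      using sets_P[OF assms] by simp
    fix A assume "A \<in> sets (distr lim (Pi\<^sub>M J (\<lambda>_. borel)) (\<lambda>f. restrict f J))"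
    then have A: "A \<in> sets (Pi\<^sub>M J (\<lambda>_. borel))" by simp
    have "(\<lambda>f. restrict f J) -` A \<inter> space lim = emb {0..} J A"
      by (simp add: prod_emb_def space_PiM)
    then show "emeasure (distr lim (Pi\<^sub>M J (\<lambda>_. borel)) (\<lambda>f. restrict f J)) A = emeasure (fdd J) A"
      using emeasure_lim_emb[OF assms(2,1) A] emeasure_distr[OF restr A] by simp
  qed
  then have "pathchar (fdd J) J u = (\<integral>x. iexp (\<Sum>j\<in>J. u j \<bullet> restrict x J j) \<partial>lim)"
    using integral_distr[OF restr meas] by simp
  also have "\<dots> = pathchar lim J u"
    by simp
  finally show ?thesis using char_fdd[OF assms, of J u] by simp
qed

lemma measurable_coordinate [measurable]: "0 \<le> t \<Longrightarrow> (\<lambda>\<omega>. \<omega> t) \<in> borel_measurable lim"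
  unfolding measurable_cong_sets[OF sets_lim refl] by (rule measurable_component_singleton) simp

text \<open>Abel summation: with coefficients v (k - 1) - v k, read as 0 beyond the ends, the tail
  sums telescope to v (m - 1). The full sum is 0, so the interval from 0 to \<open>\<tau> 0\<close>
  contributes \<open>\<rho> 0 = 0\<close>.\<close>

lemma fdd_exponent_increments:
  fixes v :: "nat \<Rightarrow> 'a" and u :: "real \<Rightarrow> 'a" and \<tau> :: "nat \<Rightarrow> real"
  assumes u: "\<And>k. k \<le> n \<Longrightarrow> u (\<tau> k) = (if 0 < k then v (k - 1) else 0) - (if k < n then v k else 0)"
  shows "fdd_exponent \<rho> 0 (map \<tau> [0..<Suc n]) u =
           (\<Sum>i<n. complex_of_real (\<tau> (Suc i) - \<tau> i) * \<rho> (v i))"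
proof -
  have tail: "(\<Sum>j\<leftarrow>map \<tau> [m..<Suc n]. u j) = (if 0 < m then v (m - 1) else 0)" if "m \<le> n" for m
    using that
  proof (induction m rule: inc_induct)
    case base
    then show ?case using u[of n] by simp
  next
    case (step m)
    then have eq: "[m..<Suc n] = m # [Suc m..<Suc n]"
      by (intro upt_conv_Cons) simp
    have "(\<Sum>j\<leftarrow>map \<tau> [m..<Suc n]. u j) = u (\<tau> m) + (\<Sum>j\<leftarrow>map \<tau> [Suc m..<Suc n]. u j)"
      by (simp only: eq list.map sum_list.Cons)
    also have "\<dots> = (if 0 < m then v (m - 1) else 0)"
      using step u[of m] by (simp del: upt_Suc)
    finally show ?case .
  qed
  have "fdd_exponent \<rho> (\<tau> m) (map \<tau> [Suc m..<Suc n]) u =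
      (\<Sum>i=m..<n. complex_of_real (\<tau> (Suc i) - \<tau> i) * \<rho> (v i))" if "m \<le> n" for m
    using that
  proof (induction m rule: inc_induct)
    case base
    then show ?case by simp
  next
    case (step m)
    then have eq: "[Suc m..<Suc n] = Suc m # [Suc (Suc m)..<Suc n]"
      by (intro upt_conv_Cons) simp
    have "fdd_exponent \<rho> (\<tau> m) (map \<tau> [Suc m..<Suc n]) u =
       complex_of_real (\<tau> (Suc m) - \<tau> m) * \<rho> (\<Sum>j\<leftarrow>map \<tau> [Suc m..<Suc n]. u j) +
       fdd_exponent \<rho> (\<tau> (Suc m)) (map \<tau> [Suc (Suc m)..<Suc n]) u"
      unfolding eq list.map fdd_exponent.simps ..
    then show ?case
      using step tail[of "Suc m"] by (simp add: sum.atLeast_Suc_lessThan del: upt_Suc)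
  qed
  from this[of 0] have *: "fdd_exponent \<rho> (\<tau> 0) (map \<tau> [Suc 0..<Suc n]) u =
      (\<Sum>i<n. complex_of_real (\<tau> (Suc i) - \<tau> i) * \<rho> (v i))"
    by (simp add: atLeast0LessThan del: upt_Suc)
  have eq: "[0..<Suc n] = 0 # [Suc 0..<Suc n]"
    by (intro upt_conv_Cons) simp
  have "fdd_exponent \<rho> 0 (map \<tau> [0..<Suc n]) u =
     complex_of_real (\<tau> 0 - 0) * \<rho> (\<Sum>j\<leftarrow>map \<tau> [0..<Suc n]. u j) +
       fdd_exponent \<rho> (\<tau> 0) (map \<tau> [Suc 0..<Suc n]) u"
    unfolding eq list.map fdd_exponent.simps ..
  then show ?thesis
    using tail[of 0] rho_0 * by (simp del: upt_Suc)
qed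

text \<open>A functional of the increments is rewritten as one of the positions, whose transform is
  known. The result is a product over the increments, which is what independence requires.\<close>

lemma char_increments:
  fixes \<tau> :: "nat \<Rightarrow> real"
  assumes \<tau>: "0 \<le> \<tau> 0" "\<And>i. i < n \<Longrightarrow> \<tau> i < \<tau> (Suc i)"
  shows "(\<integral>\<omega>. iexp (\<Sum>i<n. v i \<bullet> (\<omega> (\<tau> (Suc i)) - \<omega> (\<tau> i))) \<partial>lim) =
           (\<Prod>i<n. exp (complex_of_real (\<tau> (Suc i) - \<tau> i) * \<rho> (v i)))"
proof -
  have less: "\<tau> i < \<tau> j" if "i < j" "j \<le> n" for i j
    using that
  proof (induction j)
    case (Suc j)
    then show ?case using \<tau>(2)[of j] by (cases "i = j") auto
  qed simp
  then have inj: "inj_on \<tau> {..n}"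
    by (intro linorder_inj_onI) (auto simp: less_le)
  define w where "w k = (if 0 < k then v (k - 1) else 0) - (if k < n then v k else 0)" for k
  \<comment> \<open>Coefficients are found by index but needed by time; \<open>\<tau>\<close> is
    injective because it increases strictly.\<close>
  define u where "u t = w (the_inv_into {..n} \<tau> t)" for t
  have u: "u (\<tau> k) = w k" if "k \<le> n" for k
    using that inj by (simp add: u_def the_inv_into_f_f)
  define J where "J = \<tau> ` {..n}"
  have J: "finite J" "J \<subseteq> {0..}"
  proof -
    have "0 \<le> \<tau> k" if "k \<le> n" for k
      using \<tau>(1) less[of 0 k] that by (cases "k = 0") auto
    then show "finite J" "J \<subseteq> {0..}" by (auto simp: J_def)
  qed
  have "sorted (map \<tau> [0..<Suc n])"
    unfolding sorted_map
    by (rule sorted_wrt_mono_rel[OF _ sorted_wrt_upt]) (auto intro!: less_imp_le[OF less] simp del: upt_Suc)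
  moreover have "distinct (map \<tau> [0..<Suc n])"
    using inj by (simp add: distinct_map atLeast0LessThan lessThan_Suc_atMost del: upt_Suc)
  moreover have "set (map \<tau> [0..<Suc n]) = J"
    by (simp add: J_def atLeast0LessThan lessThan_Suc_atMost del: upt_Suc)
  ultimately have sol: "sorted_list_of_set J = map \<tau> [0..<Suc n]"
    using sorted_list_of_set.idem_if_sorted_distinct[of "map \<tau> [0..<Suc n]"] by (simp only:)
  have "(\<Sum>j\<in>J. u j \<bullet> \<omega> j) = (\<Sum>i<n. v i \<bullet> (\<omega> (\<tau> (Suc i)) - \<omega> (\<tau> i)))" for \<omega> :: "real \<Rightarrow> 'a"
  proof -
    have "(\<Sum>j\<in>J. u j \<bullet> \<omega> j) = (\<Sum>k\<le>n. w k \<bullet> \<omega> (\<tau> k))"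
      unfolding J_def using inj u by (subst sum.reindex) auto
    also have "\<dots> = (\<Sum>k\<le>n. (if 0 < k then v (k - 1) else 0) \<bullet> \<omega> (\<tau> k)) -
        (\<Sum>k\<le>n. (if k < n then v k else 0) \<bullet> \<omega> (\<tau> k))"
      by (simp add: w_def inner_diff_left sum_subtractf)
    also have "(\<Sum>k\<le>n. (if 0 < k then v (k - 1) else 0) \<bullet> \<omega> (\<tau> k)) = (\<Sum>i<n. v i \<bullet> \<omega> (\<tau> (Suc i)))"
      by (subst sum.atMost_shift) simp
    also have "(\<Sum>k\<le>n. (if k < n then v k else 0) \<bullet> \<omega> (\<tau> k)) = (\<Sum>i<n. v i \<bullet> \<omega> (\<tau> i))"
      by (intro sum.mono_neutral_cong_right) auto
    finally show ?thesis by (simp add: inner_diff_right sum_subtractf)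
  qed
  then have "(\<integral>\<omega>. iexp (\<Sum>i<n. v i \<bullet> (\<omega> (\<tau> (Suc i)) - \<omega> (\<tau> i))) \<partial>lim) =
      exp (fdd_exponent \<rho> 0 (sorted_list_of_set J) u)"
    using finite_char[OF J, of u] by simp
  also have "fdd_exponent \<rho> 0 (sorted_list_of_set J) u =
      (\<Sum>i<n. complex_of_real (\<tau> (Suc i) - \<tau> i) * \<rho> (v i))"
    unfolding sol by (rule fdd_exponent_increments) (simp add: u w_def)
  finally show ?thesis by (simp add: exp_sum)
qed

lemma char_coordinate:
  assumes "0 \<le> t"
  shows "(\<integral>\<omega>. iexp (u \<bullet> \<omega> t) \<partial>lim) = exp (complex_of_real t * \<rho> u)"
  using finite_char[of "{t}" "\<lambda>_. u"] assms by simp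

lemma distr_increment:
  assumes "0 \<le> s" "s \<le> t"
  shows "distr lim borel (\<lambda>\<omega>. \<omega> t - \<omega> s) = \<mu> (t - s)"
proof (rule prob_measure_eqI_char)
  have t: "0 \<le> t" using assms by simp
  have [measurable]: "(\<lambda>\<omega>. \<omega> s) \<in> borel_measurable lim" "(\<lambda>\<omega>. \<omega> t) \<in> borel_measurable lim"
    using assms t by measurable
  show "prob_space (distr lim borel (\<lambda>\<omega>. \<omega> t - \<omega> s))"
    by (intro P.prob_space_distr) simp
  fix u :: 'a
  have "charf (distr lim borel (\<lambda>\<omega>. \<omega> t - \<omega> s)) u = (\<integral>\<omega>. iexp (u \<bullet> (\<omega> t - \<omega> s)) \<partial>lim)"
    by (rule integral_distr) measurable
  also have "\<dots> = exp (complex_of_real (t - s) * \<rho> u)"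
  \<comment> \<open>The formula for increments covers strictly increasing times only.\<close>
  proof (cases "s = t")
    case False
    then have "s < t" using assms by simp
    then show ?thesis
      using char_increments[of "\<lambda>i. if i = 0 then s else t" 1 "\<lambda>_. u"] assms by simp
  qed (simp add: P.prob_space[unfolded space_lim])
  finally show "charf (distr lim borel (\<lambda>\<omega>. \<omega> t - \<omega> s)) u = charf (\<mu> (t - s)) u"
    using char_mu[of "t - s" u] assms by simp
qed (use assms prob_mu sets_mu in auto)

lemma distr_coordinate:
  assumes "0 \<le> t"
  shows "distr lim borel (\<lambda>\<omega>. \<omega> t) = \<mu> t"
proof (rule prob_measure_eqI_char)
  have [measurable]: "(\<lambda>\<omega>. \<omega> t) \<in> borel_measurable lim"
    using assms by measurable
  show "prob_space (distr lim borel (\<lambda>\<omega>. \<omega> t))"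
    by (intro P.prob_space_distr) simp
  fix u :: 'a
  have "charf (distr lim borel (\<lambda>\<omega>. \<omega> t)) u = (\<integral>\<omega>. iexp (u \<bullet> \<omega> t) \<partial>lim)"
    by (rule integral_distr) measurable
  then show "charf (distr lim borel (\<lambda>\<omega>. \<omega> t)) u = charf (\<mu> t) u"
    using char_mu[of t u] char_coordinate[OF assms] assms by simp
qed (use assms prob_mu sets_mu in auto)

lemma levy_process_coordinates: "levy_process lim (\<lambda>t \<omega>. \<omega> t)"
proof
  fix t :: real assume "0 \<le> t"
  then show "(\<lambda>\<omega>. \<omega> t) \<in> borel_measurable lim" by measurable
next
  have m0: "(\<lambda>\<omega>. \<omega> 0) \<in> borel_measurable lim" by measurable
  \<comment> \<open>At time 0 \<open>char_mu\<close> gives the constant transform 1, which is that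
    of the Dirac mass at 0.\<close>
  have "distr lim borel (\<lambda>\<omega>. \<omega> 0) = return borel 0"
  proof (rule prob_measure_eqI_char)
    interpret r: prob_space "return borel (0 :: 'a)" by (rule prob_space_return) simp
    show "prob_space (distr lim borel (\<lambda>\<omega>. \<omega> 0))" "prob_space (return borel (0 :: 'a))"
      using m0 r.prob_space_axioms by (auto intro: P.prob_space_distr)
    fix u :: 'a
    show "charf (distr lim borel (\<lambda>\<omega>. \<omega> 0)) u = charf (return borel 0) u"
      using char_mu[of 0 u] distr_coordinate[of 0] by (simp add: integral_return)
  qed auto
  note * = this
  have "AE x in distr lim borel (\<lambda>\<omega>. \<omega> 0). x = 0"
    unfolding * by (subst AE_return) auto
  then show "AE \<omega> in lim. \<omega> 0 = 0"
    using AE_distrD[OF m0] by fast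
next
  fix s t :: real assume st: "0 \<le> s" "s \<le> t"
  then show "distr lim borel (\<lambda>\<omega>. \<omega> t - \<omega> s) = distr lim borel (\<lambda>\<omega>. \<omega> (t - s))"
    using distr_increment[OF st] distr_coordinate[of "t - s"] by simp
next
  fix n :: nat and \<tau> :: "nat \<Rightarrow> real"
  assume \<tau>: "0 \<le> \<tau> 0" "\<And>i. i < n \<Longrightarrow> \<tau> i < \<tau> (Suc i)"
  have nonneg: "0 \<le> \<tau> i" if "i \<le> n" for i
    using that
  proof (induction i)
    case (Suc i)
    then show ?case using \<tau>(2)[of i] by simp
  qed (use \<tau> in simp)
  let ?X = "\<lambda>i \<omega>. \<omega> (\<tau> (Suc i)) - \<omega> (\<tau> i) :: 'a"
  have X[measurable]: "?X i \<in> borel_measurable lim" if "i \<in> {..<n}" for i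
    using that nonneg[of i] nonneg[of "Suc i"] by (intro borel_measurable_diff measurable_coordinate) auto
  show "P.indep_vars (\<lambda>_. borel) ?X {..<n}"
  proof (cases "n = 0")
    case True
    then show ?thesis by (simp add: P.indep_vars_def P.indep_sets_def)
  next
    case False
    \<comment> \<open>Independence is read off from the joint law: it is a product measure because
      its characteristic functional factorizes by \<open>char_increments\<close>.\<close>
    let ?D = "distr lim (Pi\<^sub>M {..<n} (\<lambda>_. borel)) (\<lambda>\<omega>. \<lambda>i\<in>{..<n}. ?X i \<omega>)"
    let ?N = "\<lambda>i. distr lim borel (?X i)"
    have mX: "(\<lambda>\<omega>. \<lambda>i\<in>{..<n}. ?X i \<omega>) \<in> lim \<rightarrow>\<^sub>M Pi\<^sub>M {..<n} (\<lambda>_. borel)"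
      by (intro measurable_restrict X)
    have N: "prob_space (?N i)" if "i < n" for i
      using that by (intro P.prob_space_distr X) simp
    \<comment> \<open>A product over natural numbers asks for a probability measure at every index;
      the Dirac masses fill the indices from \<open>n\<close> on.\<close>
    define N' where "N' i = (if i < n then ?N i else return borel 0)" for i
    have N': "prob_space (N' i)" for i
      using N by (auto simp: N'_def intro: prob_space_return)
    interpret N': product_prob_space N' "{..<n}"
      by (rule product_prob_spaceI) (rule N')
    have PiM_N': "Pi\<^sub>M {..<n} ?N = Pi\<^sub>M {..<n} N'"
      by (intro PiM_cong) (auto simp: N'_def)
    have "?D = Pi\<^sub>M {..<n} ?N"
    proof (rule PiM_measure_eqI_char[where I = "{..<n}"])
      show "prob_space ?D" using mX by (rule P.prob_space_distr)
      show "prob_space (Pi\<^sub>M {..<n} ?N)" using N by (intro prob_space_PiM) auto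
      show "sets (Pi\<^sub>M {..<n} ?N) = sets (Pi\<^sub>M {..<n} (\<lambda>_. borel))"
        by (intro sets_PiM_cong) auto
    next
      fix K :: "nat set" and u :: "nat \<Rightarrow> 'a" assume K: "finite K" "K \<subseteq> {..<n}"
      define v where "v i = (if i \<in> K then u i else 0)" for i
      have ext: "(\<Sum>j\<in>K. u j \<bullet> x j) = (\<Sum>j<n. v j \<bullet> x j)" for x
        unfolding v_def using K by (intro sum.mono_neutral_cong_left) auto
      have meas: "(\<lambda>x. iexp (\<Sum>j<n. v j \<bullet> x j)) \<in> borel_measurable (Pi\<^sub>M {..<n} (\<lambda>_. borel))"
        by measurable
      have "(\<integral>x. iexp (\<Sum>j<n. v j \<bullet> x j) \<partial>?D) =
         (\<integral>\<omega>. iexp (\<Sum>j<n. v j \<bullet> (\<omega> (\<tau> (Suc j)) - \<omega> (\<tau> j))) \<partial>lim)"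
        by (subst integral_distr[OF mX meas]) simp
      also have "\<dots> = (\<Prod>i<n. exp (complex_of_real (\<tau> (Suc i) - \<tau> i) * \<rho> (v i)))"
        by (rule char_increments[OF \<tau>])
      also have "\<dots> = (\<Prod>i<n. \<integral>x. iexp (v i \<bullet> x) \<partial>N' i)"
      proof (rule prod.cong)
        fix i assume "i \<in> {..<n}"
        then have i: "i < n" "0 \<le> \<tau> i" "\<tau> i \<le> \<tau> (Suc i)" using \<tau>(2)[of i] nonneg[of i] by auto
        then show "exp (complex_of_real (\<tau> (Suc i) - \<tau> i) * \<rho> (v i)) = (\<integral>x. iexp (v i \<bullet> x) \<partial>N' i)"
          using distr_increment[OF i(2,3)] char_mu[of "\<tau> (Suc i) - \<tau> i" "v i"] by (simp add: N'_def)
      qed simp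
      also have "\<dots> = (\<integral>x. (\<Prod>i<n. iexp (v i \<bullet> x i)) \<partial>Pi\<^sub>M {..<n} N')"
      proof (rule N'.product_integral_prod[symmetric])
        fix i assume i: "i \<in> {..<n}"
        have "sets (N' i) = sets borel" by (simp add: N'_def)
        then have "(\<lambda>x. iexp (v i \<bullet> x)) \<in> borel_measurable (N' i)"
          by (simp only: measurable_cong_sets[of "N' i" borel, OF _ refl]) measurable
        then show "integrable (N' i) (\<lambda>x. iexp (v i \<bullet> x))"
          by (intro finite_measure.integrable_const_bound[OF prob_space.axioms(1)[OF N'], of _ 1]) auto
      qed simp
      also have "\<dots> = (\<integral>x. iexp (\<Sum>j<n. v j \<bullet> x j) \<partial>Pi\<^sub>M {..<n} N')"
        by (simp add: exp_sum sum_distrib_left)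
      finally show "pathchar ?D K u = pathchar (Pi\<^sub>M {..<n} ?N) K u"
        unfolding ext PiM_N' .
    qed simp
    then show ?thesis
      using False X by (subst P.indep_vars_iff_distr_eq_PiM') auto
  qed
next
  fix t \<epsilon> :: real assume t: "0 \<le> t" and \<epsilon>: "0 < \<epsilon>"
  \<comment> \<open>The norm does not see the sign of an increment, so the two orders of
    \<open>s\<close> and \<open>t\<close> are treated alike.\<close>
  have eq: "P.prob {\<omega> \<in> space lim. \<epsilon> < norm (\<omega> s - \<omega> t)} = measure (\<mu> \<bar>s - t\<bar>) {x. \<epsilon> < norm x}"
    if s: "0 \<le> s" for s
  proof -
    have *: "P.prob {\<omega> \<in> space lim. \<epsilon> < norm (\<omega> b - \<omega> a)} = measure (\<mu> (b - a)) {x. \<epsilon> < norm x}"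
      if ab: "0 \<le> a" "a \<le> b" for a b
    proof -
      have m: "(\<lambda>\<omega>. \<omega> b - \<omega> a) \<in> borel_measurable lim"
        using ab by (intro borel_measurable_diff measurable_coordinate) auto
      have "measure (\<mu> (b - a)) {x. \<epsilon> < norm x} = measure (distr lim borel (\<lambda>\<omega>. \<omega> b - \<omega> a)) {x. \<epsilon> < norm x}"
        using distr_increment[OF ab] by simp
      also have "\<dots> = P.prob ((\<lambda>\<omega>. \<omega> b - \<omega> a) -` {x. \<epsilon> < norm x} \<inter> space lim)"
        by (intro measure_distr m) measurable
      also have "(\<lambda>\<omega>. \<omega> b - \<omega> a) -` {x. \<epsilon> < norm x} \<inter> space lim = {\<omega> \<in> space lim. \<epsilon> < norm (\<omega> b - \<omega> a)}"
        by auto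
      finally show ?thesis by simp
    qed
    show ?thesis
    proof (cases "t \<le> s")
      case True
      then show ?thesis using *[OF t True] by simp
    next
      case False
      then show ?thesis using *[OF s, of t] by (simp add: norm_minus_commute)
    qed
  qed
  have "((\<lambda>s. measure (\<mu> \<bar>s - t\<bar>) {x. \<epsilon> < norm x}) \<longlongrightarrow> 0) (at t within {0..})"
  proof (rule filterlim_compose[OF tendsto_mu[OF \<epsilon>]])
    have "((\<lambda>s. \<bar>s - t\<bar>) \<longlongrightarrow> \<bar>t - t\<bar>) (at t within {0..})"
      by (intro tendsto_intros)
    then show "filterlim (\<lambda>s. \<bar>s - t\<bar>) (at_right 0) (at t within {0..})"
      by (auto simp: filterlim_at eventually_at_filter)
  qed
  then show "((\<lambda>s. P.prob {\<omega> \<in> space lim. \<epsilon> < norm (\<omega> s - \<omega> t)}) \<longlongrightarrow> 0) (at t within {0..})"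
    by (rule Lim_transform_eventually) (auto simp: eventually_at_filter eq[unfolded space_lim] intro!: always_eventually)
qed

lemma levy_exponent_coordinates: "levy_exponent lim (\<lambda>t \<omega>. \<omega> t) \<rho>"
  unfolding levy_exponent_def using char_coordinate by simp

lemma symmetric_process_coordinates:
  assumes even: "\<And>u. \<rho> (- u) = \<rho> u"
  shows "symmetric_process lim (\<lambda>t \<omega>. \<omega> t)"
  unfolding symmetric_process_def
proof (rule PiM_measure_eqI_char[where I = "{0..}"])
  have m1: "(\<lambda>\<omega>. \<lambda>t\<in>{0..}. \<omega> t) \<in> lim \<rightarrow>\<^sub>M Pi\<^sub>M {0..} (\<lambda>_. borel)"
    by (intro measurable_restrict measurable_coordinate) auto
  have m2: "(\<lambda>\<omega>. \<lambda>t\<in>{0..}. - \<omega> t) \<in> lim \<rightarrow>\<^sub>M Pi\<^sub>M {0..} (\<lambda>_. borel)"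
    by (intro measurable_restrict borel_measurable_uminus measurable_coordinate) auto
  show "prob_space (process_law lim (\<lambda>t \<omega>. \<omega> t))" "prob_space (process_law lim (\<lambda>t \<omega>. - \<omega> t))"
    unfolding process_law_def by (intro P.prob_space_distr m1 m2)+
  fix K :: "real set" and u :: "real \<Rightarrow> 'a" assume K: "finite K" "K \<subseteq> {0..}"
  have meas: "(\<lambda>x. iexp (\<Sum>j\<in>K. u j \<bullet> x j)) \<in> borel_measurable (Pi\<^sub>M {0..} (\<lambda>_. borel))"
    by measurable (use K in auto)
  have "pathchar (process_law lim (\<lambda>t \<omega>. \<omega> t)) K u = pathchar lim K u"
    unfolding process_law_def integral_distr[OF m1 meas] using K(2)
    by (intro Bochner_Integration.integral_cong refl arg_cong[where f = iexp] sum.cong) auto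
  also have "\<dots> = pathchar lim K (\<lambda>j. - u j)"
    using finite_char[OF K, of u] finite_char[OF K, of "\<lambda>j. - u j"] fdd_exponent_uminus[of \<rho>, OF even] by simp
  also have "\<dots> = pathchar (process_law lim (\<lambda>t \<omega>. - \<omega> t)) K u"
    unfolding process_law_def integral_distr[OF m2 meas] using K(2)
    by (intro Bochner_Integration.integral_cong refl arg_cong[where f = iexp] sum.cong) auto
  finally show "pathchar (process_law lim (\<lambda>t \<omega>. \<omega> t)) K u =
    pathchar (process_law lim (\<lambda>t \<omega>. - \<omega> t)) K u" .
qed (simp_all add: process_law_def)

end

section \<open>Characteristic functionals of symmetric Levy processes\<close>

text \<open>An additive nonnegative function is monotone. With m = \<lfloor>n t\<rfloor> both n h(t)
  and n t h(1) lie between m h(1) and (m + 1) h(1), so n |h(t) - t h(1)| \<le> h(1) for every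
  n.\<close>

lemma additive_nonneg_imp_linear:
  fixes h :: "real \<Rightarrow> real"
  assumes add: "\<And>s t. 0 \<le> s \<Longrightarrow> 0 \<le> t \<Longrightarrow> h (s + t) = h s + h t"
    and nonneg: "\<And>t. 0 \<le> t \<Longrightarrow> 0 \<le> h t" and t: "0 \<le> t"
  shows "h t = t * h 1"
proof -
  have mult: "h (real n * s) = real n * h s" if "0 \<le> s" for n s
  proof (induction n)
    case 0
    show ?case using add[of 0 0] by simp
  next
    case (Suc n)
    then show ?case using add[of s "real n * s"] that by (simp add: algebra_simps)
  qed
  have mono: "h s \<le> h t" if "0 \<le> s" "s \<le> t" for s t
    using add[of s "t - s"] nonneg[of "t - s"] that by simp
  have bound: "real n * \<bar>h t - t * h 1\<bar> \<le> h 1" for n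
  proof -
    define m where "m = nat \<lfloor>real n * t\<rfloor>"
    have "real m = real_of_int \<lfloor>real n * t\<rfloor>"
      using t by (simp add: m_def)
    then have m: "real m \<le> real n * t" "real n * t \<le> real (Suc m)"
      by linarith+
    have "real m * h 1 \<le> real n * h t" "real n * h t \<le> real (Suc m) * h 1"
      using mono[OF _ m(1)] mono[OF _ m(2)] mult[of 1 m] mult[of 1 "Suc m"] mult[of t n] t by auto
    moreover have "real m * h 1 \<le> real n * t * h 1" "real n * t * h 1 \<le> real (Suc m) * h 1"
      using m nonneg[of 1] by (auto intro!: mult_right_mono)
    ultimately have "\<bar>real n * (h t - t * h 1)\<bar> \<le> h 1"
      by (simp add: algebra_simps abs_le_iff)
    then show ?thesis by (simp add: abs_mult)
  qed
  show ?thesis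
  proof (rule ccontr)
    assume "h t \<noteq> t * h 1"
    then obtain n where "h 1 < real n * \<bar>h t - t * h 1\<bar>"
      using reals_Archimedean3[of "\<bar>h t - t * h 1\<bar>"] by auto
    with bound[of n] show False by simp
  qed
qed

text \<open>The difference of the two sides is 2 (1 - cos x)^2.\<close>

lemma one_minus_cos_double_le: "1 - cos (2 * x) \<le> 4 * (1 - cos (x::real))"
proof -
  have "0 \<le> 2 * (1 - cos x)\<^sup>2" by simp
  then show ?thesis using cos_double_cos[of x] by (simp add: power2_eq_square algebra_simps)
qed

lemma one_minus_cos_le_abs: "1 - cos x \<le> \<bar>x::real\<bar>"
proof -
  have "1 - cos x = 2 * (sin (x / 2))\<^sup>2"
    using cos_double_sin[of "x / 2"] by simp
  also have "(sin (x / 2))\<^sup>2 \<le> \<bar>sin (x / 2)\<bar>"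
    using abs_sin_le_one[of "x / 2"] mult_left_le[of "\<bar>sin (x / 2)\<bar>" "\<bar>sin (x / 2)\<bar>"]
    by (simp add: power2_eq_square abs_mult[symmetric])
  also have "\<bar>sin (x / 2)\<bar> \<le> \<bar>x / 2\<bar>"
    by (rule abs_sin_x_le_abs_x)
  finally show ?thesis by simp
qed

context levy_process
begin

lemma distr_uminus:
  assumes "symmetric_process M Y" "0 \<le> t"
  shows "distr M borel (Y t) = distr M borel (\<lambda>w. - Y t w)"
proof -
  have m: "(\<lambda>x. x t) \<in> borel_measurable (Pi\<^sub>M {0..} (\<lambda>_. borel :: 'a measure))"
    using assms(2) by (intro measurable_component_singleton) auto
  have "(\<lambda>w. \<lambda>t\<in>{0..}. Y t w) \<in> M \<rightarrow>\<^sub>M Pi\<^sub>M {0..} (\<lambda>_. borel)"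
    "(\<lambda>w. \<lambda>t\<in>{0..}. - Y t w) \<in> M \<rightarrow>\<^sub>M Pi\<^sub>M {0..} (\<lambda>_. borel)"
    using random_variable by (auto intro!: measurable_restrict)
  from this[THEN distr_distr[OF m]]
  have "distr (process_law M Y) borel (\<lambda>x. x t) = distr M borel (Y t)"
    "distr (process_law M (\<lambda>t w. - Y t w)) borel (\<lambda>x. x t) = distr M borel (\<lambda>w. - Y t w)"
    using assms(2) by (auto simp: process_law_def o_def)
  then show ?thesis using assms(1) by (simp add: symmetric_process_def)
qed

text \<open>The real part of the characteristic functional; for symmetric processes it is all of it,
  by \<open>char_eq_rchar\<close>.\<close>

definition rchar :: "real \<Rightarrow> 'a \<Rightarrow> real" where
  "rchar t u = (\<integral>w. cos (u \<bullet> Y t w) \<partial>M)"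

lemma integrable_cos: "0 \<le> t \<Longrightarrow> integrable M (\<lambda>w. cos (u \<bullet> Y t w))"
  using random_variable by (intro integrable_const_bound[of _ 1]) auto

lemma char_add:
  assumes st: "0 < s" "0 < t"
  shows "(\<integral>w. iexp (u \<bullet> Y (s + t) w) \<partial>M) = (\<integral>w. iexp (u \<bullet> Y s w) \<partial>M) * (\<integral>w. iexp (u \<bullet> Y t w) \<partial>M)"
proof -
  \<comment> \<open>The partition 0 < s < s + t of two increments; as \<open>Y 0 = 0\<close> holds
    only almost surely, the factorization below is an equality almost everywhere.\<close>
  define \<tau> where "\<tau> i = (if i = 0 then 0 else if i = Suc 0 then s else s + t)" for i
  let ?X = "\<lambda>i w. Y (\<tau> (Suc i)) w - Y (\<tau> i) w"
  let ?E = "\<lambda>(i::nat) x. iexp (u \<bullet> x)"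
  have rv: "Y r \<in> borel_measurable M" if "r \<in> {0, s, t, s + t}" for r
    using that st by (intro random_variable) auto
  note [measurable] = rv[of 0] rv[of s] rv[of t] rv[of "s + t"]
  have ind: "indep_vars (\<lambda>_. borel) ?X {..<2}"
    using st by (intro indep_increments) (auto simp: \<tau>_def)
  have ind': "indep_vars (\<lambda>_. borel) (\<lambda>i. ?E i \<circ> ?X i) {..<2}"
    by (rule indep_vars_compose[OF ind]) simp
  have step: "(\<integral>w. iexp (u \<bullet> (Y b w - Y a w)) \<partial>M) = (\<integral>w. iexp (u \<bullet> Y (b - a) w) \<partial>M)"
    if ab: "0 \<le> a" "a \<le> b" for a b
  proof -
    have [measurable]: "Y a \<in> borel_measurable M" "Y b \<in> borel_measurable M" "Y (b - a) \<in> borel_measurable M"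
      using ab by (auto intro: random_variable)
    have "(\<integral>w. iexp (u \<bullet> (Y b w - Y a w)) \<partial>M) =
        charf (distr M borel (\<lambda>w. Y b w - Y a w)) u"
      by (rule integral_distr[symmetric]) measurable
    also have "\<dots> = charf (distr M borel (Y (b - a))) u"
      using stationary_increments[OF ab] by simp
    also have "\<dots> = (\<integral>w. iexp (u \<bullet> Y (b - a) w) \<partial>M)"
      by (rule integral_distr) measurable
    finally show ?thesis .
  qed
  have "(\<integral>w. iexp (u \<bullet> Y (s + t) w) \<partial>M) = (\<integral>w. (\<Prod>i<2. (?E i \<circ> ?X i) w) \<partial>M)"
  proof (rule integral_cong_AE)
    show "AE w in M. iexp (u \<bullet> Y (s + t) w) = (\<Prod>i<2. (?E i \<circ> ?X i) w)"
      using start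
    proof eventually_elim
      case (elim w)
      have "u \<bullet> Y (s + t) w = u \<bullet> (Y s w - Y 0 w) + u \<bullet> (Y (s + t) w - Y s w)"
        using elim by (simp add: inner_diff_right)
      then have "iexp (u \<bullet> Y (s + t) w) = iexp (u \<bullet> (Y s w - Y 0 w)) * iexp (u \<bullet> (Y (s + t) w - Y s w))"
        by (simp only: of_real_add distrib_left exp_add)
      then show ?case by (simp add: \<tau>_def numeral_2_eq_2 lessThan_Suc)
    qed
  qed (simp_all add: \<tau>_def numeral_2_eq_2 lessThan_Suc)
  also have "\<dots> = (\<Prod>i<2. \<integral>w. (?E i \<circ> ?X i) w \<partial>M)"
  proof (rule indep_vars_lebesgue_integral[OF _ ind'])
    fix i :: nat assume "i \<in> {..<2}"
    then have i: "i = 0 \<or> i = 1" by auto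
    then show "integrable M (?E i \<circ> ?X i)"
      by (intro integrable_const_bound[of _ 1]) (auto simp: \<tau>_def)
  qed simp
  also have "\<dots> = (\<integral>w. iexp (u \<bullet> (Y s w - Y 0 w)) \<partial>M) * (\<integral>w. iexp (u \<bullet> (Y (s + t) w - Y s w)) \<partial>M)"
    by (simp add: \<tau>_def numeral_2_eq_2 lessThan_Suc mult.commute)
  also have "\<dots> = (\<integral>w. iexp (u \<bullet> Y s w) \<partial>M) * (\<integral>w. iexp (u \<bullet> Y t w) \<partial>M)"
    using step[of 0 s] step[of s "s + t"] st by simp
  finally show ?thesis .
qed

lemma char_eq_rchar:
  assumes "symmetric_process M Y" "0 \<le> t"
  shows "(\<integral>w. iexp (u \<bullet> Y t w) \<partial>M) = complex_of_real (rchar t u)"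
proof -
  note [measurable] = random_variable[OF assms(2)]
  have "(\<integral>w. sin (u \<bullet> Y t w) \<partial>M) = (\<integral>x. sin (u \<bullet> x) \<partial>distr M borel (Y t))"
    by (rule integral_distr[symmetric]) measurable
  also have "\<dots> = (\<integral>x. sin (u \<bullet> x) \<partial>distr M borel (\<lambda>w. - Y t w))"
    using distr_uminus[OF assms] by simp
  also have "\<dots> = (\<integral>w. sin (u \<bullet> (- Y t w)) \<partial>M)"
    by (rule integral_distr) measurable
  finally have sin0: "(\<integral>w. sin (u \<bullet> Y t w) \<partial>M) = 0" by simp
  have "integrable M (\<lambda>w. iexp (u \<bullet> Y t w))"
    by (intro integrable_const_bound[of _ 1]) auto
  then have "Re (\<integral>w. iexp (u \<bullet> Y t w) \<partial>M) = rchar t u" "Im (\<integral>w. iexp (u \<bullet> Y t w) \<partial>M) = 0"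
    using sin0 by (simp_all add: rchar_def integral_Re[symmetric] integral_Im[symmetric] Re_exp Im_exp)
  then show ?thesis by (simp add: complex_eq_iff)
qed

lemma rchar_0: "rchar 0 u = 1"
proof -
  have "rchar 0 u = (\<integral>w. 1 \<partial>M)"
    unfolding rchar_def using random_variable[of 0] start by (intro integral_cong_AE) auto
  then show ?thesis by (simp add: prob_space)
qed

lemma rchar_add:
  assumes "symmetric_process M Y" "0 \<le> s" "0 \<le> t"
  shows "rchar (s + t) u = rchar s u * rchar t u"
proof (cases "s = 0 \<or> t = 0")
  case True
  then show ?thesis by (auto simp: rchar_0)
next
  case False
  then have "complex_of_real (rchar (s + t) u) = complex_of_real (rchar s u * rchar t u)"
    using char_add[of s t u] assms by (simp add: char_eq_rchar)
  then show ?thesis by (simp only: of_real_eq_iff)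
qed

lemma rchar_le_1: "0 \<le> t \<Longrightarrow> rchar t u \<le> 1"
  unfolding rchar_def using integral_mono[OF integrable_cos[of t u], of "\<lambda>_. 1"] by (simp add: prob_space)

text \<open>Splitting at norm \<open>\<epsilon>\<close> gives 1 - rchar \<le> 1/4 + 2 P(norm >
  \<open>\<epsilon>\<close>), and stochastic continuity at 0 makes this less than 3/4 for small
  times.\<close>

lemma rchar_pos_small:
  obtains \<delta> where "0 < \<delta>" "\<And>t. 0 < t \<Longrightarrow> t < \<delta> \<Longrightarrow> 0 < rchar t u"
proof -
  \<comment> \<open>On vectors of norm at most \<open>\<epsilon>\<close> the bound 1 - cos x \<le>
    |x| yields 1/4; the summand 1 covers u = 0.\<close>
  define \<epsilon> where "\<epsilon> = 1 / (4 * (norm u + 1))"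
  have \<epsilon>: "0 < \<epsilon>" "norm u * \<epsilon> \<le> 1 / 4"
    by (auto simp: \<epsilon>_def divide_simps add_nonneg_pos)
  have "\<forall>\<^sub>F s in at 0 within {0..}. prob {w \<in> space M. \<epsilon> < norm (Y s w - Y 0 w)} < 1 / 4"
    using order_tendstoD(2)[OF stochastically_continuous[of 0 \<epsilon>], of "1/4"] \<epsilon>(1) by simp
  then obtain \<delta> where \<delta>: "0 < \<delta>"
    "\<And>s. s \<in> {0..} \<Longrightarrow> s \<noteq> 0 \<Longrightarrow> dist s 0 < \<delta> \<Longrightarrow> prob {w \<in> space M. \<epsilon> < norm (Y s w - Y 0 w)} < 1 / 4"
    unfolding eventually_at by blast
  show ?thesis
  proof (rule that[OF \<delta>(1)])
    fix t assume t: "0 < t" "t < \<delta>"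
    note [measurable] = random_variable[OF less_imp_le[OF t(1)]] random_variable[of 0, simplified]
    define A where "A = {w \<in> space M. \<epsilon> < norm (Y t w - Y 0 w)}"
    have [measurable]: "A \<in> sets M" unfolding A_def by measurable
    have "1 - rchar t u = (\<integral>w. 1 - cos (u \<bullet> Y t w) \<partial>M)"
      unfolding rchar_def using integrable_cos[of t u] t by (simp add: prob_space)
    also have "\<dots> \<le> (\<integral>w. 1 / 4 + 2 * indicator A w \<partial>M)"
    proof (rule integral_mono_AE)
      show "integrable M (\<lambda>w. 1 - cos (u \<bullet> Y t w))"
        using integrable_cos[of t u] t by simp
      show "integrable M (\<lambda>w. 1 / 4 + 2 * indicator A w :: real)"
        by (simp add: emeasure_eq_measure)
      show "AE w in M. 1 - cos (u \<bullet> Y t w) \<le> 1 / 4 + 2 * indicator A w"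
        using start AE_space
      proof eventually_elim
        case (elim w)
        show ?case
        proof (cases "w \<in> A")
          case True
          then show ?thesis using cos_ge_minus_one[of "u \<bullet> Y t w"]
            by (simp only: indicator_simps)
        next
          case False
          then have "norm (Y t w) \<le> \<epsilon>" using elim by (simp add: A_def)
          then have "\<bar>u \<bullet> Y t w\<bar> \<le> norm u * \<epsilon>"
            using Cauchy_Schwarz_ineq2[of u "Y t w"] mult_left_mono[of "norm (Y t w)" \<epsilon> "norm u"] by simp
          then show ?thesis using one_minus_cos_le_abs[of "u \<bullet> Y t w"] \<epsilon>(2) False by simp
        qed
      qed
    qed
    also have "\<dots> = 1 / 4 + 2 * prob A"
      by (simp add: prob_space emeasure_eq_measure)
    also have "prob A < 1 / 4"
      unfolding A_def using \<delta>(2)[of t] t by simp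
    finally show "0 < rchar t u" by simp
  qed
qed

text \<open>Since rchar t is the square of rchar (t / 2), positivity at a small time t / 2^n climbs
  back to t in n doublings.\<close>

lemma rchar_pos:
  assumes sym: "symmetric_process M Y" and t: "0 \<le> t"
  shows "0 < rchar t u"
proof (cases "t = 0")
  case False
  obtain \<delta> where \<delta>: "0 < \<delta>" "\<And>t. 0 < t \<Longrightarrow> t < \<delta> \<Longrightarrow> 0 < rchar t u"
    using rchar_pos_small by blast
  have double: "0 < rchar s u" if "0 \<le> s" "0 < rchar (s / 2) u" for s
    using rchar_add[OF sym, of "s / 2" "s / 2" u] that by simp
  obtain n where "t / \<delta> < 2 ^ n"
    using real_arch_pow[of 2 "t / \<delta>"] by auto
  then have "t / 2 ^ n < \<delta>"
    using \<delta>(1) by (simp add: field_simps)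
  then have "0 < rchar (t / 2 ^ n) u" using \<delta>(2) False t by simp
  then show ?thesis
  proof (induction n)
    case (Suc n)
    then show ?case using double[of "t / 2 ^ n"] t by (simp add: field_simps)
  qed simp
qed (simp add: rchar_0)

text \<open>As 0 < rchar \<le> 1 and rchar is multiplicative in time, its negative logarithm is
  additive and nonnegative, hence linear in \<open>t\<close>.\<close>

lemma rchar_eq_exp:
  assumes sym: "symmetric_process M Y" and t: "0 \<le> t"
  shows "rchar t u = exp (- t * (- ln (rchar 1 u)))"
proof -
  have "- ln (rchar t u) = t * (- ln (rchar 1 u))"
  proof (rule additive_nonneg_imp_linear[OF _ _ t])
    fix s t :: real assume st: "0 \<le> s" "0 \<le> t"
    then show "- ln (rchar (s + t) u) = - ln (rchar s u) + - ln (rchar t u)"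
      using rchar_add[OF sym st] rchar_pos[OF sym st(1)] rchar_pos[OF sym st(2)] by (simp add: ln_mult_pos)
    show "0 \<le> - ln (rchar t u)"
      using rchar_le_1[OF st(2)] rchar_pos[OF sym st(2)] by (simp add: ln_le_zero_iff)
  qed
  then have "ln (rchar t u) = - t * (- ln (rchar 1 u))" by simp
  then show ?thesis using rchar_pos[OF sym t, of u] by (metis exp_ln)
qed

lemma continuous_rchar: "continuous_on UNIV (rchar 1)"
  unfolding continuous_on_sequentially o_def
proof safe
  fix x :: "nat \<Rightarrow> 'a" and a assume "x \<longlonglongrightarrow> a"
  note [measurable] = random_variable[of 1, simplified]
  show "(\<lambda>n. rchar 1 (x n)) \<longlonglongrightarrow> rchar 1 a"
    unfolding rchar_def
    by (rule integral_dominated_convergence[where w = "\<lambda>_. 1"])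
       (use \<open>x \<longlonglongrightarrow> a\<close> in \<open>auto intro!: tendsto_intros\<close>)
qed

lemma rchar_double_le:
  assumes "0 \<le> t"
  shows "1 - rchar t (2 *\<^sub>R u) \<le> 4 * (1 - rchar t u)"
proof -
  have "1 - rchar t (2 *\<^sub>R u) = (\<integral>w. 1 - cos (2 * (u \<bullet> Y t w)) \<partial>M)"
    unfolding rchar_def using integrable_cos[OF assms, of "2 *\<^sub>R u"] by (simp add: prob_space)
  also have "\<dots> \<le> (\<integral>w. 4 * (1 - cos (u \<bullet> Y t w)) \<partial>M)"
    using integrable_cos[OF assms, of "2 *\<^sub>R u"] integrable_cos[OF assms, of u]
    by (intro integral_mono one_minus_cos_double_le) auto
  also have "\<dots> = 4 * (1 - rchar t u)"
    unfolding rchar_def using integrable_cos[OF assms, of u] by (simp add: prob_space)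
  finally show ?thesis .
qed

lemma rchar_uminus: "rchar t (- u) = rchar t u"
  by (simp add: rchar_def)

lemma rchar_stable:
  assumes "strictly_stable \<alpha> M Y" "0 \<le> s"
  shows "rchar (s powr \<alpha>) u = rchar 1 (s *\<^sub>R u)"
proof -
  note [measurable] = random_variable[of 1, simplified] random_variable[of "s powr \<alpha>", simplified]
  have "rchar (s powr \<alpha>) u = (\<integral>x. cos (u \<bullet> x) \<partial>distr M borel (Y (s powr \<alpha>)))"
    unfolding rchar_def by (rule integral_distr[symmetric]) measurable
  also have "\<dots> = (\<integral>x. cos (u \<bullet> x) \<partial>distr M borel (\<lambda>w. s *\<^sub>R Y 1 w))"
    using assms by (simp add: strictly_stable_def)
  also have "\<dots> = (\<integral>w. cos (u \<bullet> (s *\<^sub>R Y 1 w)) \<partial>M)"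
    by (rule integral_distr) measurable
  finally show ?thesis by (simp add: rchar_def)
qed

text \<open>The exponent vanishes, so the transform of every \<open>Y t\<close> is 1, as for the
  Dirac mass at 0. Both bounds on the stability index are proved by contradiction to this.\<close>

lemma trivial_if_rchar_1:
  assumes sym: "symmetric_process M Y" and 1: "\<And>u. rchar 1 u = 1"
  shows "\<not> nontrivial_process M Y"
proof -
  have "prob {w \<in> space M. Y t w \<noteq> 0} = 0" if t: "0 \<le> t" for t
  proof -
    note [measurable] = random_variable[OF t]
    have "distr M borel (Y t) = return borel 0"
    proof (rule prob_measure_eqI_char)
      show "prob_space (distr M borel (Y t))" by (rule prob_space_distr) measurable
      show "prob_space (return borel (0 :: 'a))" by (rule prob_space_return) simp
      fix u :: 'a
      have "charf (distr M borel (Y t)) u = (\<integral>w. iexp (u \<bullet> Y t w) \<partial>M)"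
        by (rule integral_distr) measurable
      also have "\<dots> = 1"
        using char_eq_rchar[OF sym t] rchar_eq_exp[OF sym t, of u] 1 by simp
      finally show "charf (distr M borel (Y t)) u = charf (return borel 0) u"
        by (simp add: integral_return)
    qed auto
    then have "measure (distr M borel (Y t)) {x. x \<noteq> 0} = measure (return borel 0) {x :: 'a. x \<noteq> 0}"
      by simp
    moreover have "measure (return borel 0) {x :: 'a. x \<noteq> 0} = 0"
      by (subst measure_return) auto
    moreover have "measure (distr M borel (Y t)) {x. x \<noteq> 0} = prob {w \<in> space M. Y t w \<noteq> 0}"
      by (subst measure_distr) (auto intro!: arg_cong[where f = prob])
    ultimately show ?thesis by simp
  qed
  then show ?thesis by (auto simp: nontrivial_process_def)
qed

lemma stable_index_range:
  assumes sym: "symmetric_process M Y" and stable: "strictly_stable \<alpha> M Y"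
    and nt: "nontrivial_process M Y" and "0 \<le> \<alpha>"
  shows "0 < \<alpha>" "\<alpha> \<le> 2"
proof -
  define \<psi> where "\<psi> u = - ln (rchar 1 u)" for u
  have r: "rchar t u = exp (- t * \<psi> u)" if "0 \<le> t" for t u
    using rchar_eq_exp[OF sym that] by (simp add: \<psi>_def)
  have scale: "rchar 1 (s *\<^sub>R u) = exp (- (s powr \<alpha>) * \<psi> u)" if "0 \<le> s" for s u
    using rchar_stable[OF stable that, of u] r[of "s powr \<alpha>" u] by simp
  have half_tendsto: "(\<lambda>n. rchar 1 ((1/2) ^ n *\<^sub>R u)) \<longlonglongrightarrow> 1" for u
  proof -
    have "(\<lambda>n. (1/2) ^ n *\<^sub>R u) \<longlonglongrightarrow> 0 *\<^sub>R u"
      by (intro tendsto_scaleR tendsto_const LIMSEQ_realpow_zero) auto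
    then have "(\<lambda>n. rchar 1 ((1/2) ^ n *\<^sub>R u)) \<longlonglongrightarrow> rchar 1 (0 *\<^sub>R u)"
      using continuous_rchar by (intro isCont_tendsto_compose[of _ "rchar 1"])
        (auto simp: continuous_on_eq_continuous_at)
    then show ?thesis by (simp add: rchar_def prob_space)
  qed
  show "0 < \<alpha>"
  proof (rule ccontr)
    \<comment> \<open>For \<alpha> = 0 the function \<open>rchar 1\<close> is constant along open
      rays, so continuity at the origin forces the value 1.\<close>
    assume "\<not> 0 < \<alpha>"
    then have "\<alpha> = 0" using \<open>0 \<le> \<alpha>\<close> by simp
    then have "rchar 1 ((1/2) ^ n *\<^sub>R u) = rchar 1 u" for n u
      using scale[of "(1/2) ^ n" u] scale[of 1 u] by simp
    then have "rchar 1 u = 1" for u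
      using half_tendsto[of u] by (simp add: LIMSEQ_const_iff)
    then show False using trivial_if_rchar_1[OF sym] nt by simp
  qed
  show "\<alpha> \<le> 2"
  proof (rule ccontr)
    assume "\<not> \<alpha> \<le> 2"
    then have \<alpha>: "2 < \<alpha>" by simp
    have "rchar 1 u = 1" for u
    proof -
      have \<psi>: "0 \<le> \<psi> u"
        using rchar_le_1[of 1 u] rchar_pos[OF sym, of 1 u] by (simp add: \<psi>_def ln_le_zero_iff)
      \<comment> \<open>Halving the argument costs a factor 4 at most, by the double-angle
        bound.\<close>
      have iter: "1 - rchar 1 u \<le> 4 ^ n * (1 - rchar 1 ((1/2) ^ n *\<^sub>R u))" for n
      proof (induction n)
        case (Suc n)
        have "2 *\<^sub>R ((1/2) ^ Suc n *\<^sub>R u) = (1/2) ^ n *\<^sub>R u" by simp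
        then have "1 - rchar 1 ((1/2) ^ n *\<^sub>R u) \<le> 4 * (1 - rchar 1 ((1/2) ^ Suc n *\<^sub>R u))"
          using rchar_double_le[of 1 "(1/2) ^ Suc n *\<^sub>R u"] by simp
        then have "4 ^ n * (1 - rchar 1 ((1/2) ^ n *\<^sub>R u)) \<le> 4 ^ n * (4 * (1 - rchar 1 ((1/2) ^ Suc n *\<^sub>R u)))"
          by (rule mult_left_mono) simp
        also have "\<dots> = 4 ^ Suc n * (1 - rchar 1 ((1/2) ^ Suc n *\<^sub>R u))"
          by (simp only: power_Suc mult_ac)
        finally show ?case by (rule order_trans[OF Suc])
      qed simp
      \<comment> \<open>By homogeneity the halved argument contributes at most 2^(- n \<alpha>)
        \<psi>(u), since 1 - exp (- x) \<le> x. Against the factor 4^n this still decays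
        geometrically when \<alpha> > 2.\<close>
      have bound: "1 - rchar 1 u \<le> ((1/2) powr (\<alpha> - 2)) ^ n * \<psi> u" for n
      proof -
        have "1 - rchar 1 ((1/2) ^ n *\<^sub>R u) \<le> ((1/2) ^ n) powr \<alpha> * \<psi> u"
          using exp_ge_add_one_self[of "- (((1/2) ^ n) powr \<alpha>) * \<psi> u"] scale[of "(1/2) ^ n" u] by simp
        then have "1 - rchar 1 u \<le> 4 ^ n * (((1/2) ^ n) powr \<alpha> * \<psi> u)"
          by (intro order_trans[OF iter[of n]] mult_left_mono) auto
        also have "\<dots> = ((1/2) powr (\<alpha> - 2)) ^ n * \<psi> u"
        proof -
          have "((1/2::real) ^ n) powr \<alpha> = ((1/2) powr \<alpha>) ^ n"
            by (simp add: powr_realpow[symmetric] powr_powr mult.commute)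
          moreover have "4 ^ n * ((1/2::real) powr \<alpha>) ^ n = ((1/2) powr (\<alpha> - 2)) ^ n"
          proof -
            have "4 * (1/2::real) powr \<alpha> = (1/2) powr (\<alpha> - 2)"
              by (simp add: powr_diff power2_eq_square)
            then show ?thesis by (simp only: power_mult_distrib[symmetric])
          qed
          ultimately show ?thesis by simp
        qed
        finally show ?thesis .
      qed
      have "(1/2::real) powr (\<alpha> - 2) < 1"
        using gr_one_powr[of 2 "\<alpha> - 2"] \<alpha> by (simp add: powr_divide)
      then have "(\<lambda>n. ((1/2) powr (\<alpha> - 2)) ^ n * \<psi> u) \<longlonglongrightarrow> 0 * \<psi> u"
        by (intro tendsto_mult tendsto_const LIMSEQ_realpow_zero) auto
      then have "1 - rchar 1 u \<le> 0"
        using bound by (intro LIMSEQ_le_const[of _ 0]) auto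
      then show ?thesis using rchar_le_1[of 1 u] by simp
    qed
    then show False using trivial_if_rchar_1[OF sym] nt by simp
  qed
qed

lemma stable_levy_exponent:
  assumes sym: "symmetric_process M Y" and stable: "strictly_stable \<alpha> M Y"
  shows "\<exists>f. continuous_on (sphere 0 1) f \<and> (\<forall>v\<in>sphere 0 1. 0 \<le> f v \<and> f (- v) = f v) \<and>
           (\<exists>\<rho>. levy_exponent M Y \<rho> \<and> \<rho> 0 = 0 \<and>
              (\<forall>u. u \<noteq> 0 \<longrightarrow> \<rho> u = - complex_of_real (norm u powr \<alpha> * f (u /\<^sub>R norm u))))"
proof -
  define \<psi> where "\<psi> u = - ln (rchar 1 u)" for u
  have r: "rchar t u = exp (- t * \<psi> u)" if "0 \<le> t" for t u
    using rchar_eq_exp[OF sym that] by (simp add: \<psi>_def)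
  have le: "levy_exponent M Y (\<lambda>u. - complex_of_real (\<psi> u))"
    unfolding levy_exponent_def using r by (simp add: char_eq_rchar[OF sym] exp_of_real[symmetric])
  have psi_0: "\<psi> 0 = 0" by (simp add: \<psi>_def rchar_def prob_space)
  \<comment> \<open>Stability at the scale |u|, applied to the unit vector in direction
    \<open>u\<close>. Hence \<open>\<psi>\<close> itself serves as \<open>f\<close>.\<close>
  have scale: "\<psi> u = norm u powr \<alpha> * \<psi> (u /\<^sub>R norm u)" if "u \<noteq> 0" for u
  proof -
    have "exp (- (norm u powr \<alpha>) * \<psi> (u /\<^sub>R norm u)) = exp (- 1 * \<psi> u)"
      using rchar_stable[OF stable, of "norm u" "u /\<^sub>R norm u"] r[of "norm u powr \<alpha>" "u /\<^sub>R norm u"]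
        r[of 1 u] that by simp
    then show ?thesis by (simp only: exp_inj_iff)
  qed
  have cont: "continuous_on (sphere 0 1) \<psi>"
    unfolding \<psi>_def using rchar_pos[OF sym, of 1]
    by (intro continuous_intros continuous_on_subset[OF continuous_rchar]) (auto simp: less_imp_neq[symmetric])
  have nonneg: "0 \<le> \<psi> v" for v
    using rchar_le_1[of 1 v] rchar_pos[OF sym, of 1 v] by (simp add: \<psi>_def ln_le_zero_iff)
  have even: "\<psi> (- v) = \<psi> v" for v by (simp add: \<psi>_def rchar_uminus)
  show ?thesis
  proof (intro exI[of _ \<psi>] conjI ballI exI[of _ "\<lambda>u. - complex_of_real (\<psi> u)"] allI impI)
    fix u :: 'a assume "u \<noteq> 0"
    from scale[OF this] show "- complex_of_real (\<psi> u) = - complex_of_real (norm u powr \<alpha> * \<psi> (u /\<^sub>R norm u))"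
      by (rule arg_cong[where f = "\<lambda>x. - complex_of_real x"])
  qed (use le psi_0 cont nonneg even in auto)
qed

end

section \<open>Trace class covariance operators\<close>

lemma pos_semidef_bounded_linear: "pos_semidef Q \<Longrightarrow> bounded_linear Q"
  and pos_semidef_sym: "pos_semidef Q \<Longrightarrow> Q x \<bullet> y = Q y \<bullet> x"
  and pos_semidef_nonneg: "pos_semidef Q \<Longrightarrow> 0 \<le> Q x \<bullet> x"
  unfolding pos_semidef_def by (blast, metis inner_commute, blast)

lemma pos_semidef_linear:
  assumes "pos_semidef Q"
  shows "Q (x + y) = Q x + Q y" "Q (x - y) = Q x - Q y" "Q (c *\<^sub>R x) = c *\<^sub>R Q x"
    "Q (\<Sum>i\<in>I. f i) = (\<Sum>i\<in>I. Q (f i))" "Q 0 = 0"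
proof -
  interpret bounded_linear Q using assms by (rule pos_semidef_bounded_linear)
  show "Q (x + y) = Q x + Q y" "Q (x - y) = Q x - Q y" "Q (c *\<^sub>R x) = c *\<^sub>R Q x"
    "Q (\<Sum>i\<in>I. f i) = (\<Sum>i\<in>I. Q (f i))" "Q 0 = 0"
    by (simp_all add: add diff scaleR sum)
qed

lemma pos_semidef_Cauchy_Schwarz:
  assumes "pos_semidef Q"
  shows "(Q x \<bullet> y)\<^sup>2 \<le> (Q x \<bullet> x) * (Q y \<bullet> y)"
proof -
  note lin = pos_semidef_linear[OF assms]
  have quad: "0 \<le> Q x \<bullet> x + 2 * t * (Q x \<bullet> y) + t\<^sup>2 * (Q y \<bullet> y)" for t
    using pos_semidef_nonneg[OF assms, of "x + t *\<^sub>R y"] pos_semidef_sym[OF assms, of y x]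
    by (simp add: lin inner_add_left inner_add_right power2_eq_square algebra_simps)
  show ?thesis
  proof (cases "Q y \<bullet> y = 0")
    case True
    have "Q x \<bullet> y = 0"
    proof (rule ccontr)
      assume "Q x \<bullet> y \<noteq> 0"
      \<comment> \<open>In the degenerate case the polynomial in \<open>t\<close> is affine, and
        this choice of \<open>t\<close> gives it the value -1.\<close>
      then show False
        using quad[of "- (Q x \<bullet> x + 1) / (2 * (Q x \<bullet> y))"] True by (simp add: field_simps)
    qed
    then show ?thesis using True by simp
  next
    case False
    then have pos: "0 < Q y \<bullet> y" using pos_semidef_nonneg[OF assms, of y] by simp
    have "0 \<le> Q x \<bullet> x - (Q x \<bullet> y)\<^sup>2 / (Q y \<bullet> y)"
      using quad[of "- (Q x \<bullet> y) / (Q y \<bullet> y)"] pos by (simp add: field_simps power2_eq_square)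
    then show ?thesis using pos by (simp add: field_simps)
  qed
qed

lemma pos_semidef_eq_0:
  assumes "pos_semidef Q" "Q x \<bullet> x = 0"
  shows "Q x = 0"
  using pos_semidef_Cauchy_Schwarz[OF assms(1), of x "Q x"] assms(2) by simp

text \<open>Cauchy--Schwarz in the form of \<open>E\<close> for the vectors x and E x. It shows that
  a vector on which the form is small is almost in the kernel of \<open>E\<close>.\<close>

lemma pos_semidef_norm_le:
  assumes E: "pos_semidef E" and K: "\<And>x. norm (E x) \<le> K * norm x"
  shows "(norm (E x))\<^sup>2 \<le> K * (E x \<bullet> x)"
proof (cases "E x = 0")
  case False
  have 1: "((norm (E x))\<^sup>2)\<^sup>2 \<le> (E x \<bullet> x) * (E (E x) \<bullet> E x)"
    using pos_semidef_Cauchy_Schwarz[OF E, of x "E x"] by (simp add: power2_norm_eq_inner)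
  have "E (E x) \<bullet> E x \<le> norm (E (E x)) * norm (E x)" by (rule norm_cauchy_schwarz)
  also have "\<dots> \<le> K * norm (E x) * norm (E x)" using K by (intro mult_right_mono) auto
  finally have "E (E x) \<bullet> E x \<le> K * (norm (E x))\<^sup>2" by (simp add: power2_eq_square mult.assoc)
  with 1 have "((norm (E x))\<^sup>2)\<^sup>2 \<le> (E x \<bullet> x) * (K * (norm (E x))\<^sup>2)"
    using mult_left_mono[OF _ pos_semidef_nonneg[OF E, of x]] order_trans by blast
  then have "(norm (E x))\<^sup>2 * (norm (E x))\<^sup>2 \<le> K * (E x \<bullet> x) * (norm (E x))\<^sup>2"
    by (simp add: power2_eq_square mult_ac)
  then show ?thesis by (rule mult_right_le_imp_le) (use False in simp)
qed (use pos_semidef_nonneg[OF E, of x] K[of x] in simp)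

text \<open>With \<open>D = A - Q\<close>, the hypothesis says \<open>\<langle>D x | (A + Q) x\<rangle> = 0\<close>. If the infimum \<open>l\<close> of the
  quadratic form of \<open>D\<close> on the unit sphere were negative, an approximate minimizer \<open>x\<close> would satisfy
  \<open>D x \<approx> l x\<close>, so \<open>l \<langle>x | (A + Q) x\<rangle> \<approx> 0\<close>, contradicting \<open>\<langle>Q x | x\<rangle> \<ge> - \<langle>D x | x\<rangle> \<approx> - l\<close>.\<close>

lemma pos_semidef_mono_of_norm_eq:
  assumes A: "pos_semidef A" and Q: "pos_semidef Q" and eq: "\<And>x. norm (A x) = norm (Q x)"
  shows "Q x \<bullet> x \<le> A x \<bullet> x"
proof (rule ccontr)
  assume neg: "\<not> Q x \<bullet> x \<le> A x \<bullet> x"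
  define D where "D x = A x - Q x" for x
  note linA = pos_semidef_linear[OF A] and linQ = pos_semidef_linear[OF Q]
  have Dsym: "D x \<bullet> y = D y \<bullet> x" for x y
    using pos_semidef_sym[OF A, of x y] pos_semidef_sym[OF Q, of x y] by (simp add: D_def inner_diff_left)
  obtain KA where KA: "\<And>x. norm (A x) \<le> norm x * KA" "0 < KA"
    using bounded_linear.pos_bounded[OF pos_semidef_bounded_linear[OF A]] by auto
  have Dbound: "norm (D x) \<le> 2 * KA * norm x" for x
    using norm_triangle_ineq4[of "A x" "Q x"] KA(1)[of x] eq[of x] by (simp add: D_def algebra_simps)
  define S where "S = (\<lambda>x. D x \<bullet> x) ` sphere 0 1"
  have bdd: "bdd_below S"
  proof (rule bdd_belowI)
    fix s assume "s \<in> S"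
    then obtain x where "norm x = 1" "s = D x \<bullet> x" by (auto simp: S_def)
    then show "- (2 * KA) \<le> s"
      using Cauchy_Schwarz_ineq2[of "D x" x] Dbound[of x] by simp
  qed
  have "x \<noteq> 0" using neg linA(5) linQ(5) by auto
  have quad: "D (c *\<^sub>R y) \<bullet> (c *\<^sub>R y) = c\<^sup>2 * (D y \<bullet> y)" for c y
    by (simp add: D_def linA linQ power2_eq_square algebra_simps)
  have "D x \<bullet> x < 0" using neg by (simp add: D_def inner_diff_left)
  then have neg': "D (inverse (norm x) *\<^sub>R x) \<bullet> (inverse (norm x) *\<^sub>R x) < 0"
    unfolding quad using \<open>x \<noteq> 0\<close> by (intro mult_pos_neg) auto
  have inS: "D (inverse (norm x) *\<^sub>R x) \<bullet> (inverse (norm x) *\<^sub>R x) \<in> S"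
    unfolding S_def using \<open>x \<noteq> 0\<close> by (intro imageI) auto
  define l where "l = Inf S"
  define m where "m = - l"
  have m: "0 < m" using cInf_lower[OF inS bdd] neg' by (simp add: m_def l_def)
  \<comment> \<open>Subtracting the infimum leaves a positive semi-definite operator, so
    \<open>pos_semidef_norm_le\<close> applies to an approximate minimizer.\<close>
  define E where "E x = D x - l *\<^sub>R x" for x
  have E: "pos_semidef E"
    unfolding pos_semidef_def
  proof (intro conjI allI)
    show "bounded_linear E"
      unfolding E_def D_def
      by (intro bounded_linear_sub pos_semidef_bounded_linear A Q bounded_linear_scaleR_right)
    show "E x \<bullet> y = x \<bullet> E y" for x y
      using Dsym[of x y] by (simp add: E_def inner_diff_left inner_diff_right inner_commute)
    show "0 \<le> E y \<bullet> y" for y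
    proof (cases "y = 0")
      case False
      have "D (inverse (norm y) *\<^sub>R y) \<bullet> (inverse (norm y) *\<^sub>R y) \<in> S"
        unfolding S_def using False by (intro imageI) auto
      from cInf_lower[OF this bdd] have "l \<le> D y \<bullet> y / (norm y)\<^sup>2"
        unfolding quad l_def by (simp add: field_simps power_inverse)
      then show ?thesis
        using False by (simp add: E_def inner_diff_left field_simps power2_norm_eq_inner)
    qed simp
  qed
  define K where "K = 2 * KA + m"
  have Kpos: "0 < K" using KA m by (simp add: K_def)
  have Ebound: "norm (E x) \<le> K * norm x" for x
    using norm_triangle_ineq4[of "D x" "l *\<^sub>R x"] Dbound[of x] m
    by (simp add: E_def K_def m_def algebra_simps)
  define C where "C = 2 * KA"
  \<comment> \<open>The first bound keeps z \<bullet> w above m/2. The second keeps |E z| |w| below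
    m^2/2, the resulting lower bound of E z \<bullet> w; the 1 in the denominator keeps it
    positive.\<close>
  define \<delta> where "\<delta> = min (m / 2) (m ^ 4 / (8 * (C\<^sup>2 * K + 1)))"
  have CK: "0 \<le> C\<^sup>2 * K" using Kpos by simp
  have \<delta>: "0 < \<delta>" "\<delta> \<le> m / 2" "C\<^sup>2 * K * \<delta> < m ^ 4 / 4"
  proof -
    show "0 < \<delta>" using m CK by (simp add: \<delta>_def add_nonneg_pos)
    show "\<delta> \<le> m / 2" unfolding \<delta>_def by (rule min.cobounded1)
    have "C\<^sup>2 * K * \<delta> \<le> (C\<^sup>2 * K + 1) * (m ^ 4 / (8 * (C\<^sup>2 * K + 1)))"
      using CK \<open>0 < \<delta>\<close> by (intro mult_mono) (auto simp: \<delta>_def)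
    also have "\<dots> = m ^ 4 / 8" using CK by (simp add: field_simps add_nonneg_eq_0_iff)
    also have "\<dots> < m ^ 4 / 4" using m by simp
    finally show "C\<^sup>2 * K * \<delta> < m ^ 4 / 4" .
  qed
  obtain s where "s \<in> S" "s < l + \<delta>"
    using cInf_lessD[of S "l + \<delta>"] inS \<delta>(1) by (auto simp: l_def)
  then obtain z where z: "norm z = 1" "D z \<bullet> z < l + \<delta>" by (auto simp: S_def)
  have "z \<bullet> z = 1" using z(1) by (simp add: power2_norm_eq_inner[symmetric])
  then have "E z \<bullet> z < \<delta>" using z by (simp add: E_def inner_diff_left)
  then have Ez: "(norm (E z))\<^sup>2 \<le> K * \<delta>"
    using pos_semidef_norm_le[OF E Ebound, of z] Kpos by (smt (verit) mult_left_mono)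
  define w where "w = A z + Q z"
  have nw: "norm w \<le> C"
    using norm_triangle_ineq[of "A z" "Q z"] KA(1)[of z] eq[of z] z(1) by (simp add: w_def C_def)
  \<comment> \<open>This is |A z|^2 - |Q z|^2, the only place where the equality of norms enters as
    an identity.\<close>
  have "D z \<bullet> w = 0"
    using eq[of z] inner_commute[of "A z" "Q z"]
    by (simp add: D_def w_def inner_diff_left inner_add_right norm_eq)
  then have "E z \<bullet> w = m * (z \<bullet> w)" by (simp add: E_def m_def inner_diff_left)
  moreover have "m - \<delta> \<le> z \<bullet> w"
    using z(2) pos_semidef_nonneg[OF A, of z]
    by (simp add: D_def w_def m_def inner_diff_right inner_add_right inner_commute)
  ultimately have "m * (m / 2) \<le> E z \<bullet> w"
    using m \<delta>(2) by (auto intro!: mult_left_mono)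
  also have "\<dots> \<le> norm (E z) * norm w" by (rule norm_cauchy_schwarz)
  finally have "(m * (m / 2))\<^sup>2 \<le> (norm (E z) * norm w)\<^sup>2"
    using m by (intro power_mono) auto
  also have "\<dots> \<le> (K * \<delta>) * C\<^sup>2"
    unfolding power_mult_distrib using Ez nw Kpos \<delta>(1) by (intro mult_mono power_mono) auto
  finally have "m ^ 4 / 4 \<le> C\<^sup>2 * K * \<delta>"
    by (simp add: power2_eq_square power4_eq_xxxx field_simps)
  with \<delta>(3) show False by simp
qed

text \<open>For self-adjoint \<open>Q\<close> the absolute value satisfies A^2 = Q^2, hence |A x| =
  |Q x|. Comparing the forms of \<open>Q\<close> and \<open>A\<close> takes the place of the
  uniqueness of positive square roots.\<close>

lemma trace_class_bounded_sums:
  fixes Q :: "'a::real_inner \<Rightarrow> 'a"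
  assumes Q: "pos_semidef Q" and tc: "trace_class Q"
  obtains B C where "orthonormal_basis B"
    "\<And>F. finite F \<Longrightarrow> F \<subseteq> B \<Longrightarrow> (\<Sum>e\<in>F. Q e \<bullet> e) \<le> C"
proof -
  from tc obtain A B where AB: "is_absolute_value A Q" "orthonormal_basis B" "(\<lambda>e. A e \<bullet> e) summable_on B"
    by (auto simp: trace_class_def)
  have A: "pos_semidef A" and AA: "A \<circ> A = adjoint Q \<circ> Q"
    using AB(1) by (auto simp: is_absolute_value_def)
  have "adjoint Q = Q"
    using Q by (intro adjoint_unique) (auto simp: pos_semidef_def)
  then have "A (A x) = Q (Q x)" for x
    using AA by (metis comp_apply)
  then have "A x \<bullet> A x = Q x \<bullet> Q x" for x
    using pos_semidef_sym[OF A, of "A x" x] pos_semidef_sym[OF Q, of "Q x" x] by (simp add: inner_commute)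
  then have "norm (A x) = norm (Q x)" for x
    by (simp add: norm_eq)
  then have le: "Q x \<bullet> x \<le> A x \<bullet> x" for x
    by (rule pos_semidef_mono_of_norm_eq[OF A Q])
  show ?thesis
  proof (rule that[OF AB(2)])
    fix F assume F: "finite F" "F \<subseteq> B"
    have "(\<Sum>e\<in>F. Q e \<bullet> e) \<le> (\<Sum>e\<in>F. A e \<bullet> e)"
      by (intro sum_mono le)
    also have "\<dots> \<le> (\<Sum>\<^sub>\<infinity>e\<in>B. A e \<bullet> e)"
      using F AB(3) pos_semidef_nonneg[OF A] by (intro finite_sum_le_infsum) auto
    finally show "(\<Sum>e\<in>F. Q e \<bullet> e) \<le> (\<Sum>\<^sub>\<infinity>e\<in>B. A e \<bullet> e)" .
  qed
qed

text \<open>A finite form of Parseval's identity, obtained from a vector of the span within sqrt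
  \<epsilon> of \<open>v\<close>.\<close>

lemma orthonormal_basis_approx:
  fixes v :: "'a::real_inner"
  assumes B: "orthonormal_basis B" and "0 < \<epsilon>"
  obtains F where "finite F" "F \<subseteq> B" "(norm v)\<^sup>2 \<le> (\<Sum>e\<in>F. (v \<bullet> e)\<^sup>2) + \<epsilon>"
proof -
  have "v \<in> closure (span B)" using B by (simp add: orthonormal_basis_def)
  then obtain y where y: "y \<in> span B" "dist y v < sqrt \<epsilon>"
    using \<open>0 < \<epsilon>\<close> by (meson closure_approachable real_sqrt_gt_zero)
  then obtain F r where F: "finite F" "F \<subseteq> B" "y = (\<Sum>e\<in>F. r e *\<^sub>R e)"
    by (auto simp: span_explicit)
  have on: "e \<bullet> f = (if e = f then 1 else 0)" if "e \<in> F" "f \<in> F" for e f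
    using B F(2) that by (auto simp: orthonormal_basis_def pairwise_def orthogonal_def norm_eq_1 subset_iff)
  have ye: "y \<bullet> e = r e" if "e \<in> F" for e
  proof -
    have "y \<bullet> e = (\<Sum>f\<in>F. r f * (f \<bullet> e))"
      by (simp add: F(3) inner_sum_left)
    also have "\<dots> = (\<Sum>f\<in>{e}. r f * (f \<bullet> e))"
      using that F(1) on by (intro sum.mono_neutral_right) auto
    finally show ?thesis using on[OF that that] by simp
  qed
  have "y \<bullet> y = y \<bullet> (\<Sum>e\<in>F. r e *\<^sub>R e)"
    by (simp only: F(3)[symmetric])
  also have "\<dots> = (\<Sum>e\<in>F. r e * (y \<bullet> e))"
    by (simp add: inner_sum_right)
  also have "\<dots> = (\<Sum>e\<in>F. (r e)\<^sup>2)"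
    by (intro sum.cong refl) (simp add: ye power2_eq_square)
  finally have yy: "y \<bullet> y = (\<Sum>e\<in>F. (r e)\<^sup>2)" .
  have vy: "v \<bullet> y = (\<Sum>e\<in>F. r e * (v \<bullet> e))"
    unfolding F(3) by (simp add: inner_sum_right)
  \<comment> \<open>Completing the square: replacing the coefficients of \<open>y\<close> by those
    of \<open>v\<close> only decreases the distance.\<close>
  have "(norm (y - v))\<^sup>2 = y \<bullet> y - 2 * (v \<bullet> y) + (norm v)\<^sup>2"
    unfolding power2_norm_eq_inner by (simp add: inner_diff_left inner_diff_right inner_commute)
  also have "\<dots> = (\<Sum>e\<in>F. (r e)\<^sup>2) - 2 * (\<Sum>e\<in>F. r e * (v \<bullet> e)) + (norm v)\<^sup>2"
    by (simp only: yy vy)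
  also have "\<dots> = (\<Sum>e\<in>F. (r e - v \<bullet> e)\<^sup>2) - (\<Sum>e\<in>F. (v \<bullet> e)\<^sup>2) + (norm v)\<^sup>2"
    by (simp add: power2_diff sum.distrib sum_subtractf sum_distrib_left mult.assoc)
  finally have "(norm v)\<^sup>2 - (\<Sum>e\<in>F. (v \<bullet> e)\<^sup>2) \<le> (norm (y - v))\<^sup>2"
    using sum_nonneg[of F "\<lambda>e. (r e - v \<bullet> e)\<^sup>2"] by simp
  also have "\<dots> \<le> (sqrt \<epsilon>)\<^sup>2"
    using y(2) by (intro power_mono) (auto simp: dist_norm)
  finally show ?thesis
    using F \<open>0 < \<epsilon>\<close> by (intro that[of F]) auto
qed

section \<open>Gram--Schmidt for the semi-inner product given by Q\<close>

fun gram_schmidt :: "('a::real_inner \<Rightarrow> 'a) \<Rightarrow> (nat \<Rightarrow> 'a) \<Rightarrow> nat \<Rightarrow> 'a" where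
  "gram_schmidt Q d n =
    (let w = d n - (\<Sum>k<n. (Q (d n) \<bullet> gram_schmidt Q d k) *\<^sub>R gram_schmidt Q d k)
     in w /\<^sub>R sqrt (Q w \<bullet> w))"

declare gram_schmidt.simps [simp del]

context
  fixes Q :: "'a::real_inner \<Rightarrow> 'a" and d :: "nat \<Rightarrow> 'a"
  assumes Q: "pos_semidef Q"
begin

private definition "g = gram_schmidt Q d"
private definition "w n = d n - (\<Sum>k<n. (Q (d n) \<bullet> g k) *\<^sub>R g k)"

private lemmas lin = pos_semidef_linear[OF Q]
private lemmas sym = pos_semidef_sym[OF Q]

private lemma g_w: "g n = w n /\<^sub>R sqrt (Q (w n) \<bullet> w n)"
  by (simp add: g_def w_def gram_schmidt.simps[of Q d n] Let_def)

text \<open>The value 0 comes from \<open>inverse 0 = 0\<close>: a remainder \<open>w n\<close> of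
  seminorm 0 produces the zero vector. Thus linear dependence of \<open>d\<close> and a kernel of
  \<open>Q\<close> are both allowed.\<close>

private lemma g_norm: "Q (g n) \<bullet> g n = (if Q (w n) \<bullet> w n = 0 then 0 else 1)"
proof -
  define q where "q = Q (w n) \<bullet> w n"
  have q: "0 \<le> q" unfolding q_def by (rule pos_semidef_nonneg[OF Q])
  have "Q (g n) \<bullet> g n = q / (sqrt q * sqrt q)"
    by (simp only: g_w lin inner_scaleR_left inner_scaleR_right q_def[symmetric] divide_inverse
        inverse_mult_distrib mult_ac)
  also have "sqrt q * sqrt q = q" using q by simp
  finally show ?thesis by (simp add: q_def)
qed

private lemma g_norm_cases: "Q (g n) \<bullet> g n = 0 \<and> Q (g n) = 0 \<or> Q (g n) \<bullet> g n = 1"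
  using g_norm[of n] pos_semidef_eq_0[OF Q, of "g n"] by auto

private lemma g_orth_less: "j < n \<Longrightarrow> Q (g j) \<bullet> g n = 0"
proof (induction n arbitrary: j rule: less_induct)
  case (less n)
  have orth: "Q (g j) \<bullet> g k = 0" if "k < n" "k \<noteq> j" for k
    using less that sym[of "g j" "g k"] by (cases "k < j") auto
  have "Q (g j) \<bullet> w n = Q (g j) \<bullet> d n - (\<Sum>k<n. (Q (d n) \<bullet> g k) * (Q (g j) \<bullet> g k))"
    by (simp add: w_def inner_diff_right inner_sum_right)
  also have "(\<Sum>k<n. (Q (d n) \<bullet> g k) * (Q (g j) \<bullet> g k)) =
      (\<Sum>k\<in>{j}. (Q (d n) \<bullet> g k) * (Q (g j) \<bullet> g k))"
    using less.prems orth by (intro sum.mono_neutral_right) auto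
  \<comment> \<open>If \<open>g j\<close> has seminorm 0, then \<open>Q (g j) = 0\<close> and both
    terms vanish; otherwise it is normalized and they cancel.\<close>
  also have "Q (g j) \<bullet> d n - \<dots> = 0"
    using g_norm_cases[of j] sym[of "d n" "g j"] by auto
  finally show ?case by (simp add: g_w)
qed

private lemma g_orth: "j \<noteq> n \<Longrightarrow> Q (g j) \<bullet> g n = 0"
  using g_orth_less[of j n] g_orth_less[of n j] sym[of "g j" "g n"] by (cases "j < n") auto

private lemma Q_sum: "Q (\<Sum>k<N. a k *\<^sub>R g k) \<bullet> (\<Sum>k<N. a k *\<^sub>R g k) = (\<Sum>k<N. (a k)\<^sup>2 * (Q (g k) \<bullet> g k))"
proof -
  have "Q (\<Sum>k<N. a k *\<^sub>R g k) \<bullet> (\<Sum>k<N. a k *\<^sub>R g k) = (\<Sum>j<N. \<Sum>k<N. a j * a k * (Q (g j) \<bullet> g k))"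
    by (simp add: lin inner_sum_left inner_sum_right sum_distrib_left mult_ac sym)
  also have "\<dots> = (\<Sum>j<N. \<Sum>k\<in>{j}. a j * a k * (Q (g j) \<bullet> g k))"
    by (intro sum.cong[OF refl] sum.mono_neutral_right) (auto simp: g_orth)
  finally show ?thesis by (simp add: power2_eq_square)
qed

text \<open>The last sum has nonnegative terms, which vanish for the coefficients a k = Q u
  \<bullet> g k. This gives Bessel's inequality and the best approximation property.\<close>

private lemma Q_minus_sum:
  "Q (u - (\<Sum>k<N. a k *\<^sub>R g k)) \<bullet> (u - (\<Sum>k<N. a k *\<^sub>R g k)) =
     Q u \<bullet> u - (\<Sum>k<N. (Q u \<bullet> g k)\<^sup>2) +
     (\<Sum>k<N. (Q u \<bullet> g k)\<^sup>2 - 2 * a k * (Q u \<bullet> g k) + (a k)\<^sup>2 * (Q (g k) \<bullet> g k))"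
proof -
  define S where "S = (\<Sum>k<N. a k *\<^sub>R g k)"
  have "Q u \<bullet> S = (\<Sum>k<N. a k * (Q u \<bullet> g k))"
    by (simp add: S_def inner_sum_right)
  then have "Q (u - S) \<bullet> (u - S) =
      Q u \<bullet> u - 2 * (\<Sum>k<N. a k * (Q u \<bullet> g k)) + (\<Sum>k<N. (a k)\<^sup>2 * (Q (g k) \<bullet> g k))"
    using sym[of S u] Q_sum[of a N] by (simp add: lin inner_diff_left inner_diff_right S_def)
  then show ?thesis
    by (simp add: S_def sum.distrib sum_subtractf sum_distrib_left mult.assoc)
qed

private lemma square_nonneg: "0 \<le> (Q u \<bullet> g k)\<^sup>2 - 2 * a * (Q u \<bullet> g k) + a\<^sup>2 * (Q (g k) \<bullet> g k)"
proof -
  consider "Q (g k) = 0" | "Q (g k) \<bullet> g k = 1" using g_norm_cases[of k] by auto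
  then show ?thesis
  proof cases
    case 1
    then show ?thesis using sym[of u "g k"] by simp
  next
    case 2
    then show ?thesis
      using zero_le_power2[of "Q u \<bullet> g k - a"] by (simp add: power2_diff algebra_simps)
  qed
qed

private lemma remainder_eq: "Q u \<bullet> u - (\<Sum>k<N. (Q u \<bullet> g k)\<^sup>2) =
    Q (u - (\<Sum>k<N. (Q u \<bullet> g k) *\<^sub>R g k)) \<bullet> (u - (\<Sum>k<N. (Q u \<bullet> g k) *\<^sub>R g k))"
proof -
  have "(Q u \<bullet> g k)\<^sup>2 - 2 * (Q u \<bullet> g k) * (Q u \<bullet> g k) + (Q u \<bullet> g k)\<^sup>2 * (Q (g k) \<bullet> g k) = 0" for k
    using g_norm_cases[of k] sym[of u "g k"] by (auto simp: power2_eq_square)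
  then show ?thesis unfolding Q_minus_sum by simp
qed

private lemma remainder_le: "Q u \<bullet> u - (\<Sum>k<N. (Q u \<bullet> g k)\<^sup>2) \<le>
    Q (u - (\<Sum>k<N. a k *\<^sub>R g k)) \<bullet> (u - (\<Sum>k<N. a k *\<^sub>R g k))"
  unfolding Q_minus_sum using sum_nonneg[of "{..<N}", OF square_nonneg] by simp

private lemma bessel: "(\<Sum>k<N. (Q u \<bullet> g k)\<^sup>2) \<le> Q u \<bullet> u"
  using remainder_eq[of u N] pos_semidef_nonneg[OF Q, of "u - (\<Sum>k<N. (Q u \<bullet> g k) *\<^sub>R g k)"] by linarith

text \<open>Modulo the kernel of \<open>Q\<close>, the vector \<open>d n\<close> lies in the span of
  the first n + 1 vectors \<open>g k\<close>; a remainder that was dropped has seminorm 0 and is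
  annihilated by \<open>Q\<close>.\<close>

private lemma Q_d: "Q (d n) = Q (\<Sum>k<Suc n. (Q (d n) \<bullet> g k) *\<^sub>R g k)"
proof -
  define c where "c k = Q (d n) \<bullet> g k" for k
  define S where "S = (\<Sum>k<n. c k *\<^sub>R g k)"
  have w: "w n = d n - S" by (simp only: w_def S_def c_def)
  have Qw: "Q (w n) = Q (c n *\<^sub>R g n)"
  proof (cases "Q (w n) \<bullet> w n = 0")
    case True
    then have "Q (w n) = 0" by (rule pos_semidef_eq_0[OF Q])
    moreover have "g n = 0" using True by (simp add: g_w)
    ultimately show ?thesis by (simp add: lin)
  next
    case False
    then have pos: "0 < Q (w n) \<bullet> w n" using pos_semidef_nonneg[OF Q, of "w n"] by simp
    have "Q S \<bullet> g n = 0"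
      by (simp add: S_def lin inner_sum_left g_orth)
    then have "c n = Q (w n) \<bullet> g n"
      by (simp add: c_def w lin inner_diff_left)
    also have "\<dots> = sqrt (Q (w n) \<bullet> w n)"
      using pos real_div_sqrt[of "Q (w n) \<bullet> w n"] by (simp add: g_w field_simps)
    finally have "c n *\<^sub>R g n = w n"
      using pos by (simp add: g_w)
    then show ?thesis by simp
  qed
  have "Q (d n) = Q (w n) + Q S"
    by (simp add: w lin)
  also have "\<dots> = Q (\<Sum>k<Suc n. c k *\<^sub>R g k)"
    unfolding Qw by (simp add: S_def lin)
  finally show ?thesis unfolding c_def .
qed

private lemma inner_Q_g: "u \<bullet> Q (gram_schmidt Q d k) = Q u \<bullet> g k"
  unfolding g_def[symmetric] by (rule trans[OF inner_commute sym])

lemma gram_schmidt_Bessel: "(\<Sum>k<N. (u \<bullet> Q (gram_schmidt Q d k))\<^sup>2) \<le> Q u \<bullet> u"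
  using bessel[of u N] by (simp only: inner_Q_g[symmetric])

text \<open>Some \<open>d n\<close> is close to \<open>u\<close> in the seminorm of
  \<open>Q\<close>, and by best approximation the remainder of \<open>u\<close> is no larger than
  this distance.\<close>

lemma gram_schmidt_Parseval:
  assumes dense: "\<And>X. open X \<Longrightarrow> X \<noteq> {} \<Longrightarrow> \<exists>n. d n \<in> X"
  shows "(\<lambda>k. (u \<bullet> Q (gram_schmidt Q d k))\<^sup>2) sums (Q u \<bullet> u)"
proof -
  interpret bounded_linear Q by (rule pos_semidef_bounded_linear[OF Q])
  have "(\<lambda>N. \<Sum>k<N. (Q u \<bullet> g k)\<^sup>2) \<longlonglongrightarrow> Q u \<bullet> u"
  proof (rule LIMSEQ_I)
    fix \<epsilon> :: real assume "0 < \<epsilon>"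
    have "open {x. Q (u - x) \<bullet> (u - x) < \<epsilon>}"
      by (intro open_Collect_less continuous_intros continuous_on)
    moreover have "u \<in> {x. Q (u - x) \<bullet> (u - x) < \<epsilon>}" using \<open>0 < \<epsilon>\<close> by simp
    ultimately obtain n where n: "Q (u - d n) \<bullet> (u - d n) < \<epsilon>"
      using dense[of "{x. Q (u - x) \<bullet> (u - x) < \<epsilon>}"] by blast
    define S where "S = (\<Sum>k<Suc n. (Q (d n) \<bullet> g k) *\<^sub>R g k)"
    have QS: "Q S = Q (d n)" unfolding S_def by (rule Q_d[symmetric])
    have Qu: "Q (u - S) = Q (u - d n)" by (simp only: lin QS)
    \<comment> \<open>\<open>S\<close> and \<open>d n\<close> agree only after applying
      \<open>Q\<close>, so the symmetry of \<open>Q\<close> is needed to exchange them in the second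
      argument.\<close>
    have "Q (u - S) \<bullet> (u - S) = Q (u - S) \<bullet> (u - d n)"
      unfolding Qu by (subst sym) (simp only: Qu)
    then have "Q (u - S) \<bullet> (u - S) = Q (u - d n) \<bullet> (u - d n)"
      unfolding Qu .
    then have rem: "Q u \<bullet> u - (\<Sum>k<Suc n. (Q u \<bullet> g k)\<^sup>2) < \<epsilon>"
      using remainder_le[of u "Suc n" "\<lambda>k. Q (d n) \<bullet> g k"] n by (simp only: S_def[symmetric])
    have mono: "(\<Sum>k<Suc n. (Q u \<bullet> g k)\<^sup>2) \<le> (\<Sum>k<N. (Q u \<bullet> g k)\<^sup>2)" if "Suc n \<le> N" for N
      using that by (intro sum_mono2) auto
    show "\<exists>no. \<forall>N\<ge>no. norm ((\<Sum>k<N. (Q u \<bullet> g k)\<^sup>2) - Q u \<bullet> u) < \<epsilon>"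
    proof (intro exI[of _ "Suc n"] allI impI)
      fix N assume "Suc n \<le> N"
      from mono[OF this] rem bessel[of u N] show "norm ((\<Sum>k<N. (Q u \<bullet> g k)\<^sup>2) - Q u \<bullet> u) < \<epsilon>"
        unfolding real_norm_def by linarith
    qed
  qed
  then show ?thesis unfolding sums_def by (simp only: inner_Q_g[symmetric])
qed

end

text \<open>For the covariance operator \<open>Q\<close> this is a factorization \<open>Q = T T*\<close> with the Hilbert--Schmidt
  operator \<open>T\<close> that maps the unit vectors to \<open>v k\<close>. Applying Gram--Schmidt to the semi-inner product
  \<open>\<langle>Q x | y\<rangle>\<close> avoids the spectral theorem.\<close>

lemma covariance_factorization:
  fixes Q :: "'a::{real_inner, second_countable_topology} \<Rightarrow> 'a"
  assumes Q: "pos_semidef Q" and tc: "trace_class Q"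
  obtains v :: "nat \<Rightarrow> 'a" and C where "\<And>u. (\<lambda>k. (u \<bullet> v k)\<^sup>2) sums (Q u \<bullet> u)"
    "\<And>N. (\<Sum>k<N. (norm (v k))\<^sup>2) \<le> C"
proof -
  obtain D :: "'a set" where D: "countable D" "\<And>X. open X \<Longrightarrow> X \<noteq> {} \<Longrightarrow> \<exists>d\<in>D. d \<in> X"
    using countable_dense_setE by blast
  have "D \<noteq> {}" using D(2)[of UNIV] by auto
  define d where "d = from_nat_into D"
  have d: "\<exists>n. d n \<in> X" if "open X" "X \<noteq> {}" for X
  proof -
    obtain x where "x \<in> D" "x \<in> X" using D(2)[OF \<open>open X\<close> \<open>X \<noteq> {}\<close>] by blast
    then have "x \<in> range d" using range_from_nat_into[OF \<open>D \<noteq> {}\<close> D(1)] by (simp add: d_def)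
    then show ?thesis using \<open>x \<in> X\<close> by auto
  qed
  obtain B C where B: "orthonormal_basis B"
    and C: "\<And>F. finite F \<Longrightarrow> F \<subseteq> B \<Longrightarrow> (\<Sum>e\<in>F. Q e \<bullet> e) \<le> C"
    using trace_class_bounded_sums[OF Q tc] by blast
  define v where "v k = Q (gram_schmidt Q d k)" for k
  show ?thesis
  proof (rule that)
    show "(\<lambda>k. (u \<bullet> v k)\<^sup>2) sums (Q u \<bullet> u)" for u
      unfolding v_def by (rule gram_schmidt_Parseval[OF Q d])
    fix N
    show "(\<Sum>k<N. (norm (v k))\<^sup>2) \<le> C + 1"
    proof -
      \<comment> \<open>N errors of this size add up to at most 1. Apart from them, Bessel's
        inequality bounds the sum for each basis vector \<open>e\<close> by Q e \<bullet> e, and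
        hence the total by the trace bound.\<close>
      define \<epsilon> where "\<epsilon> = 1 / (real N + 1)"
      have "0 < \<epsilon>" by (simp add: \<epsilon>_def add_nonneg_pos)
      have "\<exists>F. finite F \<and> F \<subseteq> B \<and> (norm (v k))\<^sup>2 \<le> (\<Sum>e\<in>F. (v k \<bullet> e)\<^sup>2) + \<epsilon>" for k
        by (rule orthonormal_basis_approx[OF B \<open>0 < \<epsilon>\<close>, of "v k"]) blast
      then obtain F where F: "\<And>k. finite (F k)" "\<And>k. F k \<subseteq> B"
        "\<And>k. (norm (v k))\<^sup>2 \<le> (\<Sum>e\<in>F k. (v k \<bullet> e)\<^sup>2) + \<epsilon>" by metis
      define G where "G = (\<Union>k<N. F k)"
      have G: "finite G" "G \<subseteq> B" using F by (auto simp: G_def)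
      have "(\<Sum>k<N. (norm (v k))\<^sup>2) \<le> (\<Sum>k<N. (\<Sum>e\<in>G. (v k \<bullet> e)\<^sup>2) + \<epsilon>)"
      proof (rule sum_mono)
        fix k assume k: "k \<in> {..<N}"
        have "(\<Sum>e\<in>F k. (v k \<bullet> e)\<^sup>2) \<le> (\<Sum>e\<in>G. (v k \<bullet> e)\<^sup>2)"
          using G k by (intro sum_mono2) (auto simp: G_def)
        then show "(norm (v k))\<^sup>2 \<le> (\<Sum>e\<in>G. (v k \<bullet> e)\<^sup>2) + \<epsilon>" using F(3)[of k] by simp
      qed
      also have "\<dots> = (\<Sum>e\<in>G. \<Sum>k<N. (e \<bullet> v k)\<^sup>2) + real N * \<epsilon>"
      proof -
        have "(\<Sum>k<N. \<Sum>e\<in>G. (v k \<bullet> e)\<^sup>2) = (\<Sum>e\<in>G. \<Sum>k<N. (e \<bullet> v k)\<^sup>2)"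
          by (subst sum.swap) (simp only: inner_commute)
        then show ?thesis by (simp only: sum.distrib) simp
      qed
      also have "\<dots> \<le> (\<Sum>e\<in>G. Q e \<bullet> e) + 1"
        unfolding v_def by (intro add_mono sum_mono gram_schmidt_Bessel[OF Q]) (simp add: \<epsilon>_def)
      also have "\<dots> \<le> C + 1" using C[OF G] by simp
      finally show ?thesis .
    qed
  qed
qed

section \<open>Gaussian measures\<close>

lemma prob_space_std_normal: "prob_space std_normal_distribution"
  using real_dist_normal_dist by (simp add: real_distribution_def)

text \<open>Tail variances of order 4^(- k) give increments of order 2^(- k) in mean, which are
  summable. The partial sums of N i + 1 increase strictly and dominate every
  \<open>N k\<close>.\<close>

lemma subseq_summable_tails:
  fixes a :: "nat \<Rightarrow> real"
  assumes "summable a"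
  obtains r :: "nat \<Rightarrow> nat" where "strict_mono r" "\<And>k. (\<Sum>j=r k..<r (Suc k). a j) \<le> (1/4) ^ k"
proof -
  have "\<exists>N. \<forall>m\<ge>N. \<forall>n. norm (\<Sum>j=m..<n. a j) < (1/4) ^ k" for k
    using assms unfolding summable_Cauchy by simp
  then obtain N where N: "\<And>k m n. N k \<le> m \<Longrightarrow> norm (\<Sum>j=m..<n. a j) < (1/4) ^ k"
    by metis
  define r where "r k = (\<Sum>i\<le>k. Suc (N i))" for k
  have "strict_mono r" by (rule strict_monoI_Suc) (simp add: r_def)
  moreover have "N k \<le> r k" for k
    by (cases k) (simp_all add: r_def)
  then have "(\<Sum>j=r k..<r (Suc k). a j) \<le> (1/4) ^ k" for k
    using N[of k "r k" "r (Suc k)"] by (simp add: abs_less_iff less_imp_le)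
  ultimately show ?thesis using that by blast
qed

locale gaussian_series =
  fixes v :: "nat \<Rightarrow> 'a::{real_inner, banach, polish_space}" and q :: "'a \<Rightarrow> real" and C :: real
  assumes sums_q: "\<And>u. (\<lambda>k. (u \<bullet> v k)\<^sup>2) sums q u"
    and bound: "\<And>N. (\<Sum>k<N. (norm (v k))\<^sup>2) \<le> C"
begin

definition \<Omega> :: "(nat \<Rightarrow> real) measure" where
  "\<Omega> = Pi\<^sub>M UNIV (\<lambda>_. std_normal_distribution)"

sublocale product_prob_space "\<lambda>_::nat. std_normal_distribution" UNIV
  by (rule product_prob_spaceI) (rule prob_space_std_normal)

sublocale W: prob_space \<Omega>
  unfolding \<Omega>_def by (rule prob_space_PiM) (rule prob_space_std_normal)

lemma sets_Omega: "sets \<Omega> = sets (Pi\<^sub>M UNIV (\<lambda>_. borel))"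
  unfolding \<Omega>_def by (rule sets_PiM_cong) auto

lemma measurable_coord [measurable]: "(\<lambda>w. w k) \<in> borel_measurable \<Omega>"
  unfolding measurable_cong_sets[OF sets_Omega refl] by simp

lemma distr_coord: "distr \<Omega> borel (\<lambda>w. w k) = std_normal_distribution"
  using PiM_component[of k] unfolding \<Omega>_def by (simp cong: distr_cong)

lemma integral_coord:
  fixes f :: "real \<Rightarrow> 'b::{banach, second_countable_topology}"
  assumes "f \<in> borel_measurable borel"
  shows "(\<integral>w. f (w k) \<partial>\<Omega>) = (\<integral>x. f x \<partial>std_normal_distribution)"
  using integral_distr[OF measurable_coord assms] distr_coord by simp

lemma indep_coord: "W.indep_vars (\<lambda>_. borel) (\<lambda>k w. w k) UNIV"
proof (subst W.indep_vars_iff_distr_eq_PiM)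
  have "distr \<Omega> (Pi\<^sub>M UNIV (\<lambda>_. borel)) (\<lambda>w. \<lambda>i\<in>UNIV. w i) = distr \<Omega> \<Omega> (\<lambda>w. w)"
    by (intro distr_cong sets_Omega[symmetric]) (auto simp: restrict_def)
  also have "\<dots> = Pi\<^sub>M UNIV (\<lambda>i. distr \<Omega> borel (\<lambda>w. w i))"
    by (simp add: distr_coord[unfolded \<Omega>_def] \<Omega>_def)
  finally show "distr \<Omega> (Pi\<^sub>M UNIV (\<lambda>_. borel)) (\<lambda>w. \<lambda>i\<in>UNIV. w i) =
      Pi\<^sub>M UNIV (\<lambda>i. distr \<Omega> borel (\<lambda>w. w i))" .
qed simp_all

lemma moments_coord:
  "integrable \<Omega> (\<lambda>w. w i * w j)" "(\<integral>w. w i * w j \<partial>\<Omega>) = (if i = j then 1 else 0)"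
proof -
  have int: "integrable \<Omega> (\<lambda>w. w k ^ n)" for k n
  proof -
    have "integrable (distr \<Omega> borel (\<lambda>w. w k)) (\<lambda>x. x ^ n)"
      unfolding distr_coord by (rule integrable_std_normal_distribution_moment)
    then show ?thesis by (simp add: integrable_distr_eq)
  qed
  have mean: "(\<integral>w. w k \<partial>\<Omega>) = 0" for k
    using integral_coord[of "\<lambda>x. x ^ 1" k] integral_std_normal_distribution_moment_odd[of 1] by simp
  have var: "(\<integral>w. w k * w k \<partial>\<Omega>) = 1" for k
    using integral_coord[of "\<lambda>x. x ^ 2" k] std_normal_distribution_even_moments(1)[of 1]
    by (simp add: power2_eq_square)
  have ind: "W.indep_var borel (\<lambda>w. w i) borel (\<lambda>w. w j)" if "i \<noteq> j"
    using W.indep_var_compose[OF W.indep_var_restrict[OF indep_coord, of "{i}" "{j}"],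
        of "\<lambda>f. f i" borel "\<lambda>f. f j" borel] that by (simp add: o_def)
  show "integrable \<Omega> (\<lambda>w. w i * w j)"
    using int[of i 2] ind int[of i 1] int[of j 1] W.indep_var_integrable[of "\<lambda>w. w i" "\<lambda>w. w j"]
    by (cases "i = j") (auto simp: power2_eq_square)
  show "(\<integral>w. w i * w j \<partial>\<Omega>) = (if i = j then 1 else 0)"
    using var[of i] ind int[of i 1] int[of j 1] mean
      W.indep_var_lebesgue_integral[of "\<lambda>w. w i" "\<lambda>w. w j"]
    by (cases "i = j") auto
qed

lemma second_moment:
  assumes "finite F"
  shows "integrable \<Omega> (\<lambda>w. (norm (\<Sum>k\<in>F. w k *\<^sub>R v k))\<^sup>2)"
    "(\<integral>w. (norm (\<Sum>k\<in>F. w k *\<^sub>R v k))\<^sup>2 \<partial>\<Omega>) = (\<Sum>k\<in>F. (norm (v k))\<^sup>2)"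
proof -
  have eq: "(norm (\<Sum>k\<in>F. w k *\<^sub>R v k))\<^sup>2 = (\<Sum>i\<in>F. \<Sum>j\<in>F. w i * w j * (v i \<bullet> v j))" for w :: "nat \<Rightarrow> real"
    unfolding power2_norm_eq_inner inner_sum_left inner_sum_right
    by (intro sum.cong refl) (simp add: inner_commute)
  show "integrable \<Omega> (\<lambda>w. (norm (\<Sum>k\<in>F. w k *\<^sub>R v k))\<^sup>2)"
    unfolding eq by (intro Bochner_Integration.integrable_sum integrable_mult_left moments_coord)
  have "(\<integral>w. (norm (\<Sum>k\<in>F. w k *\<^sub>R v k))\<^sup>2 \<partial>\<Omega>) = (\<Sum>i\<in>F. \<Sum>j\<in>F. (if i = j then 1 else 0) * (v i \<bullet> v j))"
    unfolding eq
    by (subst Bochner_Integration.integral_sum, intro Bochner_Integration.integrable_sum integrable_mult_left moments_coord,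
        intro sum.cong refl, subst Bochner_Integration.integral_sum, intro integrable_mult_left moments_coord)
       (simp add: moments_coord)
  also have "\<dots> = (\<Sum>i\<in>F. v i \<bullet> v i)"
    using assms by (intro sum.cong refl) (simp add: if_distrib[of "\<lambda>x. x * _"] cong: if_cong)
  finally show "(\<integral>w. (norm (\<Sum>k\<in>F. w k *\<^sub>R v k))\<^sup>2 \<partial>\<Omega>) = (\<Sum>k\<in>F. (norm (v k))\<^sup>2)"
    by (simp add: power2_norm_eq_inner)
qed

definition S :: "nat \<Rightarrow> (nat \<Rightarrow> real) \<Rightarrow> 'a" where
  "S n w = (\<Sum>k<n. w k *\<^sub>R v k)"

lemma measurable_S [measurable]: "S n \<in> borel_measurable \<Omega>"
  unfolding S_def[abs_def] by measurable

lemma char_S: "(\<integral>w. iexp (u \<bullet> S n w) \<partial>\<Omega>) = complex_of_real (exp (- (\<Sum>k<n. (u \<bullet> v k)\<^sup>2) / 2))"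
proof -
  have "(\<integral>w. iexp (u \<bullet> S n w) \<partial>\<Omega>) = (\<integral>w. (\<Prod>k<n. iexp (u \<bullet> v k * w k)) \<partial>\<Omega>)"
    by (simp add: S_def inner_sum_right exp_sum[symmetric] sum_distrib_left mult_ac)
  also have "\<dots> = (\<Prod>k<n. \<integral>w. iexp (u \<bullet> v k * w k) \<partial>\<Omega>)"
  proof (rule W.indep_vars_lebesgue_integral)
    show "W.indep_vars (\<lambda>_. borel) (\<lambda>k w. iexp (u \<bullet> v k * w k)) {..<n}"
      by (rule W.indep_vars_compose2[OF W.indep_vars_subset[OF indep_coord]]) auto
    show "integrable \<Omega> (\<lambda>w. iexp (u \<bullet> v k * w k))" for k
      by (intro W.integrable_const_bound[of _ 1]) auto
  qed simp
  also have "\<dots> = (\<Prod>k<n. complex_of_real (exp (- ((u \<bullet> v k)\<^sup>2) / 2)))"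
  proof (intro prod.cong refl)
    fix k
    have "(\<integral>w. iexp (u \<bullet> v k * w k) \<partial>\<Omega>) = char std_normal_distribution (u \<bullet> v k)"
      unfolding char_def by (rule integral_coord) measurable
    then show "(\<integral>w. iexp (u \<bullet> v k * w k) \<partial>\<Omega>) = complex_of_real (exp (- ((u \<bullet> v k)\<^sup>2) / 2))"
      by (simp only: char_std_normal_distribution)
  qed
  also have "\<dots> = complex_of_real (exp (- (\<Sum>k<n. (u \<bullet> v k)\<^sup>2) / 2))"
    by (simp only: of_real_prod[symmetric] exp_sum[OF finite_lessThan, symmetric] sum_negf[symmetric] sum_divide_distrib)
  finally show ?thesis .
qed

text \<open>The partial sums converge in \<open>L\<^sup>2\<close>; along a fast subsequence they converge almost surely.\<close>

lemma AE_convergent_subseq: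
  obtains r where "strict_mono r" "AE w in \<Omega>. convergent (\<lambda>k. S (r k) w)"
proof -
  have "summable (\<lambda>k. (norm (v k))\<^sup>2)"
    using bound by (intro summableI_nonneg_bounded[of _ C]) auto
  then obtain r where r: "strict_mono r" "\<And>k. (\<Sum>j=r k..<r (Suc k). (norm (v j))\<^sup>2) \<le> (1/4) ^ k"
    using subseq_summable_tails by blast
  define D where "D k w = S (r (Suc k)) w - S (r k) w" for k w
  have D_eq: "D k w = (\<Sum>j=r k..<r (Suc k). w j *\<^sub>R v j)" for k w
    using sum_diff_nat_ivl[of 0 "r k" "r (Suc k)" "\<lambda>j. w j *\<^sub>R v j"] strict_mono_less_eq[OF r(1), of k "Suc k"]
    by (simp add: D_def S_def atLeast0LessThan)
  have [measurable]: "D k \<in> borel_measurable \<Omega>" for k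
    unfolding D_def[abs_def] by measurable
  have D_int: "(\<integral>\<^sup>+w. ennreal (norm (D k w)) \<partial>\<Omega>) \<le> ennreal ((1/2) ^ k)" for k
  proof -
    have int: "integrable \<Omega> (\<lambda>w. (norm (D k w))\<^sup>2)"
      unfolding D_eq by (rule second_moment) simp
    have "(\<integral>\<^sup>+w. ennreal (norm (D k w)) \<partial>\<Omega>) \<le> (\<integral>\<^sup>+w. ennreal ((1/2) ^ k / 2 + 2 ^ k / 2 * (norm (D k w))\<^sup>2) \<partial>\<Omega>)"
    proof (intro nn_integral_mono ennreal_leI)
      fix w
      \<comment> \<open>The inequality x \<le> a/2 + x^2/(2 a) with a = 2^(- k); each half then
        integrates to at most a/2.\<close>
      have "0 \<le> 2 ^ k * (norm (D k w) - (1/2) ^ k)\<^sup>2" by simp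
      then show "norm (D k w) \<le> (1/2) ^ k / 2 + 2 ^ k / 2 * (norm (D k w))\<^sup>2"
        by (simp add: power2_diff algebra_simps power_one_over power2_eq_square)
    qed
    also have "\<dots> = ennreal (\<integral>w. (1/2) ^ k / 2 + 2 ^ k / 2 * (norm (D k w))\<^sup>2 \<partial>\<Omega>)"
      using int by (intro nn_integral_eq_integral) auto
    also have "(\<integral>w. (1/2) ^ k / 2 + 2 ^ k / 2 * (norm (D k w))\<^sup>2 \<partial>\<Omega>) =
        (1/2) ^ k / 2 + 2 ^ k / 2 * (\<Sum>j=r k..<r (Suc k). (norm (v j))\<^sup>2)"
      using int second_moment(2)[of "{r k..<r (Suc k)}"] by (simp add: W.prob_space D_eq)
    also have "\<dots> \<le> (1/2) ^ k / 2 + 2 ^ k / 2 * (1/4) ^ k"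
      using r(2)[of k] by simp
    also have "\<dots> = (1/2) ^ k"
      by (simp add: power_mult_distrib[symmetric])
    finally show ?thesis by (simp add: ennreal_leI)
  qed
  \<comment> \<open>The expected sum of the norms is finite, so almost surely the increments are
    absolutely summable.\<close>
  have "(\<integral>\<^sup>+w. (\<Sum>k. ennreal (norm (D k w))) \<partial>\<Omega>) = (\<Sum>k. \<integral>\<^sup>+w. ennreal (norm (D k w)) \<partial>\<Omega>)"
    by (rule nn_integral_suminf) measurable
  also have "\<dots> \<le> (\<Sum>k. ennreal ((1/2) ^ k))"
    by (intro suminf_le D_int) auto
  also have "\<dots> = ennreal (\<Sum>k. (1/2) ^ k)"
    by (intro suminf_ennreal2) (auto simp: summable_geometric)
  also have "\<dots> < \<infinity>" by simp
  finally have "AE w in \<Omega>. (\<Sum>k. ennreal (norm (D k w))) \<noteq> \<infinity>"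
    by (intro nn_integral_PInf_AE) auto
  then have "AE w in \<Omega>. convergent (\<lambda>k. S (r k) w)"
  proof eventually_elim
    case (elim w)
    then have "summable (\<lambda>k. norm (D k w))"
      by (intro summable_suminf_not_top) auto
    then have "summable (\<lambda>k. D k w)" by (rule summable_norm_cancel)
    then have "convergent (\<lambda>n. \<Sum>k<n. D k w)" by (simp add: summable_iff_convergent)
    moreover have "(\<Sum>k<n. D k w) = S (r n) w - S (r 0) w" for n
      unfolding D_def by (rule sum_lessThan_telescope)
    ultimately have "convergent (\<lambda>n. S (r n) w - S (r 0) w)" by simp
    from convergent_add[OF this convergent_const[of "S (r 0) w"]] show ?case by simp
  qed
  with r(1) show ?thesis by (rule that)
qed

text \<open>The characteristic functional passes to the almost sure limit by dominated convergence,
  the second moment by Fatou's lemma.\<close>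

lemma gaussian_measure:
  obtains \<mu> where "prob_space \<mu>" "sets \<mu> = sets borel"
    "\<And>u. charf \<mu> u = complex_of_real (exp (- q u / 2))"
    "integrable \<mu> (\<lambda>x. (norm x)\<^sup>2)"
proof -
  obtain r where r: "strict_mono r" "AE w in \<Omega>. convergent (\<lambda>k. S (r k) w)"
    using AE_convergent_subseq by blast
  \<comment> \<open>\<open>Lim\<close> is total, so \<open>G\<close> is measurable everywhere; its
    values off the set of convergence do not affect the law.\<close>
  define G where "G w = Lim sequentially (\<lambda>k. S (r k) w)" for w
  have G[measurable]: "G \<in> borel_measurable \<Omega>"
    unfolding G_def[abs_def] by (rule borel_measurable_lim_metric) measurable
  have lim: "AE w in \<Omega>. (\<lambda>k. S (r k) w) \<longlonglongrightarrow> G w"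
    using r(2) by eventually_elim (simp add: G_def convergent_LIMSEQ_iff)
  have char: "(\<integral>w. iexp (u \<bullet> G w) \<partial>\<Omega>) = complex_of_real (exp (- q u / 2))" for u
  proof (rule LIMSEQ_unique)
    show "(\<lambda>k. \<integral>w. iexp (u \<bullet> S (r k) w) \<partial>\<Omega>) \<longlonglongrightarrow> (\<integral>w. iexp (u \<bullet> G w) \<partial>\<Omega>)"
    proof (rule integral_dominated_convergence[where w = "\<lambda>_. 1"])
      show "AE w in \<Omega>. (\<lambda>k. iexp (u \<bullet> S (r k) w)) \<longlonglongrightarrow> iexp (u \<bullet> G w)"
        using lim by eventually_elim (auto intro!: tendsto_intros)
    qed auto
    have "(\<lambda>k. \<Sum>j<r k. (u \<bullet> v j)\<^sup>2) \<longlonglongrightarrow> q u"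
      using LIMSEQ_subseq_LIMSEQ[OF _ r(1), of "\<lambda>n. \<Sum>j<n. (u \<bullet> v j)\<^sup>2"] sums_q[of u]
      by (simp add: sums_def o_def)
    then show "(\<lambda>k. \<integral>w. iexp (u \<bullet> S (r k) w) \<partial>\<Omega>) \<longlonglongrightarrow> complex_of_real (exp (- q u / 2))"
      unfolding char_S by (intro tendsto_of_real tendsto_exp tendsto_divide tendsto_minus tendsto_const) auto
  qed
  have "integrable \<Omega> (\<lambda>w. (norm (G w))\<^sup>2)"
  proof (rule integrableI_nonneg)
    have "(\<integral>\<^sup>+w. ennreal ((norm (G w))\<^sup>2) \<partial>\<Omega>) = (\<integral>\<^sup>+w. liminf (\<lambda>k. ennreal ((norm (S (r k) w))\<^sup>2)) \<partial>\<Omega>)"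
      using lim
      by (intro nn_integral_cong_AE, eventually_elim)
         (auto intro!: lim_imp_Liminf[symmetric] tendsto_intros)
    also have "\<dots> \<le> liminf (\<lambda>k. \<integral>\<^sup>+w. ennreal ((norm (S (r k) w))\<^sup>2) \<partial>\<Omega>)"
      by (rule nn_integral_liminf) measurable
    also have "\<dots> \<le> liminf (\<lambda>k. ennreal C)"
    proof (intro Liminf_mono always_eventually allI)
      fix k
      have "(\<integral>\<^sup>+w. ennreal ((norm (S (r k) w))\<^sup>2) \<partial>\<Omega>) = ennreal (\<integral>w. (norm (S (r k) w))\<^sup>2 \<partial>\<Omega>)"
        using second_moment(1)[of "{..<r k}"] by (intro nn_integral_eq_integral) (auto simp: S_def)
      then show "(\<integral>\<^sup>+w. ennreal ((norm (S (r k) w))\<^sup>2) \<partial>\<Omega>) \<le> ennreal C"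
        using second_moment(2)[of "{..<r k}"] bound[of "r k"] by (simp add: S_def ennreal_leI)
    qed
    also have "\<dots> = ennreal C" by (simp add: Liminf_const)
    also have "\<dots> < \<infinity>" by simp
    finally show "(\<integral>\<^sup>+w. ennreal ((norm (G w))\<^sup>2) \<partial>\<Omega>) < \<infinity>" .
  qed auto
  then show ?thesis
    using char by (intro that[of "distr \<Omega> borel G"] W.prob_space_distr)
      (auto simp: integral_distr integrable_distr_eq)
qed

end

section \<open>Positive stable laws\<close>

text \<open>Laws on the half-line are kept as measures on the whole real line, where tightness and
  Helly's theorem are stated.\<close>

definition laplace_of :: "real measure \<Rightarrow> (real \<Rightarrow> real) \<Rightarrow> bool" where
  "laplace_of M \<phi> \<longleftrightarrow> real_distribution M \<and> (AE x in M. 0 \<le> x) \<and>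
     (\<forall>l\<ge>0. (\<integral>x. exp (- l * x) \<partial>M) = \<phi> l)"

lemma laplace_ofI:
  assumes "real_distribution M" "AE x in M. 0 \<le> x"
    "\<And>l. 0 \<le> l \<Longrightarrow> (\<integral>x. exp (- l * x) \<partial>M) = \<phi> l"
  shows "laplace_of M \<phi>"
  using assms by (simp add: laplace_of_def)

lemma laplace_integrable:
  assumes "laplace_of M \<phi>" "0 \<le> l"
  shows "integrable M (\<lambda>x. exp (- l * x))"
proof -
  interpret real_distribution M using assms by (simp add: laplace_of_def)
  have "AE x in M. 0 \<le> x" using assms by (simp add: laplace_of_def)
  then show ?thesis
    using assms(2) by (intro integrable_const_bound[of _ 1]) (auto elim!: eventually_mono)
qed

lemma laplace_mult:
  assumes M: "laplace_of M \<phi>" and N: "laplace_of N \<psi>"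
  shows "\<exists>K. laplace_of K (\<lambda>l. \<phi> l * \<psi> l)"
proof -
  interpret M: real_distribution M using M by (simp add: laplace_of_def)
  interpret N: real_distribution N using N by (simp add: laplace_of_def)
  interpret P: pair_prob_space M N ..
  define K where "K = distr (M \<Otimes>\<^sub>M N) borel (\<lambda>(x, y). x + y)"
  have [measurable]: "(\<lambda>(x, y). x + y) \<in> borel_measurable (M \<Otimes>\<^sub>M N)" by measurable
  have "real_distribution K"
    unfolding K_def by (rule P.real_distribution_distr) measurable
  moreover have "AE x in K. 0 \<le> x"
  proof -
    have 1: "AE x in M. 0 \<le> x" and 2: "AE y in N. 0 \<le> y" using M N by (auto simp: laplace_of_def)
    have "AE z in M \<Otimes>\<^sub>M N. 0 \<le> fst z + snd z"
    proof (rule P.AE_pair_measure)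
      show "AE x in M. AE y in N. 0 \<le> fst (x, y) + snd (x, y)"
        using 1
      proof eventually_elim
        case (elim x)
        show ?case using 2 by eventually_elim (use elim in simp)
      qed
    qed measurable
    then show ?thesis
      unfolding K_def by (subst AE_distr_iff) (auto simp: split_beta')
  qed
  moreover have "(\<integral>x. exp (- l * x) \<partial>K) = \<phi> l * \<psi> l" if l: "0 \<le> l" for l
  proof -
    have iM: "integrable M (\<lambda>x. exp (- l * x))" and iN: "integrable N (\<lambda>x. exp (- l * x))"
      using laplace_integrable M N l by auto
    have "(\<integral>x. exp (- l * x) \<partial>K) = (\<integral>z. exp (- l * fst z) * exp (- l * snd z) \<partial>(M \<Otimes>\<^sub>M N))"
      unfolding K_def
      by (subst integral_distr) (auto simp: split_beta' exp_add[symmetric] algebra_simps)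
    also have "\<dots> = (\<integral>x. (\<integral>y. exp (- l * x) * exp (- l * y) \<partial>N) \<partial>M)"
    proof -
      have "integrable (M \<Otimes>\<^sub>M N) (\<lambda>z. exp (- l * fst z) * exp (- l * snd z))"
      proof (rule P.Fubini_integrable)
        show "integrable M (\<lambda>x. \<integral>y. norm (exp (- l * fst (x, y)) * exp (- l * snd (x, y))) \<partial>N)"
          using iM by simp
        show "AE x in M. integrable N (\<lambda>y. exp (- l * fst (x, y)) * exp (- l * snd (x, y)))"
          using iN by simp
      qed measurable
      from P.integral_fst'[OF this] show ?thesis by simp
    qed
    also have "\<dots> = \<phi> l * \<psi> l"
      using M N l by (simp add: laplace_of_def)
    finally show ?thesis .
  qed
  ultimately show ?thesis by (intro exI laplace_ofI)
qed

lemma laplace_return: "0 \<le> c \<Longrightarrow> laplace_of (return borel c) (\<lambda>l. exp (- l * c))"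
proof -
  assume "0 \<le> c"
  interpret prob_space "return borel c" by (rule prob_space_return) simp
  have "real_distribution (return borel c)"
    by unfold_locales auto
  then show ?thesis
    using \<open>0 \<le> c\<close> by (auto simp: laplace_of_def integral_return AE_return)
qed

lemma laplace_power:
  assumes "laplace_of M \<phi>"
  shows "\<exists>K. laplace_of K (\<lambda>l. \<phi> l ^ n)"
proof (induction n)
  case 0
  then show ?case using laplace_return[of 0] by auto
next
  case (Suc n)
  then show ?case using laplace_mult[OF assms] by auto
qed

lemma laplace_scale:
  assumes M: "laplace_of M \<phi>" and c: "0 \<le> c"
  shows "\<exists>K. laplace_of K (\<lambda>l. \<phi> (l * c))"
proof -
  interpret M: real_distribution M using M by (simp add: laplace_of_def)
  have "real_distribution (distr M borel (\<lambda>x. c * x))"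
    by (rule M.real_distribution_distr) measurable
  moreover have "AE x in distr M borel (\<lambda>x. c * x). 0 \<le> x"
    using M c by (subst AE_distr_iff) (auto simp: laplace_of_def elim!: eventually_mono)
  moreover have "(\<integral>x. exp (- l * x) \<partial>distr M borel (\<lambda>x. c * x)) = \<phi> (l * c)" if "0 \<le> l" for l
    using M c that by (subst integral_distr) (auto simp: laplace_of_def mult.assoc[symmetric])
  ultimately show ?thesis by (intro exI laplace_ofI)
qed

text \<open>Markov's inequality for 1 - exp (- x / K), which exceeds 1 - exp (- 1) when x > K. Tails
  are thus controlled by the transform near 0.\<close>

lemma laplace_tail:
  assumes M: "laplace_of M \<phi>" and K: "0 < K"
  shows "measure M {x. K < x} \<le> (1 - \<phi> (1 / K)) / (1 - exp (- 1))"
proof -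
  interpret M: real_distribution M using M by (simp add: laplace_of_def)
  have int: "integrable M (\<lambda>x. exp (- (1 / K) * x))"
    using laplace_integrable[OF M, of "1 / K"] K by simp
  have "(1 - exp (- 1)) * measure M {x. K < x} = (\<integral>x. (1 - exp (- 1)) * indicator {x. K < x} x \<partial>M)"
    by simp
  also have "\<dots> \<le> (\<integral>x. 1 - exp (- (1 / K) * x) \<partial>M)"
  proof (rule integral_mono_AE)
    have "AE x in M. 0 \<le> x" using M by (simp add: laplace_of_def)
    then show "AE x in M. (1 - exp (- 1)) * indicator {x. K < x} x \<le> 1 - exp (- (1 / K) * x)"
    proof eventually_elim
      case (elim x)
      then show ?case using K by (auto simp: indicator_def field_simps)
    qed
    show "integrable M (\<lambda>x. (1 - exp (- 1)) * indicator {x. K < x} x :: real)"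
      by (intro integrable_mult_right) (simp add: M.emeasure_eq_measure)
    show "integrable M (\<lambda>x. 1 - exp (- (1 / K) * x))"
      using int by simp
  qed
  also have "\<dots> = 1 - \<phi> (1 / K)"
    using int K M[unfolded laplace_of_def, THEN conjunct2, THEN conjunct2, rule_format, of "1 / K"]
    by (simp add: M.prob_space[unfolded M.space_eq_univ])
  finally show ?thesis by (simp add: field_simps)
qed

text \<open>The uniform bound \<open>B\<close> gives tightness, so that Helly's selection theorem applies.\<close>

lemma laplace_limit:
  assumes M: "\<And>n. laplace_of (M n) (\<phi> n)"
    and lim: "\<And>l. 0 \<le> l \<Longrightarrow> (\<lambda>n. \<phi> n l) \<longlonglongrightarrow> \<psi> l"
    and B: "\<And>n l. 0 < l \<Longrightarrow> 1 - \<phi> n l \<le> B l" "(B \<longlongrightarrow> 0) (at_right 0)"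
  shows "\<exists>K. laplace_of K \<psi>"
proof -
  have rd: "real_distribution (M n)" and nn: "AE x in M n. 0 \<le> x" for n
    using M[of n] by (auto simp: laplace_of_def)
  interpret M: real_distribution "M n" for n by (rule rd)
  have "tight M"
    unfolding tight_def
  proof (intro conjI allI impI rd)
    fix \<epsilon> :: real assume "0 < \<epsilon>"
    then have "\<forall>\<^sub>F l in at_right 0. B l < \<epsilon> * (1 - exp (- 1))"
      by (intro order_tendstoD(2)[OF B(2)]) simp
    then obtain l where l: "0 < l" "B l < \<epsilon> * (1 - exp (- 1))"
      unfolding eventually_at_right_field by (metis dense)
    show "\<exists>a b. a < b \<and> (\<forall>n. 1 - \<epsilon> < measure (M n) {a<..b})"
    \<comment> \<open>The interval is open on the left, so its endpoint has to be negative to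
      include a possible atom at 0.\<close>
    proof (rule exI[of _ "- 1"], rule exI[of _ "1 / l"], intro conjI allI)
      show "- 1 < 1 / l" using l by (simp add: field_simps)
      fix n
      have "measure (M n) {x. 1 / l < x} \<le> (1 - \<phi> n l) / (1 - exp (- 1))"
        using laplace_tail[OF M[of n], of "1 / l"] l by simp
      also have "\<dots> < \<epsilon>"
        using B(1)[OF l(1), of n] l(2) by (simp add: field_simps)
      finally have tail: "measure (M n) {x. 1 / l < x} < \<epsilon>" .
      have "1 = measure (M n) (space (M n))" by (rule M.prob_space[symmetric])
      also have "\<dots> = measure (M n) ({-1<..1 / l} \<union> {x. 1 / l < x})"
        using nn[of n] by (intro M.finite_measure_eq_AE) (auto elim!: eventually_mono)
      also have "\<dots> \<le> measure (M n) {-1<..1 / l} + measure (M n) {x. 1 / l < x}"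
        by (intro measure_Un_le) auto
      finally show "1 - \<epsilon> < measure (M n) {- 1<..1 / l}"
        using tail by simp
    qed
  qed
  then obtain r K where r: "strict_mono r" "real_distribution K" "weak_conv_m (M \<circ> id \<circ> r) K"
    using tight_imp_convergent_subsubsequence[of M id] by (auto simp: strict_mono_id)
  interpret K: real_distribution K by fact
  have conv: "(\<lambda>n. \<integral>x. f x \<partial>M (r n)) \<longlonglongrightarrow> (\<integral>x. f x \<partial>K)"
    if "\<And>x. isCont f x" "\<And>x. norm (f x) \<le> 1" for f :: "real \<Rightarrow> real"
    using weak_conv_imp_integral_bdd_continuous_conv[of "M \<circ> id \<circ> r" K f 1] r that rd by (simp add: o_def)
  have "AE x in K. 0 \<le> x"
  proof -
    \<comment> \<open>A bounded continuous function that is positive exactly on the negative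
      numbers; its integral carries nonnegativity over to the weak limit.\<close>
    define f :: "real \<Rightarrow> real" where "f x = min 1 (max 0 (- x))" for x
    have meas[measurable]: "f \<in> borel_measurable borel" unfolding f_def[abs_def] by measurable
    have "(\<lambda>n. \<integral>x. f x \<partial>M (r n)) \<longlonglongrightarrow> (\<integral>x. f x \<partial>K)"
      unfolding f_def by (intro conv continuous_intros) auto
    moreover have "(\<integral>x. f x \<partial>M n) = 0" for n
      using nn[of n] by (intro integral_eq_zero_AE) (auto simp: f_def elim!: eventually_mono)
    ultimately have "(\<integral>x. f x \<partial>K) = 0" by (simp add: LIMSEQ_const_iff)
    moreover have int: "integrable K f"
      by (intro K.integrable_const_bound[of _ 1]) (auto simp: f_def)
    have "AE x in K. 0 \<le> f x" by (simp add: f_def)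
    note integral_nonneg_eq_0_iff_AE[OF int this]
    ultimately have "AE x in K. f x = 0" by simp
    then show ?thesis by eventually_elim (auto simp: f_def split: if_splits)
  qed
  moreover have "(\<integral>x. exp (- l * x) \<partial>K) = \<psi> l" if l: "0 \<le> l" for l
  proof (rule LIMSEQ_unique)
    \<comment> \<open>The exponential is unbounded on the negative half-line, so weak convergence is
      applied to its truncation, which has the same integral for these laws.\<close>
    have eq: "(\<integral>x. exp (- l * max 0 x) \<partial>N) = (\<integral>x. exp (- l * x) \<partial>N)"
      if "real_distribution N" "AE x in N. 0 \<le> x" for N
    proof -
      interpret real_distribution N by fact
      show ?thesis
      proof (rule integral_cong_AE)
        show "AE x in N. exp (- l * max 0 x) = exp (- l * x)"
          using that(2) by eventually_elim simp
      qed simp_all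
    qed
    have "(\<lambda>n. \<integral>x. exp (- l * max 0 x) \<partial>M (r n)) \<longlonglongrightarrow> (\<integral>x. exp (- l * max 0 x) \<partial>K)"
      using l by (intro conv continuous_intros) auto
    then show "(\<lambda>n. \<phi> (r n) l) \<longlonglongrightarrow> (\<integral>x. exp (- l * x) \<partial>K)"
      using M l eq[OF rd nn] eq[OF r(2) \<open>AE x in K. 0 \<le> x\<close>] by (simp add: laplace_of_def)
    show "(\<lambda>n. \<phi> (r n) l) \<longlonglongrightarrow> \<psi> l"
      using LIMSEQ_subseq_LIMSEQ[OF lim[OF l] r(1)] by (simp add: o_def)
  qed
  ultimately show ?thesis using r(2) by (intro exI laplace_ofI)
qed

section \<open>Sibuya laws and their stable limits\<close>

text \<open>The Sibuya distribution on the positive integers, with generating function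
  \<open>1 - (1 - z)\<^sup>\<beta>\<close>.\<close>

definition sibuya :: "real \<Rightarrow> nat \<Rightarrow> real" where
  "sibuya \<beta> k = (if k = 0 then 0 else - ((- 1) ^ k * (\<beta> gchoose k)))"

text \<open>The first weight is \<beta>, and the ratio of the weights at k + 1 and k is (k -
  \<beta>) / (k + 1), which is nonnegative for k \<ge> 1.\<close>

lemma sibuya_nonneg:
  assumes "0 < \<beta>" "\<beta> < 1"
  shows "0 \<le> sibuya \<beta> k"
proof (cases k)
  case (Suc m)
  have "0 \<le> - ((- 1) ^ Suc m * (\<beta> gchoose Suc m))"
  proof (induction m)
    case 0
    then show ?case using assms by simp
  next
    case (Suc m)
    have "of_nat (Suc (Suc m)) * (\<beta> gchoose Suc (Suc m)) = (\<beta> - of_nat (Suc m)) * (\<beta> gchoose Suc m)"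
      using gbinomial_mult_1[of \<beta> "Suc m"] by (simp add: algebra_simps)
    then have "\<beta> gchoose Suc (Suc m) = (\<beta> - of_nat (Suc m)) * (\<beta> gchoose Suc m) / of_nat (Suc (Suc m))"
      by (simp add: field_simps del: of_nat_Suc)
    note Z = this
    have gen: "- (s * ((\<beta> - a) * X / b)) = (a - \<beta>) / b * - (- s * X)" for s a b X :: real
      by (simp add: algebra_simps diff_divide_distrib)
    have "- ((- 1) ^ Suc (Suc m) * (\<beta> gchoose Suc (Suc m))) =
        (of_nat (Suc m) - \<beta>) / of_nat (Suc (Suc m)) * - ((- 1) ^ Suc m * (\<beta> gchoose Suc m))"
      unfolding Z using gen[of "(- 1) ^ m"] by (simp del: of_nat_Suc)
    also have "0 \<le> \<dots>"
      using Suc assms by (intro mult_nonneg_nonneg divide_nonneg_nonneg) auto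
    finally show ?case .
  qed
  then show ?thesis by (simp add: sibuya_def Suc)
qed (simp add: sibuya_def)

lemma sibuya_sums:
  assumes "0 \<le> z" "z < 1"
  shows "(\<lambda>k. sibuya \<beta> k * z ^ k) sums (1 - (1 - z) powr \<beta>)"
proof -
  have "(\<lambda>k. (\<beta> gchoose k) * (- z) ^ k) sums (1 + - z) powr \<beta>"
    using assms by (intro gen_binomial_real) auto
  from sums_diff[OF sums_single[of 0 "\<lambda>_. 1"] this]
  have "(\<lambda>k. (if k = 0 then 1 else 0) - (\<beta> gchoose k) * (- z) ^ k) sums (1 - (1 - z) powr \<beta>)"
    by simp
  also have "(\<lambda>k. (if k = 0 then 1 else 0) - (\<beta> gchoose k) * (- z) ^ k) = (\<lambda>k. sibuya \<beta> k * z ^ k)"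
    by (auto simp: sibuya_def fun_eq_iff power_minus[of z])
  finally show ?thesis .
qed

text \<open>The binomial series is evaluated for z < 1 and then z tends to 1. Nonnegative weights
  bound the partial sums by 1 in this limit, and bound the series at z by the full sum.\<close>

lemma sibuya_sums_1:
  assumes \<beta>: "0 < \<beta>" "\<beta> < 1"
  shows "sibuya \<beta> sums 1"
proof -
  note nn = sibuya_nonneg[OF \<beta>]
  have partial: "(\<Sum>k<n. sibuya \<beta> k) \<le> 1" for n
  proof (rule tendsto_upperbound)
    show "((\<lambda>z. \<Sum>k<n. sibuya \<beta> k * z ^ k) \<longlongrightarrow> (\<Sum>k<n. sibuya \<beta> k)) (at_left 1)"
      by (auto intro!: tendsto_eq_intros)
    have "\<forall>\<^sub>F z in at_left (1::real). 0 < z \<and> z < 1"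
      by (intro eventually_conj eventually_at_left_real) (auto simp: eventually_at_left_field intro: exI[of _ 0])
    then show "\<forall>\<^sub>F z in at_left 1. (\<Sum>k<n. sibuya \<beta> k * z ^ k) \<le> 1"
    proof eventually_elim
      case (elim z)
      have s: "(\<lambda>k. sibuya \<beta> k * z ^ k) sums (1 - (1 - z) powr \<beta>)"
        using elim by (intro sibuya_sums) auto
      then have "(\<Sum>k<n. sibuya \<beta> k * z ^ k) \<le> (1 - (1 - z) powr \<beta>)"
        using nn elim sum_le_suminf[OF sums_summable[OF s], of "{..<n}"] sums_unique[OF s] by simp
      also have "\<dots> \<le> 1" by simp
      finally show ?case .
    qed
  qed simp
  then have summ: "summable (sibuya \<beta>)"
    using nn by (intro summableI_nonneg_bounded[of _ 1]) auto
  have "1 \<le> suminf (sibuya \<beta>)"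
  proof (rule tendsto_upperbound)
    have "((\<lambda>z. 1 - (1 - z) powr \<beta>) \<longlongrightarrow> 1 - 0) (at_left (1::real))"
      using \<beta> by (intro tendsto_diff tendsto_const) real_asymp
    then show "((\<lambda>z. 1 - (1 - z) powr \<beta>) \<longlongrightarrow> 1) (at_left (1::real))" by simp
    have "\<forall>\<^sub>F z in at_left (1::real). 0 < z \<and> z < 1"
      by (auto simp: eventually_at_left_field intro: exI[of _ 0])
    then show "\<forall>\<^sub>F z in at_left 1. 1 - (1 - z) powr \<beta> \<le> suminf (sibuya \<beta>)"
    proof eventually_elim
      case (elim z)
      have s: "(\<lambda>k. sibuya \<beta> k * z ^ k) sums (1 - (1 - z) powr \<beta>)"
        using elim by (intro sibuya_sums) auto
      have "sibuya \<beta> k * z ^ k \<le> sibuya \<beta> k" for k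
        using nn[of k] elim by (simp add: mult_left_le power_le_one)
      then show ?case
        using suminf_le[OF _ sums_summable[OF s] summ] sums_unique[OF s] by simp
    qed
  qed simp
  moreover have "suminf (sibuya \<beta>) \<le> 1"
    using partial summ by (intro suminf_le_const) auto
  ultimately show ?thesis using summ by (simp add: sums_iff)
qed

lemma laplace_sibuya:
  assumes \<beta>: "0 < \<beta>" "\<beta> < 1"
  shows "\<exists>M. laplace_of M (\<lambda>l. 1 - (1 - exp (- l)) powr \<beta>)"
proof -
  define P where "P = density (count_space UNIV) (\<lambda>k. ennreal (sibuya \<beta> k))"
  note nn = sibuya_nonneg[OF \<beta>]
  have "emeasure P (space P) = (\<Sum>k. ennreal (sibuya \<beta> k))"
    by (simp add: P_def emeasure_density nn_integral_count_space_nat)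
  also have "\<dots> = ennreal 1"
    using sibuya_sums_1[OF \<beta>] nn by (subst suminf_ennreal2) (auto simp: sums_iff)
  finally interpret P: prob_space P by (intro prob_spaceI) simp
  have [measurable]: "real \<in> borel_measurable P" by (simp add: P_def)
  define M where "M = distr P borel real"
  have "real_distribution M"
    unfolding M_def by (rule P.real_distribution_distr) measurable
  moreover have "AE x in M. 0 \<le> x"
    unfolding M_def by (subst AE_distr_iff) auto
  moreover have "(\<integral>x. exp (- l * x) \<partial>M) = 1 - (1 - exp (- l)) powr \<beta>" if "0 \<le> l" for l
  proof -
    have "(\<integral>x. exp (- l * x) \<partial>M) = (\<integral>k. exp (- l * real k) \<partial>P)"
      unfolding M_def by (rule integral_distr) measurable
    also have "\<dots> = (\<integral>k. sibuya \<beta> k *\<^sub>R exp (- l * real k) \<partial>count_space UNIV)"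
      unfolding P_def using nn by (intro integral_density) auto
    finally have eq: "(\<integral>x. exp (- l * x) \<partial>M) = (\<integral>k. sibuya \<beta> k * exp (- l) ^ k \<partial>count_space UNIV)"
      by (simp add: exp_of_nat_mult[symmetric] mult.commute)
    have sums: "(\<lambda>k. sibuya \<beta> k * exp (- l) ^ k) sums (1 - (1 - exp (- l)) powr \<beta>)"
    \<comment> \<open>This is the boundary value z = 1 of the generating function.\<close>
    proof (cases "l = 0")
      case True
      then show ?thesis using sibuya_sums_1[OF \<beta>] by simp
    next
      case False
      then show ?thesis using that by (intro sibuya_sums) auto
    qed
    have "integrable (count_space UNIV) (\<lambda>k. sibuya \<beta> k * exp (- l) ^ k)"
      using sums nn by (auto simp: integrable_count_space_nat_iff sums_iff)
    from sums_integral_count_space_nat[OF this] sums show ?thesis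
      unfolding eq by (rule sums_unique2)
  qed
  ultimately show ?thesis by (intro exI laplace_ofI)
qed

text \<open>With y = (1 - exp (- l c))^\<beta>, which is about l^\<beta> / n for c = n^(-1/\<beta>),
  the transforms are (1 - y)^n. Bernoulli's inequality gives 1 - (1 - y)^n \<le> n y \<le>
  l^\<beta>, the uniform bound needed for tightness.\<close>

lemma laplace_stable:
  assumes \<beta>: "0 < \<beta>" "\<beta> < 1"
  shows "\<exists>M. laplace_of M (\<lambda>l. exp (- (l powr \<beta>)))"
proof -
  obtain N where N: "laplace_of N (\<lambda>l. 1 - (1 - exp (- l)) powr \<beta>)"
    using laplace_sibuya[OF \<beta>] by blast
  define c where "c n = real n powr (- 1 / \<beta>)" for n
  have "\<exists>K. laplace_of K (\<lambda>l. (1 - (1 - exp (- (l * c n))) powr \<beta>) ^ n)" for n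
  proof -
    obtain K where "laplace_of K (\<lambda>l. 1 - (1 - exp (- (l * c n))) powr \<beta>)"
      using laplace_scale[OF N, of "c n"] by (auto simp: c_def)
    then show ?thesis by (rule laplace_power)
  qed
  then obtain M where M: "\<And>n. laplace_of (M n) (\<lambda>l. (1 - (1 - exp (- (l * c n))) powr \<beta>) ^ n)"
    by metis
  show ?thesis
  proof (rule laplace_limit[OF M, where B = "\<lambda>l. l powr \<beta>"])
    fix l :: real assume "0 \<le> l"
    show "(\<lambda>n. (1 - (1 - exp (- (l * c n))) powr \<beta>) ^ n) \<longlonglongrightarrow> exp (- (l powr \<beta>))"
    proof (cases "l = 0")
      case False
      with \<open>0 \<le> l\<close> have "0 < l" by simp
      then show ?thesis unfolding c_def using \<beta> by real_asymp
    qed simp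
  next
    fix n and l :: real assume l: "0 < l"
    define y where "y = (1 - exp (- (l * c n))) powr \<beta>"
    have lc: "0 \<le> l * c n" using l by (simp add: c_def)
    have y: "0 \<le> y" "y \<le> 1"
      using lc \<beta> by (auto simp: y_def powr_le1)
    have "y \<le> (l * c n) powr \<beta>"
      unfolding y_def using lc \<beta> exp_ge_add_one_self[of "- (l * c n)"] by (intro powr_mono2) auto
    also have "\<dots> = l powr \<beta> * c n powr \<beta>"
      using l by (simp add: powr_mult c_def)
    finally have "real n * y \<le> real n * (l powr \<beta> * c n powr \<beta>)"
      by (rule mult_left_mono) simp
    also have "\<dots> = l powr \<beta> * (real n * c n powr \<beta>)"
      by (simp only: mult_ac)
    also have "real n * c n powr \<beta> \<le> 1"
    proof -
      have "c n powr \<beta> = real n powr (- 1)"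
        unfolding c_def powr_powr using \<beta> by simp
      then show ?thesis by (cases "n = 0") (simp_all add: powr_minus)
    qed
    finally have "real n * y \<le> l powr \<beta>" by (simp add: mult_left_mono)
    moreover have "1 + real n * - y \<le> (1 + - y) ^ n"
      using y by (intro Bernoulli_inequality) auto
    ultimately show "1 - (1 - (1 - exp (- (l * c n))) powr \<beta>) ^ n \<le> l powr \<beta>"
      by (simp add: y_def)
  next
    show "((\<lambda>l. l powr \<beta>) \<longlongrightarrow> 0) (at_right 0)"
      using \<beta> by real_asymp
  qed
qed

text \<open>Tails at level K are of order K^(- \<beta>). Over dyadic blocks the mean of the square
  root is therefore bounded by a geometric series with ratio 2^(1/2 - \<beta>), which is below 1
  because \<beta> > 1/2.\<close>

lemma laplace_stable_moment:
  assumes \<beta>: "1 / 2 < \<beta>" "\<beta> < 1" and M: "laplace_of M (\<lambda>l. exp (- (l powr \<beta>)))"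
  shows "integrable M (\<lambda>x. sqrt x)"
proof -
  interpret M: real_distribution M using M by (simp add: laplace_of_def)
  define C where "C = sqrt 2 / (1 - exp (- 1))"
  have C: "0 < C" by (simp add: C_def)
  define r where "r = 2 powr (1 / 2 - \<beta>)"
  have r: "0 < r" "r < 1" using \<beta> powr_less_mono[of "1 / 2 - \<beta>" 0 2] by (auto simp: r_def)
  have tail: "sqrt (2 ^ Suc n) * measure M {x. 2 ^ n < x} \<le> C * r ^ n" for n
  proof -
    have "measure M {x. 2 ^ n < x} \<le> (1 - exp (- ((1 / 2 ^ n) powr \<beta>))) / (1 - exp (- 1))"
      by (rule laplace_tail[OF M]) simp
    also have "\<dots> \<le> (1 / 2 ^ n) powr \<beta> / (1 - exp (- 1))"
      using exp_ge_add_one_self[of "- ((1 / 2 ^ n) powr \<beta>)"] by (intro divide_right_mono) auto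
    finally have "sqrt (2 ^ Suc n) * measure M {x. 2 ^ n < x} \<le>
        sqrt (2 ^ Suc n) * ((1 / 2 ^ n) powr \<beta> / (1 - exp (- 1)))"
      by (intro mult_left_mono) auto
    also have "\<dots> = C * (sqrt (2 ^ n) * (1 / 2 ^ n) powr \<beta>)"
      by (simp add: C_def real_sqrt_mult)
    also have "sqrt (2 ^ n) * (1 / 2 ^ n) powr \<beta> = r ^ n"
    proof -
      have "sqrt (2 ^ n) = 2 powr (real n / 2)"
        by (simp add: powr_half_sqrt[symmetric] powr_realpow[symmetric] powr_powr)
      moreover have "(1 / 2 ^ n) powr \<beta> = 2 powr (- (real n * \<beta>))"
        by (simp add: powr_divide powr_realpow[symmetric] powr_powr powr_minus_divide)
      ultimately show ?thesis
        by (simp add: r_def powr_realpow[symmetric] powr_powr powr_add[symmetric] algebra_simps)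
    qed
    finally show ?thesis .
  qed
  have "(\<integral>\<^sup>+x. ennreal (sqrt x) \<partial>M) \<le>
      (\<integral>\<^sup>+x. 1 + (\<Sum>n. ennreal (sqrt (2 ^ Suc n)) * indicator {x. 2 ^ n < x} x) \<partial>M)"
  proof (rule nn_integral_mono)
    fix x :: real
    show "ennreal (sqrt x) \<le> 1 + (\<Sum>n. ennreal (sqrt (2 ^ Suc n)) * indicator {x. 2 ^ n < x} x)"
    proof (cases "x \<le> 1")
      case True
      then have "ennreal (sqrt x) \<le> 1" by simp
      then show ?thesis by (simp add: add_increasing2)
    next
      case False
      obtain m where "x < 2 ^ m" using real_arch_pow[of 2 x] by auto
      \<comment> \<open>The least such exponent locates \<open>x\<close> in the block between 2^n
        and 2^(n + 1), and the term with this \<open>n\<close> alone dominates sqrt x.\<close>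
      define k where "k = (LEAST m. x \<le> 2 ^ m)"
      have k: "x \<le> 2 ^ k" unfolding k_def using \<open>x < 2 ^ m\<close> by (intro LeastI[of "\<lambda>m. x \<le> 2 ^ m" m]) simp
      with False have "k \<noteq> 0" by (cases k) auto
      then obtain n where n: "k = Suc n" by (cases k) auto
      have "\<not> x \<le> 2 ^ n" using not_less_Least[of n "\<lambda>m. x \<le> 2 ^ m"] n by (simp add: k_def)
      define f where "f i = ennreal (sqrt (2 ^ Suc i)) * indicator {x. 2 ^ i < x} x" for i :: nat
      have "ennreal (sqrt x) \<le> f n"
        unfolding f_def using k n \<open>\<not> x \<le> 2 ^ n\<close> by (simp add: ennreal_leI)
      also have "f n = sum f {n}" by simp
      also have "\<dots> \<le> suminf f"
        by (rule sum_le_suminf) auto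
      finally have "ennreal (sqrt x) \<le> 1 + suminf f" by (simp add: add_increasing)
      then show ?thesis unfolding f_def[abs_def] .
    qed
  qed
  also have "\<dots> = 1 + (\<Sum>n. ennreal (sqrt (2 ^ Suc n)) * emeasure M {x. 2 ^ n < x})"
    by (subst nn_integral_add)
       (auto simp: M.emeasure_space_1[simplified] nn_integral_suminf nn_integral_cmult_indicator)
  also have "\<dots> \<le> 1 + (\<Sum>n. ennreal (C * r ^ n))"
    using tail by (intro add_left_mono suminf_le)
      (auto simp: M.emeasure_eq_measure ennreal_mult[symmetric] intro!: ennreal_leI simp del: power_Suc)
  also have "\<dots> = 1 + ennreal (\<Sum>n. C * r ^ n)"
    using r C by (subst suminf_ennreal2) (auto intro!: summable_mult)
  also have "\<dots> < \<infinity>" by simp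
  finally have fin: "(\<integral>\<^sup>+x. ennreal (sqrt x) \<partial>M) < \<infinity>" .
  have "AE x in M. 0 \<le> x" using M by (simp add: laplace_of_def)
  then show ?thesis
    using fin by (intro integrableI_nonneg) (auto elim!: eventually_mono)
qed

section \<open>Stable processes\<close>

lemma norm_tail_tendsto_0:
  fixes \<mu> :: "'a::{real_normed_vector, second_countable_topology} measure"
  assumes "prob_space \<mu>" "sets \<mu> = sets borel"
  shows "((\<lambda>K. measure \<mu> {x. K < norm x}) \<longlongrightarrow> 0) at_top"
proof -
  interpret prob_space \<mu> by fact
  have space: "space \<mu> = UNIV" using sets_eq_imp_space_eq[OF assms(2)] by simp
  have [measurable]: "norm \<in> borel_measurable \<mu>"
    unfolding measurable_cong_sets[OF assms(2) refl] by measurable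
  define N where "N = distr \<mu> borel norm"
  interpret N: real_distribution N
    unfolding N_def by (rule real_distribution_distr) measurable
  have "measure \<mu> {x. K < norm x} = 1 - cdf N K" for K
  proof -
    have "measure \<mu> {x. K < norm x} = measure N {K<..}"
      unfolding N_def by (subst measure_distr) (auto simp: space intro!: arg_cong[where f = prob])
    also have "{K<..} = space N - {..K}" by auto
    also have "measure N (space N - {..K}) = 1 - measure N {..K}"
      by (rule N.prob_compl) simp
    finally show ?thesis by (simp add: cdf_def)
  qed
  moreover have "((\<lambda>K. 1 - cdf N K) \<longlongrightarrow> 1 - 1) at_top"
    by (intro tendsto_diff tendsto_const N.cdf_lim_at_top_prob)
  ultimately show ?thesis by simp
qed

lemma integrable_norm_of_square:
  fixes f :: "'w \<Rightarrow> 'a::{real_normed_vector, second_countable_topology}"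
  assumes "prob_space M" and [measurable]: "f \<in> borel_measurable M"
    and "integrable M (\<lambda>x. (norm (f x))\<^sup>2)"
  shows "integrable M (\<lambda>x. norm (f x))"
proof -
  interpret prob_space M by fact
  show ?thesis
  proof (rule Bochner_Integration.integrable_bound)
    show "integrable M (\<lambda>x. 1 + (norm (f x))\<^sup>2)" using assms(3) by simp
    have "r \<le> 1 + r\<^sup>2" for r :: real
      using zero_le_power2[of "r - 1/2"] by (simp add: power2_eq_square algebra_simps)
    then show "AE x in M. norm (norm (f x)) \<le> norm (1 + (norm (f x))\<^sup>2)"
      by (simp add: abs_of_nonneg)
  qed measurable
qed

text \<open>The law is that of \<open>sqrt (2 S) G\<close> with \<open>G\<close> centred Gaussian of covariance \<open>Q\<close> and an
  independent positive \<open>\<alpha>/2\<close>-stable \<open>S\<close>; for \<open>\<alpha> = 2\<close> take \<open>S = 1\<close>.\<close>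

lemma stable_law_exists:
  fixes Q :: "'a::{real_inner, banach, polish_space} \<Rightarrow> 'a"
  assumes \<alpha>: "0 < \<alpha>" "\<alpha> \<le> 2" and Q: "pos_semidef Q" "trace_class Q"
  obtains \<mu> where "prob_space \<mu>" "sets \<mu> = sets borel"
    "\<And>u. charf \<mu> u = complex_of_real (exp (- ((Q u \<bullet> u) powr (\<alpha> / 2))))"
    "\<alpha> = 2 \<Longrightarrow> integrable \<mu> (\<lambda>x. (norm x)\<^sup>2)"
    "1 < \<alpha> \<Longrightarrow> integrable \<mu> norm"
proof -
  obtain v C where v: "\<And>u. (\<lambda>k. (u \<bullet> v k)\<^sup>2) sums (Q u \<bullet> u)" "\<And>N. (\<Sum>k<N. (norm (v k))\<^sup>2) \<le> C"
    using covariance_factorization[OF Q] by blast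
  interpret gaussian_series v "\<lambda>u. Q u \<bullet> u" C
    by unfold_locales (rule v)+
  obtain G where G: "prob_space G" "sets G = sets borel"
    "\<And>u. charf G u = complex_of_real (exp (- (Q u \<bullet> u) / 2))"
    "integrable G (\<lambda>x. (norm x)\<^sup>2)"
    using gaussian_measure by blast
  interpret G: prob_space G by (rule G)
  note G_meas = measurable_cong_sets[OF G(2) refl]
  have [measurable]: "(\<lambda>x. x) \<in> borel_measurable G" unfolding G_meas by simp
  have quad: "Q (c *\<^sub>R u) \<bullet> (c *\<^sub>R u) = c\<^sup>2 * (Q u \<bullet> u)" for c u
    by (simp add: pos_semidef_linear[OF Q(1)] power2_eq_square)
  have charG: "(\<integral>x. iexp (u \<bullet> (c *\<^sub>R x)) \<partial>G) = complex_of_real (exp (- (c\<^sup>2 * (Q u \<bullet> u)) / 2))" for c u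
    using G(3)[of "c *\<^sub>R u"] quad[of c u] by simp
  have normG: "integrable G (\<lambda>x. norm x)"
    using integrable_norm_of_square[OF G(1), of "\<lambda>x. x"] G(4) by simp
  show ?thesis
  proof (cases "\<alpha> = 2")
    case True
    \<comment> \<open>The factor sqrt 2 cancels the 1/2 in the Gaussian exponent.\<close>
    define \<mu> where "\<mu> = distr G borel (\<lambda>x. sqrt 2 *\<^sub>R x)"
    show ?thesis
    proof (rule that)
      show "prob_space \<mu>" unfolding \<mu>_def by (rule G.prob_space_distr) measurable
      show "sets \<mu> = sets borel" by (simp add: \<mu>_def)
      show "charf \<mu> u = complex_of_real (exp (- ((Q u \<bullet> u) powr (\<alpha> / 2))))" for u
      proof -
        have "charf \<mu> u = (\<integral>x. iexp (u \<bullet> (sqrt 2 *\<^sub>R x)) \<partial>G)"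
          unfolding \<mu>_def by (rule integral_distr) measurable
        then show ?thesis
          using charG[of u "sqrt 2"] True pos_semidef_nonneg[OF Q(1), of u] by simp
      qed
      show "integrable \<mu> (\<lambda>x. (norm x)\<^sup>2)"
        unfolding \<mu>_def using G(4) by (simp add: integrable_distr_eq power_mult_distrib)
      show "integrable \<mu> norm"
        unfolding \<mu>_def using normG by (simp add: integrable_distr_eq)
    qed
  next
    case False
    then have \<beta>: "0 < \<alpha> / 2" "\<alpha> / 2 < 1" using \<alpha> by auto
    obtain N where N: "laplace_of N (\<lambda>l. exp (- (l powr (\<alpha> / 2))))"
      using laplace_stable[OF \<beta>] by blast
    interpret N: real_distribution N using N by (simp add: laplace_of_def)
    have N0: "AE s in N. 0 \<le> s" using N by (simp add: laplace_of_def)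
    interpret P: pair_prob_space N G ..
    define h where "h = (\<lambda>(s, x). sqrt (2 * s) *\<^sub>R x :: 'a)"
    have h[measurable]: "h \<in> borel_measurable (N \<Otimes>\<^sub>M G)"
      unfolding h_def split_beta' by measurable
    define \<mu> where "\<mu> = distr (N \<Otimes>\<^sub>M G) borel h"
    show ?thesis
    proof (rule that)
      show "prob_space \<mu>" unfolding \<mu>_def by (rule P.prob_space_distr) measurable
      show "sets \<mu> = sets borel" by (simp add: \<mu>_def)
      show "charf \<mu> u = complex_of_real (exp (- ((Q u \<bullet> u) powr (\<alpha> / 2))))" for u
      proof -
        define q where "q = Q u \<bullet> u"
        have q: "0 \<le> q" unfolding q_def by (rule pos_semidef_nonneg[OF Q(1)])
        have "charf \<mu> u = (\<integral>z. iexp (u \<bullet> h z) \<partial>(N \<Otimes>\<^sub>M G))"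
          unfolding \<mu>_def by (rule integral_distr) measurable
        also have "\<dots> = (\<integral>s. (\<integral>x. iexp (u \<bullet> h (s, x)) \<partial>G) \<partial>N)"
          by (rule P.integral_fst'[symmetric], rule P.P.integrable_const_bound[of _ 1]) auto
        \<comment> \<open>For fixed s \<ge> 0 the inner integral is Gaussian with variance factor 2
          s; negative \<open>s\<close> form a null set.\<close>
        also have "\<dots> = (\<integral>s. complex_of_real (exp (- q * s)) \<partial>N)"
        proof (rule integral_cong_AE)
          show "AE s in N. (\<integral>x. iexp (u \<bullet> h (s, x)) \<partial>G) = complex_of_real (exp (- q * s))"
            using N0
          proof eventually_elim
            case (elim s)
            then show ?case
              using charG[of u "sqrt (2 * s)"] by (simp add: h_def q_def mult_ac)
          qed
          have "(\<lambda>(s, x). iexp (u \<bullet> h (s, x))) \<in> borel_measurable (N \<Otimes>\<^sub>M G)" by simp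
          then show "(\<lambda>s. \<integral>x. iexp (u \<bullet> h (s, x)) \<partial>G) \<in> borel_measurable N"
            by (rule G.borel_measurable_lebesgue_integral)
        qed simp
        also have "\<dots> = complex_of_real (\<integral>s. exp (- q * s) \<partial>N)"
          by (rule integral_complex_of_real)
        also have "(\<integral>s. exp (- q * s) \<partial>N) = exp (- (q powr (\<alpha> / 2)))"
          using N q by (simp add: laplace_of_def)
        finally show ?thesis by (simp add: q_def)
      qed
      show "integrable \<mu> (\<lambda>x. (norm x)\<^sup>2)" if "\<alpha> = 2" using that False by simp
      show "integrable \<mu> norm" if "1 < \<alpha>"
      proof -
        have s: "integrable N (\<lambda>s. sqrt s)"
          using laplace_stable_moment[OF _ \<beta>(2) N] that by simp
        have "integrable (N \<Otimes>\<^sub>M G) (\<lambda>z. norm (h z))"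
        proof (rule P.Fubini_integrable)
          have "(\<integral>x. norm (norm (h (s, x))) \<partial>G) = sqrt 2 * (\<bar>sqrt s\<bar> * (\<integral>x. norm x \<partial>G))" for s
            by (simp add: h_def real_sqrt_mult abs_mult)
          then show "integrable N (\<lambda>s. \<integral>x. norm (norm (h (s, x))) \<partial>G)"
            using s by simp
          show "AE s in N. integrable G (\<lambda>x. norm (h (s, x)))"
            using normG by (simp add: h_def)
        qed measurable
        then show ?thesis unfolding \<mu>_def by (simp add: integrable_distr_eq)
      qed
    qed
  qed
qed

section \<open>The convolution semigroup of dilations of a stable law\<close>

locale stable_law =
  fixes Q :: "'a::{real_inner, banach, polish_space} \<Rightarrow> 'a" and \<alpha> :: real and \<mu>\<^sub>1 :: "'a measure"
  assumes alpha: "0 < \<alpha>" and Q: "pos_semidef Q"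
    and prob_mu1: "prob_space \<mu>\<^sub>1" and sets_mu1: "sets \<mu>\<^sub>1 = sets borel"
    and char_mu1: "\<And>u. charf \<mu>\<^sub>1 u = complex_of_real (exp (- ((Q u \<bullet> u) powr (\<alpha> / 2))))"
begin

definition scaled :: "real \<Rightarrow> 'a measure" where
  "scaled c = distr \<mu>\<^sub>1 borel (\<lambda>x. c *\<^sub>R x)"

lemma measurable_mu1 [measurable]: "(\<lambda>x. c *\<^sub>R x) \<in> borel_measurable \<mu>\<^sub>1"
  unfolding measurable_cong_sets[OF sets_mu1 refl] by measurable

lemma prob_scaled: "prob_space (scaled c)"
  unfolding scaled_def by (rule prob_space.prob_space_distr[OF prob_mu1]) measurable

lemma sets_scaled: "sets (scaled c) = sets borel"
  by (simp add: scaled_def)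

lemma scaled_scaled: "distr (scaled c) borel (\<lambda>x. t *\<^sub>R x) = scaled (t * c)"
  unfolding scaled_def by (subst distr_distr) (auto simp: o_def)

lemma char_scaled:
  assumes "0 \<le> c"
  shows "charf (scaled c) u =
    exp (complex_of_real (c powr \<alpha>) * - complex_of_real ((Q u \<bullet> u) powr (\<alpha> / 2)))"
proof -
  have "charf (scaled c) u = charf \<mu>\<^sub>1 (c *\<^sub>R u)"
    unfolding scaled_def by (subst integral_distr) auto
  also have "\<dots> = complex_of_real (exp (- ((c\<^sup>2 * (Q u \<bullet> u)) powr (\<alpha> / 2))))"
    unfolding char_mu1 by (simp add: pos_semidef_linear[OF Q] power2_eq_square mult.assoc)
  also have "(c\<^sup>2 * (Q u \<bullet> u)) powr (\<alpha> / 2) = c powr \<alpha> * (Q u \<bullet> u) powr (\<alpha> / 2)"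
  proof (cases "c = 0")
    case False
    then have "c\<^sup>2 powr (\<alpha> / 2) = c powr \<alpha>"
      using assms by (simp add: power2_eq_square powr_mult powr_add[symmetric])
    then show ?thesis
      using pos_semidef_nonneg[OF Q, of u] by (simp add: powr_mult)
  qed simp
  finally show ?thesis
    by (simp only: of_real_mult of_real_minus exp_of_real[symmetric] mult_minus_right)
qed

text \<open>The exponent 1/\<alpha> makes \<open>char_scaled\<close> linear in \<open>t\<close>. At
  t = 0 the convention \<open>0 powr x = 0\<close> yields the Dirac mass at 0.\<close>

definition at_time :: "real \<Rightarrow> 'a measure" where
  "at_time t = scaled (t powr (1 / \<alpha>))"

sublocale convolution_semigroup at_time "\<lambda>u. - complex_of_real ((Q u \<bullet> u) powr (\<alpha> / 2))"
proof (rule convolution_semigroup.intro)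
  fix t :: real assume "0 \<le> t"
  show "prob_space (at_time t)" "sets (at_time t) = sets borel"
    unfolding at_time_def by (rule prob_scaled, rule sets_scaled)
  fix u
  show "charf (at_time t) u =
    exp (complex_of_real t * - complex_of_real ((Q u \<bullet> u) powr (\<alpha> / 2)))"
    unfolding at_time_def using char_scaled[of "t powr (1 / \<alpha>)" u] alpha \<open>0 \<le> t\<close> by (simp add: powr_powr)
next
  show "- complex_of_real ((Q 0 \<bullet> 0) powr (\<alpha> / 2)) = 0" by simp
next
  fix \<epsilon> :: real assume "0 < \<epsilon>"
  \<comment> \<open>The dilation is moved to the other side: as \<open>t\<close> tends to 0 the
    threshold for the fixed law \<open>\<mu>\<^sub>1\<close> tends to infinity.\<close>
  have "((\<lambda>t. measure \<mu>\<^sub>1 {x. \<epsilon> / t powr (1 / \<alpha>) < norm x}) \<longlongrightarrow> 0) (at_right 0)"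
  proof (rule filterlim_compose[OF norm_tail_tendsto_0[OF prob_mu1 sets_mu1]])
    show "filterlim (\<lambda>t. \<epsilon> / t powr (1 / \<alpha>)) at_top (at_right 0)"
      using alpha \<open>0 < \<epsilon>\<close> by real_asymp
  qed
  then show "((\<lambda>t. measure (at_time t) {x. \<epsilon> < norm x}) \<longlongrightarrow> 0) (at_right 0)"
  proof (rule Lim_transform_eventually)
    show "\<forall>\<^sub>F t in at_right 0. measure \<mu>\<^sub>1 {x. \<epsilon> / t powr (1 / \<alpha>) < norm x} = measure (at_time t) {x. \<epsilon> < norm x}"
      using eventually_at_right_less[of 0]
    proof eventually_elim
      case (elim t)
      have space: "space \<mu>\<^sub>1 = UNIV" using sets_eq_imp_space_eq[OF sets_mu1] by simp
      define c where "c = t powr (1 / \<alpha>)"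
      have c: "0 < c" using elim by (simp add: c_def)
      have "measure (scaled c) {x. \<epsilon> < norm x} = measure \<mu>\<^sub>1 ((\<lambda>x. c *\<^sub>R x) -` {x. \<epsilon> < norm x} \<inter> space \<mu>\<^sub>1)"
        unfolding scaled_def by (rule measure_distr) measurable
      also have "(\<lambda>x. c *\<^sub>R x) -` {x. \<epsilon> < norm x} \<inter> space \<mu>\<^sub>1 = {x. \<epsilon> / c < norm x}"
        using c by (auto simp: space pos_divide_less_eq mult.commute)
      finally show ?case by (simp only: at_time_def c_def)
    qed
  qed
qed

lemma stable_process_exists:
  "levy_process lim (\<lambda>t w. w t)" "symmetric_process lim (\<lambda>t w. w t)"
  "strictly_stable \<alpha> lim (\<lambda>t w. w t)"
  "levy_exponent lim (\<lambda>t w. w t) (\<lambda>u. - complex_of_real ((Q u \<bullet> u) powr (\<alpha> / 2)))"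
proof -
  show "levy_process lim (\<lambda>t w. w t)" by (rule levy_process_coordinates)
  show "levy_exponent lim (\<lambda>t w. w t) (\<lambda>u. - complex_of_real ((Q u \<bullet> u) powr (\<alpha> / 2)))"
    by (rule levy_exponent_coordinates)
  show "symmetric_process lim (\<lambda>t w. w t)"
    by (rule symmetric_process_coordinates)
       (use pos_semidef_linear(3)[OF Q, of "- 1"] in simp)
  show "strictly_stable \<alpha> lim (\<lambda>t w. w t)"
    unfolding strictly_stable_def
  proof (intro allI impI)
    fix t :: real assume t: "0 \<le> t"
    have [measurable]: "(\<lambda>w. w 1) \<in> borel_measurable lim" by measurable
    have "distr lim borel (\<lambda>w. t *\<^sub>R w 1) = distr (distr lim borel (\<lambda>w. w 1)) borel (\<lambda>x. t *\<^sub>R x)"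
      by (subst distr_distr) (auto simp: o_def)
    also have "\<dots> = scaled t"
      by (simp add: distr_coordinate at_time_def scaled_scaled)
    also have "\<dots> = at_time (t powr \<alpha>)"
      using t alpha by (simp add: at_time_def powr_powr)
    also have "\<dots> = distr lim borel (\<lambda>w. w (t powr \<alpha>))"
      by (simp add: distr_coordinate)
    finally show "distr lim borel (\<lambda>w. w (t powr \<alpha>)) = distr lim borel (\<lambda>w. t *\<^sub>R w 1)" by simp
  qed
qed

text \<open>It transfers moments from the constructed law to a process on an arbitrary probability
  space.\<close>

lemma distr_eq_at_time:
  assumes "levy_process M Y" "levy_exponent M Y (\<lambda>u. - complex_of_real ((Q u \<bullet> u) powr (\<alpha> / 2)))"
    and t: "0 \<le> t"
  shows "distr M borel (Y t) = at_time t"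
proof (rule prob_measure_eqI_char)
  interpret Y: levy_process M Y by fact
  note [measurable] = Y.random_variable[OF t]
  show "prob_space (distr M borel (Y t))" by (rule Y.prob_space_distr) measurable
  fix u :: 'a
  have "charf (distr M borel (Y t)) u = (\<integral>w. iexp (u \<bullet> Y t w) \<partial>M)"
    by (rule integral_distr) measurable
  then show "charf (distr M borel (Y t)) u = charf (at_time t) u"
    using assms(2) t char_mu[OF t, of u] by (simp add: levy_exponent_def)
qed (use t prob_mu sets_mu in auto)

lemma integrable_at_time:
  fixes Y :: "real \<Rightarrow> 'w \<Rightarrow> 'a"
  assumes Y: "levy_process M Y" "levy_exponent M Y (\<lambda>u. - complex_of_real ((Q u \<bullet> u) powr (\<alpha> / 2)))"
  shows "integrable \<mu>\<^sub>1 norm \<Longrightarrow> integrable_process M Y"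
    and "integrable \<mu>\<^sub>1 (\<lambda>x. (norm x)\<^sup>2) \<Longrightarrow> square_integrable_process M Y"
proof -
  interpret Y: levy_process M Y by fact
  have *: "integrable M (\<lambda>w. norm (Y t w) ^ n)" if "integrable \<mu>\<^sub>1 (\<lambda>x. norm x ^ n)" "0 \<le> t" for t n
  proof -
    note [measurable] = Y.random_variable[OF that(2)]
    define c where "c = t powr (1 / \<alpha>)"
    have "integrable \<mu>\<^sub>1 (\<lambda>x. \<bar>c\<bar> ^ n * norm x ^ n)"
      using that(1) by (rule integrable_mult_right)
    then have "integrable (scaled c) (\<lambda>x. norm x ^ n)"
      unfolding scaled_def by (subst integrable_distr_eq) (simp_all add: power_mult_distrib)
    then have "integrable (distr M borel (Y t)) (\<lambda>x. norm x ^ n)"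
      by (simp only: distr_eq_at_time[OF Y that(2)] at_time_def c_def)
    then show ?thesis
      by (rule integrable_distr[rotated]) measurable
  qed
  show "integrable_process M Y" if "integrable \<mu>\<^sub>1 norm"
    unfolding integrable_process_def
  proof (intro allI impI)
    fix t :: real assume t: "0 \<le> t"
    have "integrable M (\<lambda>w. norm (Y t w))"
      using *[of 1 t] that t by simp
    then show "integrable M (Y t)"
      using Y.random_variable[OF t] by (rule integrable_norm_cancel)
  qed
  show "square_integrable_process M Y" if "integrable \<mu>\<^sub>1 (\<lambda>x. (norm x)\<^sup>2)"
    unfolding square_integrable_process_def using *[OF that] by blast
qed

end

section \<open>Moments and the behaviour of the characteristic functional at 0\<close>

context levy_process
begin

lemma rchar_exponent:
  assumes "levy_exponent M Y (\<lambda>u. - complex_of_real (\<psi> u))" "0 \<le> t"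
  shows "rchar t u = exp (- (t * \<psi> u))"
proof -
  note [measurable] = random_variable[OF assms(2)]
  have "integrable M (\<lambda>w. iexp (u \<bullet> Y t w))"
    by (intro integrable_const_bound[of _ 1]) auto
  then have "rchar t u = Re (\<integral>w. iexp (u \<bullet> Y t w) \<partial>M)"
    by (simp add: rchar_def integral_Re[symmetric] Re_exp)
  also have "(\<integral>w. iexp (u \<bullet> Y t w) \<partial>M) = exp (complex_of_real (- (t * \<psi> u)))"
    using assms unfolding levy_exponent_def by simp
  finally show ?thesis by (simp only: exp_of_real Re_complex_of_real)
qed

lemma mean_zero_of_integrable:
  assumes sym: "symmetric_process M Y" and int: "integrable_process M Y"
  shows "mean_zero_process M Y"
  unfolding mean_zero_process_def
proof (intro conjI allI impI int)
  fix t :: real assume t: "0 \<le> t"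
  note [measurable] = random_variable[OF t]
  have "(\<integral>w. Y t w \<partial>M) = (\<integral>x. x \<partial>distr M borel (Y t))"
    by (rule integral_distr[symmetric]) measurable
  also have "\<dots> = (\<integral>x. x \<partial>distr M borel (\<lambda>w. - Y t w))"
    using distr_uminus[OF sym t] by simp
  also have "\<dots> = (\<integral>w. - Y t w \<partial>M)"
    by (rule integral_distr) measurable
  finally have "(\<integral>w. Y t w \<partial>M) = - (\<integral>w. Y t w \<partial>M)" by simp
  then have "2 *\<^sub>R (\<integral>w. Y t w \<partial>M) = 0"
    unfolding scaleR_2 by (simp add: eq_neg_iff_add_eq_0)
  then show "(\<integral>w. Y t w \<partial>M) = 0" by simp
qed

text \<open>Integrates 1 - cos x \<le> x^2. Second moments thus force quadratic behaviour along
  every ray.\<close>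

lemma one_minus_rchar_le:
  assumes "square_integrable_process M Y"
  shows "1 - rchar 1 (s *\<^sub>R u) \<le> s\<^sup>2 * ((norm u)\<^sup>2 * (\<integral>w. (norm (Y 1 w))\<^sup>2 \<partial>M))"
proof -
  have int: "integrable M (\<lambda>w. (norm (Y 1 w))\<^sup>2)"
    using assms by (simp add: square_integrable_process_def)
  have "1 - rchar 1 (s *\<^sub>R u) = (\<integral>w. 1 - cos ((s *\<^sub>R u) \<bullet> Y 1 w) \<partial>M)"
    unfolding rchar_def using integrable_cos[of 1 "s *\<^sub>R u"] by (simp add: prob_space)
  also have "\<dots> \<le> (\<integral>w. s\<^sup>2 * ((norm u)\<^sup>2 * (norm (Y 1 w))\<^sup>2) \<partial>M)"
  proof (rule integral_mono)
    show "integrable M (\<lambda>w. 1 - cos ((s *\<^sub>R u) \<bullet> Y 1 w))"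
      using integrable_cos[of 1 "s *\<^sub>R u"] by (simp del: inner_scaleR_left)
    show "integrable M (\<lambda>w. s\<^sup>2 * ((norm u)\<^sup>2 * (norm (Y 1 w))\<^sup>2))"
      using int by simp
    fix w
    define x where "x = (s *\<^sub>R u) \<bullet> Y 1 w"
    have "1 - cos x = 2 * (sin (x / 2))\<^sup>2"
      using cos_double_sin[of "x / 2"] by simp
    also have "(sin (x / 2))\<^sup>2 \<le> (x / 2)\<^sup>2"
      using abs_sin_x_le_abs_x[of "x / 2"] by (simp only: abs_le_square_iff)
    finally have "1 - cos x \<le> 2 * (x / 2)\<^sup>2" by simp
    also have "\<dots> \<le> x\<^sup>2" by (simp add: power_divide)
    also have "x\<^sup>2 \<le> (norm (s *\<^sub>R u) * norm (Y 1 w))\<^sup>2"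
      unfolding x_def using Cauchy_Schwarz_ineq2[of "s *\<^sub>R u" "Y 1 w"]
      by (subst abs_le_square_iff[symmetric]) simp
    finally show "1 - cos ((s *\<^sub>R u) \<bullet> Y 1 w) \<le> s\<^sup>2 * ((norm u)\<^sup>2 * (norm (Y 1 w))\<^sup>2)"
      by (simp add: x_def power_mult_distrib mult.assoc)
  qed
  also have "\<dots> = s\<^sup>2 * ((norm u)\<^sup>2 * (\<integral>w. (norm (Y 1 w))\<^sup>2 \<partial>M))" by simp
  finally show ?thesis .
qed

text \<open>A first moment makes \<open>rchar 1\<close> differentiable at 0 with derivative 0, here
  in terms of difference quotients at 1 / n: the integrand n (1 - cos (x / n)) tends to 0 and is
  dominated by |x|.\<close>

lemma one_minus_rchar_tendsto:
  assumes "integrable_process M Y"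
  shows "(\<lambda>n. real n * (1 - rchar 1 ((1 / real n) *\<^sub>R u))) \<longlonglongrightarrow> 0"
proof -
  note [measurable] = random_variable[of 1, simplified]
  have int: "integrable M (Y 1)" using assms by (simp add: integrable_process_def)
  define f where "f n w = real n * (1 - cos ((u \<bullet> Y 1 w) / real n))" for n w
  have "(\<lambda>n. \<integral>w. f n w \<partial>M) \<longlonglongrightarrow> (\<integral>w. 0 \<partial>M)"
  proof (rule integral_dominated_convergence[where w = "\<lambda>w. norm u * norm (Y 1 w)"])
    show "integrable M (\<lambda>w. norm u * norm (Y 1 w))" using int by simp
    have "(\<lambda>n. f n w) \<longlonglongrightarrow> 0" for w
      unfolding f_def by real_asymp
    then show "AE w in M. (\<lambda>n. f n w) \<longlonglongrightarrow> 0" by simp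
    fix n
    have "norm (f n w) \<le> norm u * norm (Y 1 w)" for w
    proof (cases "n = 0")
      case False
      have "\<bar>f n w\<bar> = real n * (1 - cos ((u \<bullet> Y 1 w) / real n))"
        unfolding f_def by (intro abs_of_nonneg mult_nonneg_nonneg) auto
      also have "\<dots> \<le> real n * \<bar>(u \<bullet> Y 1 w) / real n\<bar>"
        by (intro mult_left_mono one_minus_cos_le_abs) auto
      also have "\<dots> = \<bar>u \<bullet> Y 1 w\<bar>" using False by simp
      also have "\<dots> \<le> norm u * norm (Y 1 w)" by (rule Cauchy_Schwarz_ineq2)
      finally show ?thesis by simp
    qed (simp add: f_def)
    then show "AE w in M. norm (f n w) \<le> norm u * norm (Y 1 w)" by simp
    show "f n \<in> borel_measurable M" unfolding f_def[abs_def] by measurable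
  qed simp
  moreover have "(\<integral>w. f n w \<partial>M) = real n * (1 - rchar 1 ((1 / real n) *\<^sub>R u))" for n
    unfolding f_def rchar_def using integrable_cos[of 1 "(1 / real n) *\<^sub>R u"] by (simp add: prob_space)
  ultimately show ?thesis by simp
qed

end

text \<open>Near 0 the left side behaves like k s^\<alpha>, which is not O(s^2) when \<alpha> <
  2.\<close>

lemma stable_index_of_square_integrable:
  fixes k \<alpha> C :: real
  assumes "0 < k" "0 < \<alpha>" "\<alpha> \<le> 2" and le: "\<And>s. 0 < s \<Longrightarrow> 1 - exp (- (k * s powr \<alpha>)) \<le> s\<^sup>2 * C"
  shows "\<alpha> = 2"
proof (rule ccontr)
  assume "\<alpha> \<noteq> 2"
  with assms(3) have \<alpha>: "\<alpha> < 2" by simp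
  have "filterlim (\<lambda>s. (1 - exp (- (k * s powr \<alpha>))) / s\<^sup>2) at_top (at_right 0)"
    using \<open>0 < k\<close> \<open>0 < \<alpha>\<close> \<alpha> by real_asymp
  then have "\<forall>\<^sub>F s in at_right 0. C + 1 \<le> (1 - exp (- (k * s powr \<alpha>))) / s\<^sup>2"
    by (simp add: filterlim_at_top)
  then have "\<forall>\<^sub>F s in at_right (0::real). False"
    using eventually_at_right_less[of 0]
  proof eventually_elim
    case (elim s)
    then have "(C + 1) * s\<^sup>2 \<le> 1 - exp (- (k * s powr \<alpha>))"
      by (simp add: pos_le_divide_eq)
    also have "\<dots> \<le> s\<^sup>2 * C" using elim by (intro le)
    finally show False using elim by (simp add: algebra_simps)
  qed
  then show False by simp
qed

text \<open>For \<alpha> \<le> 1 and n \<ge> 1 one has (1 / n)^\<alpha> \<ge> 1 / n, so the sequence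
  is bounded below by n (1 - exp (- k / n)), whose limit is k > 0.\<close>

lemma stable_index_of_integrable:
  fixes k \<alpha> :: real
  assumes "0 < k" "0 < \<alpha>"
    and lim: "(\<lambda>n. real n * (1 - exp (- (k * (1 / real n) powr \<alpha>)))) \<longlonglongrightarrow> 0"
  shows "1 < \<alpha>"
proof (rule ccontr)
  assume "\<not> 1 < \<alpha>"
  then have \<alpha>: "\<alpha> \<le> 1" by simp
  have "(\<lambda>n. real n * (1 - exp (- (k / real n)))) \<longlonglongrightarrow> k"
    using \<open>0 < k\<close> by real_asymp
  then have "k \<le> 0"
  proof (rule LIMSEQ_le[OF _ lim], intro exI[of _ 1] allI impI)
    fix n :: nat assume n: "1 \<le> n"
    have "1 / real n \<le> (1 / real n) powr \<alpha>"
      using powr_mono'[of \<alpha> 1 "1 / real n"] n \<alpha> by simp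
    then have "k / real n \<le> k * (1 / real n) powr \<alpha>"
      using mult_left_mono[of "1 / real n" _ k] \<open>0 < k\<close> by simp
    then show "real n * (1 - exp (- (k / real n))) \<le> real n * (1 - exp (- (k * (1 / real n) powr \<alpha>)))"
      by (intro mult_left_mono) auto
  qed
  with \<open>0 < k\<close> show False by simp
qed

lemma pos_semidef_nonzero:
  assumes Q: "pos_semidef Q" and "Q \<noteq> (\<lambda>_. 0)"
  obtains u where "0 < Q u \<bullet> u"
proof -
  obtain u where "Q u \<noteq> 0" using assms(2) by auto
  then have "Q u \<bullet> u \<noteq> 0" using pos_semidef_eq_0[OF Q] by auto
  then show ?thesis using pos_semidef_nonneg[OF Q, of u] by (intro that[of u]) simp
qed

text \<open>Sufficiency comes from the explicit law \<open>\<mu>\<close>, whose dilations are the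
  laws of \<open>Y t\<close>. For necessity one direction \<open>u\<close> with Q u \<bullet> u > 0,
  available as \<open>Q\<close> is nonzero, is enough: along it the characteristic functional is exp
  (- k s^\<alpha>).\<close>

lemma stable_integrability:
  fixes Q :: "'a::{real_inner, banach, polish_space} \<Rightarrow> 'a" and Y :: "real \<Rightarrow> 'w \<Rightarrow> 'a"
  assumes \<alpha>: "0 < \<alpha>" "\<alpha> \<le> 2" and Q: "pos_semidef Q" "trace_class Q" "Q \<noteq> (\<lambda>_. 0)"
    and Y: "levy_process M Y" and sym: "symmetric_process M Y"
    and expo: "levy_exponent M Y (\<lambda>u. - complex_of_real ((Q u \<bullet> u) powr (\<alpha> / 2)))"
  shows "square_integrable_process M Y \<longleftrightarrow> \<alpha> = 2" "mean_zero_process M Y \<longleftrightarrow> 1 < \<alpha>"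
proof -
  interpret Y: levy_process M Y by fact
  obtain \<mu> where \<mu>: "prob_space \<mu>" "sets \<mu> = sets borel"
    "\<And>u. charf \<mu> u = complex_of_real (exp (- ((Q u \<bullet> u) powr (\<alpha> / 2))))"
    "\<alpha> = 2 \<Longrightarrow> integrable \<mu> (\<lambda>x. (norm x)\<^sup>2)" "1 < \<alpha> \<Longrightarrow> integrable \<mu> norm"
    using stable_law_exists[OF \<alpha> Q(1,2)] by blast
  interpret S: stable_law Q \<alpha> \<mu>
    by (rule stable_law.intro) (use \<alpha> Q \<mu> in auto)
  obtain u where u: "0 < Q u \<bullet> u" using pos_semidef_nonzero[OF Q(1,3)] by blast
  define k where "k = (Q u \<bullet> u) powr (\<alpha> / 2)"
  have k: "0 < k" using u by (simp add: k_def)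
  have r: "Y.rchar 1 (s *\<^sub>R u) = exp (- (k * s powr \<alpha>))" if "0 \<le> s" for s
  proof -
    have "(s * (s * (Q u \<bullet> u))) powr (\<alpha> / 2) = k * s powr \<alpha>"
    proof (cases "s = 0")
      case False
      then have "(s * s) powr (\<alpha> / 2) = s powr \<alpha>"
        using that by (simp add: powr_mult powr_add[symmetric])
      then show ?thesis
        using that u by (simp add: k_def powr_mult mult.assoc[symmetric])
    qed simp
    then show ?thesis
      using Y.rchar_exponent[OF expo, of 1 "s *\<^sub>R u"] by (simp add: pos_semidef_linear[OF Q(1)])
  qed
  show "square_integrable_process M Y \<longleftrightarrow> \<alpha> = 2"
  proof
    assume "square_integrable_process M Y"
    then have "1 - exp (- (k * s powr \<alpha>)) \<le> s\<^sup>2 * ((norm u)\<^sup>2 * (\<integral>w. (norm (Y 1 w))\<^sup>2 \<partial>M))"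
      if "0 < s" for s
      using Y.one_minus_rchar_le[of s u] r[of s] that by simp
    with k \<alpha> show "\<alpha> = 2" by (rule stable_index_of_square_integrable)
  qed (use S.integrable_at_time(2)[OF Y expo] \<mu>(4) in blast)
  show "mean_zero_process M Y \<longleftrightarrow> 1 < \<alpha>"
  proof
    assume "mean_zero_process M Y"
    then have "integrable_process M Y" by (simp add: mean_zero_process_def)
    from Y.one_minus_rchar_tendsto[OF this, of u] show "1 < \<alpha>"
      by (intro stable_index_of_integrable[OF k \<alpha>(1)]) (simp add: r)
  next
    assume "1 < \<alpha>"
    then show "mean_zero_process M Y"
      by (intro Y.mean_zero_of_integrable[OF sym] S.integrable_at_time(1)[OF Y expo] \<mu>(5))
  qed
qed

lemma stable_existence:
  fixes Q :: "'a::{real_inner, banach, polish_space} \<Rightarrow> 'a"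
  assumes \<alpha>: "0 < \<alpha>" "\<alpha> \<le> 2" and Q: "pos_semidef Q" "trace_class Q"
  shows "\<exists>(M :: (real \<Rightarrow> 'a) measure) (Y :: real \<Rightarrow> (real \<Rightarrow> 'a) \<Rightarrow> 'a).
     levy_process M Y \<and> symmetric_process M Y \<and> strictly_stable \<alpha> M Y \<and>
     levy_exponent M Y (\<lambda>u. - complex_of_real ((Q u \<bullet> u) powr (\<alpha> / 2)))"
proof -
  obtain \<mu> where \<mu>: "prob_space \<mu>" "sets \<mu> = sets borel"
    "\<And>u. charf \<mu> u = complex_of_real (exp (- ((Q u \<bullet> u) powr (\<alpha> / 2))))"
    using stable_law_exists[OF \<alpha> Q] by metis
  interpret S: stable_law Q \<alpha> \<mu>
    by (rule stable_law.intro) (use \<alpha> Q \<mu> in auto)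
  show ?thesis using S.stable_process_exists by blast
qed

text \<open>The process is constructed on the path space \<open>real \<Rightarrow> 'a\<close>,
  whereas the moment criteria and the second part concern processes on an arbitrary sample space
  \<open>'w\<close>.\<close>

theorem theorem4p7:
  shows
    "(\<forall>\<alpha> (Q :: 'a::{real_inner, banach, polish_space} \<Rightarrow> 'a).
        0 < \<alpha> \<and> \<alpha> \<le> 2 \<and> pos_semidef Q \<and> trace_class Q \<and> Q \<noteq> (\<lambda>_. 0) \<longrightarrow>
        (\<exists>(M :: (real \<Rightarrow> 'a) measure) (Y :: real \<Rightarrow> (real \<Rightarrow> 'a) \<Rightarrow> 'a).
           levy_process M Y \<and> symmetric_process M Y \<and> strictly_stable \<alpha> M Y \<and>
           levy_exponent M Y (\<lambda>u. - complex_of_real ((Q u \<bullet> u) powr (\<alpha> / 2)))) \<and>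
        (\<forall>(M :: 'w measure) (Y :: real \<Rightarrow> 'w \<Rightarrow> 'a).
           levy_process M Y \<and> symmetric_process M Y \<and> strictly_stable \<alpha> M Y \<and>
           levy_exponent M Y (\<lambda>u. - complex_of_real ((Q u \<bullet> u) powr (\<alpha> / 2))) \<longrightarrow>
           (square_integrable_process M Y \<longleftrightarrow> \<alpha> = 2) \<and>
           (mean_zero_process M Y \<longleftrightarrow> 1 < \<alpha>)))
     \<and>
     (\<forall>\<alpha> (M :: 'w measure) (Y :: real \<Rightarrow> 'w \<Rightarrow> 'a).
        0 \<le> \<alpha> \<and> levy_process M Y \<and> symmetric_process M Y \<and> strictly_stable \<alpha> M Y \<and>
        nontrivial_process M Y \<longrightarrow>
        (0 < \<alpha> \<and> \<alpha> \<le> 2) \<and>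
        (\<exists>f :: 'a \<Rightarrow> real.
           continuous_on (sphere 0 1) f \<and>
           (\<forall>v\<in>sphere 0 1. 0 \<le> f v \<and> f (- v) = f v) \<and>
           (\<exists>\<rho>. levy_exponent M Y \<rho> \<and> \<rho> 0 = 0 \<and>
              (\<forall>u. u \<noteq> 0 \<longrightarrow> \<rho> u = - complex_of_real (norm u powr \<alpha> * f (u /\<^sub>R norm u))))))"
  by (intro conjI allI impI; elim conjE)
    (rule stable_existence stable_integrability levy_process.stable_index_range
      levy_process.stable_levy_exponent; assumption)+

end
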